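(* Let $\mathcal H$ be a complex Hilbert space, let $k$ be a positive integer with $k<\dim\mathcal H$, and let $\mathbf A=(A_1,\dots,A_m)$ be an $m$-tuple of bounded self-adjoint operators on $\mathcal H$. (a) Suppose $\dim\mathcal H=2$. Then $W_k(\mathbf A)$ is convex if and only if the span of $\{I,A_1,\dots,A_m\}$ has dimension at most $3$. (b) Suppose $\dim\mathcal H\ge3$. If the span of $\{I,A_1,\dots,A_m\}$ has dimension at most $4$, then $W_k(\mathbf A)$ is convex. In particular, $W_k(A_1,A_2,A_3)$ is always convex. (c) Suppose $\dim\mathcal H\ge3$. If the span of $\{I,A_1,\dots,A_m\}$ has dimension at least $4$, then there is a bounded operator $A_0$ on $\mathcal H$ such that $W_k(A_0,A_1,\dots,A_m)$ is not convex.
   Context: For an $m$-tuple $\mathbf A=(A_1,\dots,A_m)$ of bounded operators on $\mathcal H$ and a positive integer $k\le\dim\mathcal H$, the joint $k$-numerical range is $$W_k(\mathbf A)=\Big\{\Big(\sum_{\ell=1}^k\langle A_1x_\ell,x_\ell\rangle,\dots,\sum_{\ell=1}^k\langle A_mx_\ell,x_\ell\rangle\Big):\{x_1,\dots,x_k\}\subseteq\mathcal H\text{ orthonormal}\Big\}.$$ $I$ is the identity operator on $\mathcal H$. *)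

theory Defs
  imports "HOL-Analysis.Analysis" "HOL-Library.Function_Algebras" "HOL-Library.Extended_Nat"
begin

class complex_vector = ab_group_add +
  fixes scaleC :: "complex \<Rightarrow> 'a \<Rightarrow> 'a"
  assumes scaleC_add_right: "scaleC c (x + y) = scaleC c x + scaleC c y"
    and scaleC_add_left: "scaleC (c + d) x = scaleC c x + scaleC d x"
    and scaleC_scaleC: "scaleC c (scaleC d x) = scaleC (c * d) x"
    and scaleC_one: "scaleC 1 x = x"

global_interpretation cvs: vector_space "scaleC :: complex \<Rightarrow> 'a \<Rightarrow> 'a::complex_vector"
  by unfold_locales (rule scaleC_add_right scaleC_add_left scaleC_scaleC scaleC_one)+

text \<open>The library's dimension \<open>cvs.dim\<close> is a natural number, with junk value 0 for
  infinite-dimensional sets; \<open>cdim\<close> separates the infinite case. For a Hilbert space the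
  (orthonormal) dimension and the algebraic one agree when finite and are infinite
  simultaneously, so as far as comparisons with natural numbers go \<open>cdim UNIV\<close> is the
  Hilbert space dimension.\<close>

definition cdim :: "'a::complex_vector set \<Rightarrow> enat" where
  "cdim V = (if \<exists>B. finite B \<and> V \<subseteq> cvs.span B then enat (cvs.dim V) else \<infinity>)"

instantiation "fun" :: (type, complex_vector) complex_vector
begin

definition scaleC_fun :: "complex \<Rightarrow> ('a \<Rightarrow> 'b) \<Rightarrow> 'a \<Rightarrow> 'b" where
  "scaleC_fun c f = (\<lambda>x. scaleC c (f x))"

instance
  by standard
    (auto simp: scaleC_fun_def scaleC_add_right scaleC_add_left scaleC_scaleC scaleC_one)

end

text \<open>Inner products are linear in the first argument.\<close>

class complex_inner = real_normed_vector + complex_vector +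
  fixes cinner :: "'a \<Rightarrow> 'a \<Rightarrow> complex"
  assumes scaleR_scaleC: "scaleR r x = scaleC (complex_of_real r) x"
    and cinner_commute: "cinner x y = cnj (cinner y x)"
    and cinner_add_left: "cinner (x + y) z = cinner x z + cinner y z"
    and cinner_scaleC_left: "cinner (scaleC c x) y = c * cinner x y"
    and cinner_self: "cinner x x = complex_of_real ((norm x)\<^sup>2)"

class complex_hilbert = complex_inner + complete_space

definition bounded_clinear :: "('a::complex_inner \<Rightarrow> 'a) \<Rightarrow> bool" where
  "bounded_clinear T \<longleftrightarrow> bounded_linear T \<and> (\<forall>c x. T (scaleC c x) = scaleC c (T x))"

definition selfadjoint :: "('a::complex_inner \<Rightarrow> 'a) \<Rightarrow> bool" where
  "selfadjoint T \<longleftrightarrow> (\<forall>x y. cinner (T x) y = cinner x (T y))"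

definition orthonormal :: "nat \<Rightarrow> (nat \<Rightarrow> 'a::complex_inner) \<Rightarrow> bool" where
  "orthonormal k x \<longleftrightarrow>
    (\<forall>i\<in>{1..k}. \<forall>j\<in>{1..k}. cinner (x i) (x j) = (if i = j then 1 else 0))"

text \<open>A tuple is a family over a finite index type \<open>'m\<close>. Since the operators need not be
  self-adjoint, the range lies in complex coordinate space, on which convexity is understood
  with respect to real scalars.\<close>

definition joint_num_range ::
    "nat \<Rightarrow> ('m::finite \<Rightarrow> 'a::complex_inner \<Rightarrow> 'a) \<Rightarrow> (complex ^ 'm) set" where
  "joint_num_range k A =
    {(\<chi> i. \<Sum>l=1..k. cinner (A i (x l)) (x l)) | x. orthonormal k x}"

end

theory Submission
  imports Defs
begin

text \<open>
  \<^emph>\<open>Convexity.\<close> After extracting a basis of the span that contains the identity, it suffices to treat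
  three self-adjoint operators. For \<open>k = 1\<close> and unit vectors \<open>x\<close>, \<open>y\<close>, an affine change of
  coordinates turns the problem into finding, between \<open>x\<close> and \<open>y\<close>, a common zero of a complex form
  \<open>T\<close> vanishing at both and of a real form \<open>C\<close> of opposite signs there. With a third vector
  orthogonal to both, \<open>T\<close> has a normal form whose zero set contains an explicit path from \<open>x\<close> to
  \<open>y\<close>, and the intermediate value theorem applies to \<open>C\<close>. For \<open>k + 1 = dim\<close>, pass to orthogonal
  complements. Otherwise principal vectors split two \<open>k\<close>-frames into \<open>k\<close> mutually orthogonal planes;
  on each plane the forms are affine functions on a Bloch ball, and as two balls have
  dimension 6 > 3, all but one of the \<open>k\<close> mixed states can be made pure. The last one is purified by
  the case \<open>k = 1\<close>.

  \<^emph>\<open>Failure of convexity.\<close> If the identity and three of the operators are independent, some plane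
  \<open>M\<close> separates them: at a plane where the restriction map has maximal rank \<open>< 4\<close>, a first or second
  order perturbation along a form vanishing on \<open>M\<close> would increase the rank. Choosing
  \<open>A0 = P + Q\<close> with \<open>Q\<close> the projection onto a \<open>(k - 1)\<close>-dimensional space \<open>E\<close> orthogonal to \<open>M\<close>
  and \<open>P\<close> the projection onto the sum of \<open>E\<close> and \<open>M\<close>, the face where the trace of \<open>A0\<close> is
  maximal is the image of the Bloch sphere of \<open>M\<close> under an injective affine map, and it misses the
  image of the centre.
\<close>

subsection \<open>Isotropic vectors of a pair of Hermitian forms\<close>

lemma path_sign_change:
  fixes G :: "complex \<times> complex \<times> complex \<Rightarrow> real" and \<gamma> :: "real \<Rightarrow> complex \<times> complex \<times> complex"
  assumes "continuous_on UNIV G" "continuous_on {0..1} \<gamma>" "G (\<gamma> 0) \<ge> 0" "G (\<gamma> 1) \<le> 0"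
  obtains t where "0 \<le> t" "t \<le> 1" "G (\<gamma> t) = 0"
proof -
  have "continuous_on {0..1} (\<lambda>t. G (\<gamma> t))"
    using continuous_on_compose2[OF assms(1,2)] by simp
  then show thesis
    using IVT2'[of "\<lambda>t. G (\<gamma> t)" 1 0 0] assms that by auto
qed

text \<open>Lets a point of a path, given as one term, be the witness for three quantifiers.\<close>

lemma exI3: "P (fst v) (fst (snd v)) (snd (snd v)) \<Longrightarrow> \<exists>a b c. P a b c"
  by blast

text \<open>The equation is affine over the reals in \<open>b\<close> for given \<open>a\<close> and \<open>c\<close>. The path \<open>\<gamma>\<close> is its
  solution, cleared of denominators, with \<open>a\<close> and \<open>c\<close> real and \<open>a / c\<close> decreasing from infinity to the
  first value where \<open>b\<close> is no longer unique; there either \<open>b\<close> becomes infinite, or a line of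
  solutions \<open>b\<close> leads on to infinity along \<open>\<delta>\<close>.\<close>

lemma normal_form_common_zero:
  fixes q r u :: complex and G :: "complex \<times> complex \<times> complex \<Rightarrow> real"
  assumes G: "continuous_on UNIV G" "G (1, 0, 0) > 0" "\<And>b. b \<noteq> 0 \<Longrightarrow> G (0, b, 0) < 0"
    and r: "r = 0 \<or> r = 1"
  shows "\<exists>a b c. (a, b, c) \<noteq> 0 \<and> a * cnj b + q * cnj a * c + r * b * cnj c + u * c * cnj c = 0
    \<and> G (a, b, c) = 0"
proof -
  \<comment> \<open>For real \<open>a, c \<ge> 0\<close>, not both zero, the solution
    \<open>b\<close> is unique except at \<open>a = c\<close> if \<open>r = 1\<close> and at
    \<open>a = 0\<close> if \<open>r = 0\<close>. The second condition of each case decides whether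
    \<open>b\<close> blows up there or becomes partly or wholly free.\<close>
  consider (1) "r = 1" "Im q + Im u \<noteq> 0" | (2) "r = 1" "Im q + Im u = 0"
    | (3) "r = 0" "u \<noteq> 0" | (4) "r = 0" "u = 0"
    using r by blast
  then show ?thesis
  proof cases
    case 1
    define \<gamma> where "\<gamma> = (\<lambda>t::real. (complex_of_real ((1 + t) * (1 - t)),
      Complex (-(Re q * t + Re u * t^2) * (1 - t)) ((Im q * t + Im u * t^2) * (1 + t)),
      complex_of_real (t * (1 - t) * (1 + t))))"
    have cont: "continuous_on {0..1} \<gamma>"
      unfolding \<gamma>_def Complex_eq by (intro continuous_intros)
    have "\<gamma> 1 = (0, Complex 0 (2 * (Im q + Im u)), 0)"
      by (simp add: \<gamma>_def)
    moreover have "\<gamma> 0 = (1, 0, 0)"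
      by (simp add: \<gamma>_def complex_eq_iff)
    ultimately have e: "G (\<gamma> 0) > 0" "G (\<gamma> 1) < 0"
      using G 1 by (simp_all add: Complex_eq_0)
    then obtain t where t: "0 \<le> t" "t \<le> 1" "G (\<gamma> t) = 0"
      using path_sign_change[OF G(1) cont] by force
    with e have "t \<noteq> 1" by auto
    with t have "(1 + t) * (1 - t) \<noteq> 0" by auto
    with t(3) show ?thesis
      by (intro exI3[of _ "\<gamma> t"])
        (simp add: \<gamma>_def 1 complex_eq_iff prod_eq_iff, simp add: algebra_simps power2_eq_square)
  next
    case 2
    define \<gamma> where "\<gamma> = (\<lambda>t::real. (1::complex,
      Complex (-(Re q * t + Re u * t^2) / (1 + t)) (Im q * t), complex_of_real t))"
    \<comment> \<open>At \<open>a = c\<close> only \<open>Re b\<close> is determined. The path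
      \<open>\<delta>\<close> keeps it and sends \<open>Im b\<close> to infinity, all coordinates
      being rescaled by \<open>1 - t\<close>.\<close>
    define \<delta> where "\<delta> = (\<lambda>t::real. (complex_of_real (1 - t),
      Complex ((1 - t) * (-(Re q + Re u) / 2)) ((1 - t) * Im q + t), complex_of_real (1 - t)))"
    have cont: "continuous_on {0..1} \<gamma>" "continuous_on {0..1} \<delta>"
      unfolding \<gamma>_def \<delta>_def Complex_eq by (intro continuous_intros; force)+
    have e: "G (\<gamma> 0) > 0" "G (\<delta> 1) < 0" "\<delta> 0 = \<gamma> 1"
      using G by (simp_all add: \<gamma>_def \<delta>_def Complex_eq add_divide_distrib)
    show ?thesis
    proof (cases "G (\<gamma> 1) \<le> 0")
      case True
      then obtain t where t: "0 \<le> t" "t \<le> 1" "G (\<gamma> t) = 0"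
        using path_sign_change[OF G(1) cont(1)] e by force
      have "1 + t \<noteq> 0" using t by auto
      have [simp]: "Im u = - Im q" using 2 by simp
      define \<beta> where "\<beta> = -(Re q * t + Re u * t^2) / (1 + t)"
      have \<beta>: "\<beta> = - (Re q * t) - Re u * (t * t) - t * \<beta>"
        using \<open>1 + t \<noteq> 0\<close> by (simp add: \<beta>_def field_simps power2_eq_square)
      have "\<gamma> t = (1, Complex \<beta> (Im q * t), of_real t)"
        by (simp add: \<gamma>_def \<beta>_def)
      with t(3) have "G (1, Complex \<beta> (Im q * t), of_real t) = 0" by simp
      then show ?thesis
        using 2 \<beta> by (intro exI3[of _ "(1, Complex \<beta> (Im q * t), of_real t)"]) (simp add: complex_eq_iff prod_eq_iff algebra_simps)
    next
      case False
      then obtain t where t: "0 \<le> t" "t \<le> 1" "G (\<delta> t) = 0"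
        using path_sign_change[OF G(1) cont(2)] e by force
      with e have "t \<noteq> 1" by auto
      have [simp]: "Im u = - Im q" using 2 by simp
      from t(3) \<open>t \<noteq> 1\<close> show ?thesis
        by (intro exI3[of _ "\<delta> t"])
          (simp add: \<delta>_def 2 complex_eq_iff prod_eq_iff, simp add: field_simps power2_eq_square)
    qed
  next
    case 3
    define \<gamma> where "\<gamma> = (\<lambda>t::real. (complex_of_real ((1 - t)^2),
      - (cnj q * of_real ((1 - t) * t) + cnj u * of_real (t^2)), complex_of_real (t * (1 - t))))"
    have "continuous_on {0..1} \<gamma>"
      unfolding \<gamma>_def by (intro continuous_intros)
    moreover have e: "G (\<gamma> 0) > 0" "G (\<gamma> 1) < 0"
      using G 3 by (simp_all add: \<gamma>_def)
    ultimately obtain t where t: "0 \<le> t" "t \<le> 1" "G (\<gamma> t) = 0"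
      using path_sign_change[OF G(1), of \<gamma>] by force
    with e have "t \<noteq> 1" by auto
    with t(3) show ?thesis
      by (intro exI3[of _ "\<gamma> t"])
        (simp add: \<gamma>_def 3 complex_eq_iff prod_eq_iff, simp add: algebra_simps power2_eq_square)
  next
    case 4
    define \<gamma> where "\<gamma> = (\<lambda>t::real. (complex_of_real (1 - t), - cnj q * of_real t, complex_of_real t))"
    define \<delta> where "\<delta> = (\<lambda>t::real. (0::complex,
      - cnj q * of_real (1 - t) + of_real t, complex_of_real (1 - t)))"
    have cont: "continuous_on {0..1} \<gamma>" "continuous_on {0..1} \<delta>"
      unfolding \<gamma>_def \<delta>_def by (intro continuous_intros)+
    have e: "G (\<gamma> 0) > 0" "G (\<delta> 1) < 0" "\<delta> 0 = \<gamma> 1"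
      using G by (simp_all add: \<gamma>_def \<delta>_def)
    show ?thesis
    proof (cases "G (\<gamma> 1) \<le> 0")
      case True
      then obtain t where t: "0 \<le> t" "t \<le> 1" "G (\<gamma> t) = 0"
        using path_sign_change[OF G(1) cont(1)] e by force
      then show ?thesis
        by (intro exI3[of _ "\<gamma> t"])
          (auto simp add: \<gamma>_def 4 complex_eq_iff prod_eq_iff algebra_simps)
    next
      case False
      then obtain t where t: "0 \<le> t" "t \<le> 1" "G (\<delta> t) = 0"
        using path_sign_change[OF G(1) cont(2)] e by force
      with e have "t \<noteq> 1" by auto
      with t(3) show ?thesis
        by (intro exI3[of _ "\<delta> t"])
          (simp add: \<delta>_def 4 complex_eq_iff prod_eq_iff)
    qed
  qed
qed

text \<open>As \<open>norm t12 \<noteq> norm t21\<close>, no zeros are gained by passing from the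
  form \<open>F\<close> to \<open>cnj t12 * F - t21 * cnj F\<close>, in which the term with
  \<open>cnj a * b\<close> cancels. A shear and a scaling of \<open>c\<close> then lead to the
  normal form.\<close>

lemma hermitian_form_common_zero:
  fixes t12 t21 t13 t31 t23 t32 t33 :: complex and G :: "complex \<times> complex \<times> complex \<Rightarrow> real"
  assumes G: "continuous_on UNIV G" "G (1, 0, 0) > 0" "\<And>b. b \<noteq> 0 \<Longrightarrow> G (0, b, 0) < 0"
    and ne: "norm t12 \<noteq> norm t21"
  shows "\<exists>a b c. (a, b, c) \<noteq> 0 \<and> a * cnj b * t12 + cnj a * b * t21 + a * cnj c * t13 + cnj a * c * t31
    + b * cnj c * t23 + cnj b * c * t32 + c * cnj c * t33 = 0 \<and> G (a, b, c) = 0"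
proof -
  define D where "D = t12 * cnj t12 - t21 * cnj t21"
  have "D = of_real ((norm t12)\<^sup>2 - (norm t21)\<^sup>2)"
    by (simp only: D_def of_real_diff complex_norm_square)
  moreover have "(norm t12)\<^sup>2 \<noteq> (norm t21)\<^sup>2"
    using ne by (simp add: power2_eq_iff_nonneg)
  ultimately have D: "D \<noteq> 0" "cnj D = D"
    by (metis eq_iff_diff_eq_0 of_real_eq_0_iff, metis complex_cnj_complex_of_real)
  define F where "F = (\<lambda>a b c. a * cnj b * t12 + cnj a * b * t21 + a * cnj c * t13 + cnj a * c * t31
    + b * cnj c * t23 + cnj b * c * t32 + c * cnj c * t33)"
  define p where "p = (cnj t12 * t13 - t21 * cnj t31) / D"
  define q where "q = (cnj t12 * t31 - t21 * cnj t13) / D"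
  define r where "r = (cnj t12 * t23 - t21 * cnj t32) / D"
  define s where "s = (cnj t12 * t32 - t21 * cnj t23) / D"
  define u where "u = (cnj t12 * t33 - t21 * cnj t33) / D"
  \<comment> \<open>Scales \<open>c\<close> so that the coefficient of \<open>b * cnj c\<close>
    becomes \<open>0\<close> or \<open>1\<close>.\<close>
  define \<kappa> where "\<kappa> = (if r = 0 then 1 else inverse (cnj r))"
  have \<kappa>: "\<kappa> \<noteq> 0" "r * cnj \<kappa> = 0 \<or> r * cnj \<kappa> = 1" by (auto simp: \<kappa>_def)
  have F': "cnj t12 * F a b c - t21 * cnj (F a b c) =
      D * (a * cnj b + p * a * cnj c + q * cnj a * c + r * b * cnj c + s * cnj b * c + u * c * cnj c)"
    for a b c
    unfolding p_def q_def r_def s_def u_def using D(1)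
    by (simp add: F_def distrib_left) (simp add: D_def algebra_simps)
  \<comment> \<open>The shifts of \<open>a\<close> and \<open>b\<close> absorb the terms with
    \<open>p\<close> and \<open>s\<close>. Vectors with \<open>c = 0\<close> are fixed, so the sign
    conditions on \<open>G\<close> survive.\<close>
  define m where "m = (\<lambda>(a, b, c). (a - s * \<kappa> * c, b - cnj p * \<kappa> * c, \<kappa> * c))"
  have "continuous_on UNIV m"
    unfolding m_def case_prod_beta by (intro continuous_intros)
  then have "continuous_on UNIV (\<lambda>v. G (m v))"
    using continuous_on_compose2[OF G(1)] by auto
  then obtain a b c where abc: "(a, b, c) \<noteq> 0"
    "a * cnj b + (q * \<kappa>) * cnj a * c + (r * cnj \<kappa>) * b * cnj c
      + ((u - q * cnj s - r * cnj p - s * p) * \<kappa> * cnj \<kappa>) * c * cnj c = 0"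
    "G (m (a, b, c)) = 0"
    using normal_form_common_zero[of "\<lambda>v. G (m v)" "r * cnj \<kappa>" "q * \<kappa>"
        "(u - q * cnj s - r * cnj p - s * p) * \<kappa> * cnj \<kappa>"] \<kappa>(2) G(2,3)
    by (auto simp: m_def)
  define a' b' c' where "a' = a - s * \<kappa> * c" and "b' = b - cnj p * \<kappa> * c" and "c' = \<kappa> * c"
  have "(a', b', c') \<noteq> 0"
    using abc(1) \<kappa>(1) by (auto simp: a'_def b'_def c'_def prod_eq_iff)
  moreover have "G (a', b', c') = 0"
    using abc(3) by (simp add: m_def a'_def b'_def c'_def)
  moreover have "F a' b' c' = 0"
  proof -
    have "a' * cnj b' + p * a' * cnj c' + q * cnj a' * c' + r * b' * cnj c' + s * cnj b' * c' + u * c' * cnj c' = 0"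
      using abc(2) by (simp add: a'_def b'_def c'_def algebra_simps)
    with F'[of a' b' c'] have "cnj t12 * F a' b' c' = t21 * cnj (F a' b' c')" by simp
    then have "norm t12 * norm (F a' b' c') = norm t21 * norm (F a' b' c')"
      by (metis norm_mult complex_mod_cnj)
    with ne show ?thesis by simp
  qed
  ultimately show ?thesis unfolding F_def by blast
qed

subsection \<open>Complex inner products\<close>

lemma cinner_add_right: "cinner x (y + z) = cinner x y + cinner x z"
  by (metis cinner_add_left cinner_commute complex_cnj_add)

lemma cinner_scaleC_right: "cinner x (scaleC c y) = cnj c * cinner x y"
  by (metis cinner_commute cinner_scaleC_left complex_cnj_mult)

lemma cinner_zero_left [simp]: "cinner 0 y = 0"
  using cinner_add_left[of 0 0 y] by simp

lemma cinner_zero_right [simp]: "cinner y 0 = 0"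
  using cinner_add_right[of y 0 0] by simp

lemma cinner_minus_left: "cinner (- x) y = - cinner x y"
  using cinner_add_left[of x "- x" y] by (simp add: eq_neg_iff_add_eq_0 add.commute)

lemma cinner_minus_right: "cinner x (- y) = - cinner x y"
  using cinner_add_right[of x y "- y"] by (simp add: eq_neg_iff_add_eq_0 add.commute)

lemma cinner_diff_left: "cinner (x - y) z = cinner x z - cinner y z"
  using cinner_add_left[of x "- y" z] by (simp add: cinner_minus_left)

lemma cinner_diff_right: "cinner x (y - z) = cinner x y - cinner x z"
  using cinner_add_right[of x y "- z"] by (simp add: cinner_minus_right)

lemma cinner_sum_left: "cinner (\<Sum>i\<in>S. f i) y = (\<Sum>i\<in>S. cinner (f i) y)"
  by (induction S rule: infinite_finite_induct) (simp_all add: cinner_add_left)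

lemma cinner_sum_right: "cinner y (\<Sum>i\<in>S. f i) = (\<Sum>i\<in>S. cinner y (f i))"
  by (induction S rule: infinite_finite_induct) (simp_all add: cinner_add_right)

lemmas cinner_simps = cinner_add_left cinner_add_right cinner_scaleC_left cinner_scaleC_right
  cinner_minus_left cinner_minus_right cinner_diff_left cinner_diff_right
  cinner_sum_left cinner_sum_right

lemma cinner_eq_zero_iff [simp]: "cinner x x = 0 \<longleftrightarrow> x = 0"
  by (simp add: cinner_self)

lemma cinner_eq_one_iff: "cinner x x = 1 \<longleftrightarrow> norm x = 1"
proof -
  have "(norm x)\<^sup>2 = 1 \<longleftrightarrow> norm x = 1"
    using power2_eq_iff_nonneg[of "norm x" 1] by simp
  then show ?thesis unfolding cinner_self of_real_eq_1_iff .
qed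

lemma norm_scaleC [simp]: "norm (scaleC c (x::'a::complex_inner)) = norm c * norm x"
proof -
  have "cinner (scaleC c x) (scaleC c x) = (c * cnj c) * cinner x x"
    by (simp add: cinner_simps mult_ac)
  then have "complex_of_real ((norm (scaleC c x))\<^sup>2) = of_real ((norm c * norm x)\<^sup>2)"
    unfolding cinner_self complex_norm_square[symmetric] by (simp only: power_mult_distrib of_real_mult)
  then show ?thesis
    unfolding of_real_eq_iff by (simp add: power2_eq_iff_nonneg)
qed

lemma cinner_zero_commute: "cinner x y = 0 \<longleftrightarrow> cinner y x = 0"
  by (metis cinner_commute complex_cnj_zero_iff)

definition clinear :: "('a::complex_vector \<Rightarrow> 'a) \<Rightarrow> bool" where
  "clinear T \<longleftrightarrow> (\<forall>x y. T (x + y) = T x + T y) \<and> (\<forall>c x. T (scaleC c x) = scaleC c (T x))"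

lemma clinear_add: "clinear T \<Longrightarrow> T (x + y) = T x + T y"
  and clinear_scaleC: "clinear T \<Longrightarrow> T (scaleC c x) = scaleC c (T x)"
  by (simp_all add: clinear_def)

lemma clinear_zero: "clinear T \<Longrightarrow> T 0 = 0"
  using clinear_add[of T 0 0] by simp

lemma clinear_sum: "clinear T \<Longrightarrow> T (\<Sum>i\<in>S. f i) = (\<Sum>i\<in>S. T (f i))"
  by (induction S rule: infinite_finite_induct) (simp_all add: clinear_add clinear_zero)

lemma bounded_clinear_imp_clinear: "bounded_clinear T \<Longrightarrow> clinear T"
  by (auto simp: bounded_clinear_def clinear_def linear_simps)

lemma selfadjoint_cnj: "selfadjoint T \<Longrightarrow> cnj (cinner (T x) y) = cinner (T y) x"
  by (metis cinner_commute selfadjoint_def)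

lemma selfadjoint_real: "selfadjoint T \<Longrightarrow> cinner (T x) x = of_real (Re (cinner (T x) x))"
  by (metis Reals_cnj_iff of_real_Re selfadjoint_cnj)

subsection \<open>Orthonormal frames\<close>

text \<open>For orthonormal \<open>w 1, ..., w k\<close> this is the orthogonal projection onto
  their span. Membership of \<open>v\<close> in the span is expressed as
  \<open>proj k w v = v\<close>.\<close>

definition proj :: "nat \<Rightarrow> (nat \<Rightarrow> 'a::complex_inner) \<Rightarrow> 'a \<Rightarrow> 'a" where
  "proj k w v = (\<Sum>l=1..k. scaleC (cinner v (w l)) (w l))"

lemma orthonormal_cinner:
  "orthonormal k w \<Longrightarrow> i \<in> {1..k} \<Longrightarrow> j \<in> {1..k} \<Longrightarrow> cinner (w i) (w j) = (if i = j then 1 else 0)"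
  by (simp add: orthonormal_def)

lemma orthonormal_norm: "orthonormal k w \<Longrightarrow> l \<in> {1..k} \<Longrightarrow> norm (w l) = 1"
  by (simp add: orthonormal_cinner flip: cinner_eq_one_iff)

lemma orthonormal_mono: "orthonormal k w \<Longrightarrow> j \<le> k \<Longrightarrow> orthonormal j w"
  by (auto simp: orthonormal_def)

lemma orthonormal_extend:
  assumes "orthonormal k w" "norm z = 1" "\<And>l. l \<in> {1..k} \<Longrightarrow> cinner z (w l) = 0"
  shows "orthonormal (Suc k) (w(Suc k := z))"
  unfolding orthonormal_def using assms
  by (auto simp: orthonormal_cinner orthonormal_norm cinner_eq_one_iff le_Suc_eq cinner_zero_commute[of _ z])

lemma cinner_comb:
  assumes "orthonormal k w" "m \<in> {1..k}"
  shows "cinner (\<Sum>l=1..k. scaleC (c l) (w l)) (w m) = c m"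
proof -
  have "(\<Sum>l=1..k. c l * cinner (w l) (w m)) = (\<Sum>l=1..k. if l = m then c l else 0)"
    using assms by (intro sum.cong) (auto simp: orthonormal_cinner)
  then show ?thesis using assms(2) by (simp add: cinner_simps)
qed

lemma cinner_proj:
  assumes "orthonormal k w" "m \<in> {1..k}"
  shows "cinner (proj k w v) (w m) = cinner v (w m)"
  unfolding proj_def using cinner_comb[OF assms, of "\<lambda>l. cinner v (w l)"] .

lemma cinner_proj_right:
  "cinner x (proj k w v) = (\<Sum>l=1..k. cinner x (w l) * cnj (cinner v (w l)))"
  by (simp add: proj_def cinner_simps mult.commute)

lemma norm_diff_proj:
  assumes "orthonormal k w"
  shows "(norm (v - proj k w v))\<^sup>2 = (norm v)\<^sup>2 - (\<Sum>l=1..k. (cmod (cinner v (w l)))\<^sup>2)"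
proof -
  have "cinner (v - proj k w v) (v - proj k w v) = cinner v v - cinner v (proj k w v)
      - (cinner (proj k w v) v - cinner (proj k w v) (proj k w v))"
    by (simp add: cinner_simps)
  also have "cinner (proj k w v) (proj k w v) = (\<Sum>l=1..k. cinner v (w l) * cnj (cinner v (w l)))"
    unfolding cinner_proj_right[of "proj k w v"] using assms by (intro sum.cong) (auto simp: cinner_proj)
  also have "cinner (proj k w v) v = cnj (cinner v (proj k w v))" by (rule cinner_commute)
  also have "cinner v (proj k w v) = (\<Sum>l=1..k. cinner v (w l) * cnj (cinner v (w l)))"
    by (rule cinner_proj_right)
  also have "(\<Sum>l=1..k. cinner v (w l) * cnj (cinner v (w l)))
      = of_real (\<Sum>l=1..k. (cmod (cinner v (w l)))\<^sup>2)"
    unfolding of_real_sum by (intro sum.cong refl) (simp only: complex_norm_square)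
  finally have "complex_of_real ((norm (v - proj k w v))\<^sup>2)
      = of_real ((norm v)\<^sup>2 - (\<Sum>l=1..k. (cmod (cinner v (w l)))\<^sup>2))"
    by (simp add: cinner_self)
  then show ?thesis unfolding of_real_eq_iff .
qed

lemma bessel:
  "orthonormal k w \<Longrightarrow> (\<Sum>l=1..k. (cmod (cinner v (w l)))\<^sup>2) \<le> (norm v)\<^sup>2"
  using norm_diff_proj[of k w v] by (metis diff_ge_0_iff_ge zero_le_power2)

lemma proj_eq_iff:
  "orthonormal k w \<Longrightarrow> proj k w v = v \<longleftrightarrow> (\<Sum>l=1..k. (cmod (cinner v (w l)))\<^sup>2) = (norm v)\<^sup>2"
  using norm_diff_proj[of k w v] by auto

lemma proj_frame: "orthonormal k w \<Longrightarrow> m \<in> {1..k} \<Longrightarrow> proj k w (w m) = w m"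
proof -
  assume w: "orthonormal k w" and m: "m \<in> {1..k}"
  have "(\<Sum>l=1..k. scaleC (cinner (w m) (w l)) (w l)) = (\<Sum>l=1..k. if m = l then w l else 0)"
    using orthonormal_cinner[OF w m] by (intro sum.cong) (auto simp: scaleC_one)
  then show ?thesis using m by (simp add: proj_def)
qed

lemma cinner_diff_proj:
  "orthonormal k w \<Longrightarrow> m \<in> {1..k} \<Longrightarrow> cinner (v - proj k w v) (w m) = 0"
  by (simp add: cinner_diff_left cinner_proj)

text \<open>Cauchy-Schwarz, read off from Bessel's inequality for the frame consisting of the
  normalised \<open>y\<close>.\<close>

lemma norm_cinner_le: "cmod (cinner x y) \<le> norm x * norm y"
proof (cases "y = 0")
  case False
  define e where "e = scaleC (of_real (inverse (norm y))) y"
  have e: "norm e = 1" using False by (simp add: e_def norm_inverse)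
  then have "orthonormal 1 (\<lambda>_. e)" by (simp add: orthonormal_def cinner_eq_one_iff)
  from bessel[OF this, of x] have "(cmod (cinner x e))\<^sup>2 \<le> (norm x)\<^sup>2" by simp
  then have "cmod (cinner x e) \<le> norm x" by (simp add: power2_le_iff_abs_le)
  with False show ?thesis by (simp add: e_def cinner_simps norm_mult norm_divide norm_inverse field_simps)
qed simp

text \<open>Inclusion of the spans of two \<open>k\<close>-frames is equality, by double counting:
  the squared moduli of the mutual inner products sum to \<open>k\<close>, and Bessel bounds each of
  the \<open>k\<close> partial sums \<open>n a\<close> by \<open>1\<close>, so each of them is
  \<open>1\<close>.\<close>

lemma proj_swap:
  assumes u: "orthonormal k u" and w: "orthonormal k w"
    and sub: "\<And>l. l \<in> {1..k} \<Longrightarrow> proj k u (w l) = w l" and a: "a \<in> {1..k}"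
  shows "proj k w (u a) = u a"
proof -
  define n where "n a = (\<Sum>l=1..k. (cmod (cinner (u a) (w l)))\<^sup>2)" for a
  have n: "n b \<le> 1" if "b \<in> {1..k}" for b
    using bessel[OF w, of "u b"] orthonormal_norm[OF u that] by (simp add: n_def)
  have "(\<Sum>a=1..k. n a) = (\<Sum>l=1..k. \<Sum>a=1..k. (cmod (cinner (w l) (u a)))\<^sup>2)"
    unfolding n_def
    by (subst sum.swap, intro sum.cong refl) (metis cinner_commute complex_mod_cnj)
  also have "\<dots> = (\<Sum>l=1..k. 1)"
    using proj_eq_iff[OF u] sub orthonormal_norm[OF w] by (intro sum.cong) auto
  finally have "(\<Sum>a=1..k. 1 - n a) = 0" by (simp add: sum_subtractf)
  then have "1 - n a = 0"
    using a n by (subst (asm) sum_nonneg_eq_0_iff) auto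
  then show ?thesis
    using proj_eq_iff[OF w] orthonormal_norm[OF u a] by (simp add: n_def)
qed

text \<open>The trace of the compression of \<open>T\<close> to a subspace does not depend on the
  orthonormal basis: expand each \<open>u a\<close> in \<open>w\<close> and exchange the
  sums.\<close>

lemma trace_eq:
  assumes T: "clinear T" and u: "orthonormal k u" and w: "orthonormal k w"
    and sub: "\<And>l. l \<in> {1..k} \<Longrightarrow> proj k u (w l) = w l"
  shows "(\<Sum>l=1..k. cinner (T (u l)) (u l)) = (\<Sum>l=1..k. cinner (T (w l)) (w l))"
proof -
  have "(\<Sum>a=1..k. cinner (T (u a)) (u a)) = (\<Sum>a=1..k. cinner (T (proj k w (u a))) (u a))"
    using proj_swap[OF u w sub] by (intro sum.cong) auto
  also have "\<dots> = (\<Sum>a=1..k. \<Sum>l=1..k. cinner (u a) (w l) * cinner (T (w l)) (u a))"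
    by (simp add: proj_def clinear_sum[OF T] clinear_scaleC[OF T] cinner_simps)
  also have "\<dots> = (\<Sum>l=1..k. \<Sum>a=1..k. cinner (u a) (w l) * cinner (T (w l)) (u a))"
    by (rule sum.swap)
  also have "\<dots> = (\<Sum>l=1..k. cinner (T (w l)) (proj k u (w l)))"
    unfolding cinner_proj_right by (intro sum.cong refl) (metis cinner_commute mult.commute)
  finally show ?thesis using sub by simp
qed

section \<open>Dimension, extension and independence of frames\<close>

lemma cdim_leE:
  assumes "cdim V \<le> enat k"
  obtains C where "finite C" "V \<subseteq> cvs.span C" "cvs.dim V \<le> k"
proof (cases "\<exists>B. finite B \<and> V \<subseteq> cvs.span B")
  case True
  then have "cdim V = enat (cvs.dim V)" by (simp only: cdim_def if_True)
  with assms True that show thesis by auto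
next
  case False
  then have "cdim V = \<infinity>" by (simp only: cdim_def if_False)
  with assms show thesis by simp
qed

lemma cdim_eq_dim:
  assumes "finite B" "V \<subseteq> cvs.span B"
  shows "cdim V = enat (cvs.dim V)"
proof -
  have "\<exists>B. finite B \<and> V \<subseteq> cvs.span B" using assms by iprover
  then show ?thesis by (simp only: cdim_def if_True)
qed

lemma cspan_proj: "proj k w v \<in> cvs.span (w ` {1..k})"
  unfolding proj_def by (intro cvs.span_sum cvs.span_scale cvs.span_base) auto

lemma ex_orthogonal:
  fixes w :: "nat \<Rightarrow> 'a::complex_inner"
  assumes "orthonormal k w" "enat k < cdim (UNIV :: 'a set)"
  obtains z where "norm z = 1" "\<And>l. l \<in> {1..k} \<Longrightarrow> cinner z (w l) = 0"
proof -
  have "\<exists>v. proj k w v \<noteq> v"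
  proof (rule ccontr)
    assume "\<nexists>v. proj k w v \<noteq> v"
    have *: "UNIV \<subseteq> cvs.span (w ` {1..k})"
    proof (rule subsetI)
      fix v show "v \<in> cvs.span (w ` {1..k})"
        using cspan_proj[of k w v] \<open>\<nexists>v. proj k w v \<noteq> v\<close> by simp
    qed
    then have "cvs.dim (UNIV :: 'a set) \<le> card (w ` {1..k})"
      by (intro cvs.dim_le_card) auto
    also have "\<dots> \<le> k" using card_image_le[of "{1..k}" w] by simp
    finally have "cdim (UNIV :: 'a set) \<le> enat k"
      using cdim_eq_dim[OF _ *] by simp
    with assms(2) show False by simp
  qed
  then obtain v where v: "v - proj k w v \<noteq> 0" by (metis right_minus_eq)
  define z where "z = scaleC (of_real (inverse (norm (v - proj k w v)))) (v - proj k w v)"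
  show thesis
  proof (rule that[of z])
    show "norm z = 1" using v by (simp add: z_def norm_inverse)
    show "cinner z (w l) = 0" if "l \<in> {1..k}" for l
      using cinner_diff_proj[OF assms(1) that] by (simp add: z_def cinner_scaleC_left)
  qed
qed

lemma ex_orthonormal_extension:
  fixes w :: "nat \<Rightarrow> 'a::complex_inner"
  assumes "orthonormal j w" "j \<le> k" "enat k \<le> cdim (UNIV :: 'a set)"
  shows "\<exists>w'. orthonormal k w' \<and> (\<forall>l\<in>{1..j}. w' l = w l)"
  using assms(2,3)
proof (induction k rule: dec_induct)
  case base
  then show ?case using assms(1) by auto
next
  case (step n)
  have lt: "enat n < cdim (UNIV :: 'a set)"
    using step.prems by (simp add: Suc_ile_eq)
  with step.IH obtain w' where w': "orthonormal n w'" "\<And>l. l \<in> {1..j} \<Longrightarrow> w' l = w l"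
    by (meson order_less_imp_le)
  obtain z where "norm z = 1" "\<And>l. l \<in> {1..n} \<Longrightarrow> cinner z (w' l) = 0"
    using ex_orthogonal[OF w'(1) lt] by blast
  then have "orthonormal (Suc n) (w'(Suc n := z))"
    by (intro orthonormal_extend w')
  moreover have "\<forall>l\<in>{1..j}. (w'(Suc n := z)) l = w l"
    using w'(2) step.hyps by auto
  ultimately show ?case by blast
qed

lemma orthonormal_independent:
  assumes "orthonormal k w"
  shows "cvs.independent (w ` {1..k})" "card (w ` {1..k}) = k"
proof -
  have inj: "inj_on w {1..k}"
  proof (rule inj_onI)
    fix i j assume "i \<in> {1..k}" "j \<in> {1..k}" "w i = w j"
    then show "i = j"
      using orthonormal_cinner[OF assms, of i i] orthonormal_cinner[OF assms, of i j]
      by (metis zero_neq_one)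
  qed
  then show "card (w ` {1..k}) = k" by (simp add: card_image)
  show "cvs.independent (w ` {1..k})"
  proof (rule cvs.independent_if_scalars_zero)
    fix f x
    assume 0: "(\<Sum>x\<in>w ` {1..k}. scaleC (f x) x) = 0" and x: "x \<in> w ` {1..k}"
    then obtain m where m: "x = w m" "m \<in> {1..k}" by auto
    have "(\<Sum>l=1..k. scaleC (f (w l)) (w l)) = 0" using 0 inj by (simp add: sum.reindex)
    then show "f x = 0" using cinner_comb[OF assms m(2), of "\<lambda>l. f (w l)"] m by simp
  qed simp
qed

text \<open>A nonzero residual, once normalised, would extend the frame to \<open>k + 1\<close>
  independent vectors.\<close>

lemma proj_full:
  fixes w :: "nat \<Rightarrow> 'a::complex_inner"
  assumes w: "orthonormal k w" and dim: "cdim (UNIV :: 'a set) \<le> enat k"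
  shows "proj k w v = v"
proof (rule ccontr)
  assume "proj k w v \<noteq> v"
  define z where "z = scaleC (of_real (inverse (norm (v - proj k w v)))) (v - proj k w v)"
  have "norm z = 1" using \<open>proj k w v \<noteq> v\<close> by (simp add: z_def norm_inverse)
  moreover have "cinner z (w l) = 0" if "l \<in> {1..k}" for l
    using cinner_diff_proj[OF w that] by (simp add: z_def cinner_scaleC_left)
  ultimately have *: "orthonormal (Suc k) (w(Suc k := z))"
    by (intro orthonormal_extend w)
  obtain C where C: "finite C" "(UNIV :: 'a set) \<subseteq> cvs.span C" "cvs.dim (UNIV :: 'a set) \<le> k"
    using cdim_leE[OF dim] .
  obtain B where B: "cvs.independent B" "(UNIV :: 'a set) \<subseteq> cvs.span B" "card B = cvs.dim (UNIV :: 'a set)"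
    by (rule cvs.basis_exists[of "UNIV :: 'a set"])
  have "finite B" using cvs.independent_span_bound[OF C(1) B(1)] subset_trans[OF subset_UNIV C(2)] by simp
  then have "Suc k \<le> card B"
    using cvs.independent_span_bound[OF \<open>finite B\<close> orthonormal_independent(1)[OF *]]
      orthonormal_independent(2)[OF *] subset_trans[OF subset_UNIV B(2)] by metis
  with B(3) C(3) show False by simp
qed

subsection \<open>Segments in the numerical range of a triple\<close>

text \<open>The seven bracketed terms have the shape treated in
  \<open>hermitian_form_common_zero\<close>; the two before them disappear when the form vanishes at
  \<open>x\<close> and \<open>y\<close>.\<close>

lemma form_comb:
  assumes "clinear T"
  shows "cinner (T (scaleC a x + scaleC b y + scaleC c z)) (scaleC a x + scaleC b y + scaleC c z) =
    a * cnj a * cinner (T x) x + b * cnj b * cinner (T y) y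
    + (a * cnj b * cinner (T x) y + cnj a * b * cinner (T y) x + a * cnj c * cinner (T x) z
      + cnj a * c * cinner (T z) x + b * cnj c * cinner (T y) z + cnj b * c * cinner (T z) y
      + c * cnj c * cinner (T z) z)"
  by (simp add: clinear_add[OF assms] clinear_scaleC[OF assms] cinner_simps algebra_simps)

lemma form_scaleC:
  "clinear T \<Longrightarrow> cinner (T (scaleC a x)) (scaleC a x) = a * cnj a * cinner (T x) x"
  by (simp add: clinear_scaleC cinner_simps)

text \<open>Since \<open>cnj s = 1 / s\<close> for a phase, the condition amounts to
  \<open>s^2 = - p / q\<close>.\<close>

lemma ex_unit_cancelling:
  assumes "cmod p = cmod q"
  obtains s where "cmod s = 1" "cnj s * p + s * q = 0"
proof (cases "q = 0")
  case True
  with assms that[of 1] show thesis by simp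
next
  case False
  define s where "s = csqrt (- p / q)"
  have s2: "s\<^sup>2 = - p / q" by (simp add: s_def)
  have "(cmod s)\<^sup>2 = 1" unfolding norm_power[symmetric] s2 using assms False by (simp add: norm_divide)
  then have s: "cmod s = 1" by (simp add: power2_eq_1_iff) (metis norm_ge_zero not_one_le_zero neg_0_le_iff_le)
  then have "s * cnj s = 1" by (simp flip: complex_norm_square)
  have "s * (cnj s * p + s * q) = (s * cnj s) * p + s\<^sup>2 * q" by (simp add: algebra_simps power2_eq_square)
  also have "\<dots> = 0" using \<open>s * cnj s = 1\<close> s2 False by simp
  finally have "cnj s * p + s * q = 0" using s by auto
  with s that show thesis by blast
qed

text \<open>If the cross terms of \<open>T\<close> have equal modulus, a phase on \<open>y\<close>
  makes the form of \<open>T\<close> vanish on the whole segment from \<open>x\<close> to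
  \<open>y\<close>, and \<open>C\<close> changes sign along it. Otherwise the third vector
  \<open>z\<close> makes \<open>hermitian_form_common_zero\<close> applicable.\<close>

lemma sesquilinear_common_zero:
  assumes T: "clinear T" and C: "clinear C"
    and x: "cinner (T x) x = 0" "Re (cinner (C x) x) > 0"
    and y: "cinner (T y) y = 0" "Re (cinner (C y) y) < 0"
    and z: "cmod (cinner (T x) y) = cmod (cinner (T y) x) \<or> z \<noteq> 0 \<and> cinner z x = 0 \<and> cinner z y = 0"
  shows "\<exists>a b c. scaleC a x + scaleC b y + scaleC c z \<noteq> 0
    \<and> cinner (T (scaleC a x + scaleC b y + scaleC c z)) (scaleC a x + scaleC b y + scaleC c z) = 0
    \<and> Re (cinner (C (scaleC a x + scaleC b y + scaleC c z)) (scaleC a x + scaleC b y + scaleC c z)) = 0"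
proof -
  \<comment> \<open>If \<open>x\<close> and \<open>y\<close> were dependent, the form of
    \<open>C\<close> would have the same sign at both.\<close>
  have xy: "a = 0 \<and> b = 0" if "scaleC a x + scaleC b y = 0" for a b
  proof -
    have "scaleC a x = scaleC (- b) y"
      using that by (simp add: eq_neg_iff_add_eq_0)
    then have "cinner (C (scaleC a x)) (scaleC a x) = cinner (C (scaleC (- b) y)) (scaleC (- b) y)"
      by simp
    then have "of_real ((cmod a)\<^sup>2) * cinner (C x) x = of_real ((cmod b)\<^sup>2) * cinner (C y) y"
      unfolding form_scaleC[OF C] by (simp only: complex_norm_square complex_cnj_minus minus_mult_minus)
    from arg_cong[OF this, of Re]
    have "(cmod a)\<^sup>2 * Re (cinner (C x) x) = (cmod b)\<^sup>2 * Re (cinner (C y) y)"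
      by simp
    moreover have "(cmod a)\<^sup>2 * Re (cinner (C x) x) \<ge> 0" "(cmod b)\<^sup>2 * Re (cinner (C y) y) \<le> 0"
      using x y by (auto intro: mult_nonneg_nonpos)
    ultimately have "(cmod a)\<^sup>2 * Re (cinner (C x) x) = 0" "(cmod b)\<^sup>2 * Re (cinner (C y) y) = 0"
      by linarith+
    then show ?thesis using x y by simp
  qed
  show ?thesis
  proof (cases "cmod (cinner (T x) y) = cmod (cinner (T y) x)")
    case True
    then obtain s where s: "cmod s = 1" "cnj s * cinner (T x) y + s * cinner (T y) x = 0"
      using ex_unit_cancelling by blast
    define a where "a t = complex_of_real (1 - t)" for t
    define b where "b t = of_real t * s" for t
    define g where "g t = Re (cinner (C (scaleC (a t) x + scaleC (b t) y + scaleC 0 z))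
      (scaleC (a t) x + scaleC (b t) y + scaleC 0 z))" for t
    have "continuous_on {0..1} g"
      unfolding g_def form_comb[OF C] a_def b_def by (intro continuous_intros)
    moreover have "g 0 > 0"
      unfolding g_def form_comb[OF C] using x by (simp add: a_def b_def)
    moreover have "g 1 = Re (s * cnj s * cinner (C y) y)"
      unfolding g_def form_comb[OF C] by (simp add: a_def b_def)
    then have "g 1 < 0" using y s(1) by (simp flip: complex_norm_square)
    ultimately obtain t where t: "0 \<le> t" "t \<le> 1" "g t = 0"
      using IVT2'[of g 1 0 0] by auto
    have "scaleC (a t) x + scaleC (b t) y \<noteq> 0"
    proof
      assume "scaleC (a t) x + scaleC (b t) y = 0"
      from xy[OF this] s(1) show False by (auto simp: a_def b_def)
    qed
    moreover have "a t * cnj (b t) * cinner (T x) y + cnj (a t) * b t * cinner (T y) x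
        = a t * of_real t * (cnj s * cinner (T x) y + s * cinner (T y) x)"
      by (simp add: a_def b_def algebra_simps)
    then have "cinner (T (scaleC (a t) x + scaleC (b t) y + scaleC 0 z))
        (scaleC (a t) x + scaleC (b t) y + scaleC 0 z) = 0"
      unfolding form_comb[OF T] using s(2) x y by simp
    ultimately show ?thesis
      using t(3) unfolding g_def
      by (intro exI3[of _ "(a t, b t, 0)"] conjI) simp_all
  next
    case False
    define G where "G = (\<lambda>(a, b, c). Re (cinner (C (scaleC a x + scaleC b y + scaleC c z))
      (scaleC a x + scaleC b y + scaleC c z)))"
    have "continuous_on UNIV G"
      unfolding G_def form_comb[OF C] case_prod_beta by (intro continuous_intros)
    moreover have "G (1, 0, 0) > 0"
      unfolding G_def case_prod_conv form_comb[OF C] using x by simp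
    moreover have "G (0, b, 0) < 0" if "b \<noteq> 0" for b
    proof -
      have "G (0, b, 0) = Re (b * cnj b * cinner (C y) y)"
        unfolding G_def case_prod_conv form_comb[OF C] by simp
      also have "\<dots> = (cmod b)\<^sup>2 * Re (cinner (C y) y)"
        unfolding complex_norm_square[symmetric] by simp
      finally show ?thesis using y that by (simp add: mult_pos_neg)
    qed
    ultimately obtain a b c where abc: "(a, b, c) \<noteq> 0"
      "a * cnj b * cinner (T x) y + cnj a * b * cinner (T y) x + a * cnj c * cinner (T x) z
      + cnj a * c * cinner (T z) x + b * cnj c * cinner (T y) z + cnj b * c * cinner (T z) y
      + c * cnj c * cinner (T z) z = 0" "G (a, b, c) = 0"
      using hermitian_form_common_zero[of G, OF _ _ _ False] by blast
    have "scaleC a x + scaleC b y + scaleC c z \<noteq> 0"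
    proof
      assume 0: "scaleC a x + scaleC b y + scaleC c z = 0"
      then have "cinner (scaleC a x + scaleC b y + scaleC c z) z = 0" by simp
      then have "c = 0"
        using z False cinner_zero_commute[of x z] cinner_zero_commute[of y z] by (simp add: cinner_simps)
      with 0 xy[of a b] abc(1) show False by (simp add: zero_prod_def)
    qed
    then show ?thesis
      using abc(2,3)
      by (intro exI3[of _ "(a, b, c)"] conjI)
        (simp_all add: form_comb[OF T] x y G_def)
  qed
qed

text \<open>Relative to the target point \<open>m\<close>, multiples of one separating coordinate
  \<open>i\<close> are subtracted from the two others so that these vanish at \<open>x\<close> and
  \<open>y\<close>. They become the real and imaginary part of the form of \<open>T\<close>, and
  coordinate \<open>i\<close> becomes the sign-changing form \<open>C\<close>.\<close>

lemma numerical_range_segment: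
  fixes B :: "3 \<Rightarrow> 'a::complex_inner \<Rightarrow> 'a"
  assumes B: "\<And>i. clinear (B i)" "\<And>i. selfadjoint (B i)"
    and x: "norm x = 1" and y: "norm y = 1" and t: "0 \<le> t" "t \<le> 1"
    and z: "(\<forall>v. B 3 v = 0) \<or> z \<noteq> 0 \<and> cinner z x = 0 \<and> cinner z y = 0"
  shows "\<exists>a b c. norm (scaleC a x + scaleC b y + scaleC c z) = 1
    \<and> (\<forall>i. Re (cinner (B i (scaleC a x + scaleC b y + scaleC c z)) (scaleC a x + scaleC b y + scaleC c z))
        = (1 - t) * Re (cinner (B i x) x) + t * Re (cinner (B i y) y))"
proof -
  define p where "p i = Re (cinner (B i x) x)" for i
  define p' where "p' i = Re (cinner (B i y) y)" for i
  define m where "m i = (1 - t) * p i + t * p' i" for i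
  consider "t = 0 \<or> (\<forall>i. p i = p' i)" | "t = 1" | i where "t > 0" "t < 1" "p i \<noteq> p' i"
    using t by (metis order_le_less)
  then show ?thesis
  proof cases
    case 1
    then have "\<forall>i. p i = m i" by (auto simp: m_def algebra_simps)
    then show ?thesis using x
      by (intro exI3[of _ "(1, 0, 0)"]) (simp add: p_def p'_def m_def scaleC_one)
  next
    case 2
    then show ?thesis using y
      by (intro exI3[of _ "(0, 1, 0)"]) (simp add: scaleC_one)
  next
    case 3
    \<comment> \<open>If coordinate \<open>3\<close> is not the separating one it is placed last, so
      that a vanishing third form makes \<open>R k\<close> vanish.\<close>
    obtain j k where jk: "UNIV = {i, j, k}" "i \<noteq> 3 \<Longrightarrow> k = 3"
      using exhaust_3[of i]
    proof (elim disjE)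
      assume "i = 1"
      show thesis
      proof (rule that[of 2 3])
        show "UNIV = {i, 2, 3}" unfolding UNIV_3 \<open>i = 1\<close> by blast
      qed (simp_all add: \<open>i = 1\<close>)
    next
      assume "i = 2"
      show thesis
      proof (rule that[of 1 3])
        show "UNIV = {i, 1, 3}" unfolding UNIV_3 \<open>i = 2\<close> by blast
      qed (simp_all add: \<open>i = 2\<close>)
    next
      assume "i = 3"
      show thesis
      proof (rule that[of 1 2])
        show "UNIV = {i, 1, 2}" unfolding UNIV_3 \<open>i = 3\<close> by blast
      qed (simp_all add: \<open>i = 3\<close>)
    qed
    \<comment> \<open>The slope of coordinate \<open>l\<close> against coordinate \<open>i\<close>
      on the line through the two given points; this makes the form of \<open>R l\<close> vanish at
      \<open>x\<close> and \<open>y\<close>.\<close>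
    define d where "d l = (p' l - p l) / (p' i - p i)" for l
    define R where "R l v = B l v - scaleC (of_real (m l)) v
      - scaleC (of_real (d l)) (B i v - scaleC (of_real (m i)) v)" for l v
    \<comment> \<open>Chosen so that \<open>C\<close> is positive at \<open>x\<close> and negative
      at \<open>y\<close>.\<close>
    define \<sigma> where "\<sigma> = sgn (p i - p' i)"
    define C where "C v = scaleC (of_real \<sigma>) (B i v - scaleC (of_real (m i)) v)" for v
    define T where "T v = R j v + scaleC \<i> (R k v)" for v
    note Bs = clinear_add[OF B(1)] clinear_scaleC[OF B(1)]
    have R: "clinear (R l)" for l
      unfolding clinear_def R_def
      by (auto simp: Bs cvs.scale_right_distrib cvs.scale_right_diff_distrib algebra_simps)
    have C: "clinear C"
      unfolding clinear_def C_def
      by (auto simp: Bs cvs.scale_right_distrib cvs.scale_right_diff_distrib algebra_simps)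
    have T: "clinear T"
      unfolding clinear_def T_def
      by (auto simp: clinear_add[OF R] clinear_scaleC[OF R] cvs.scale_right_distrib algebra_simps)
    have Rf: "cinner (R l v) v = of_real (Re (cinner (B l v) v) - m l * (norm v)\<^sup>2
        - d l * (Re (cinner (B i v) v) - m i * (norm v)\<^sup>2))" for l v
      unfolding R_def using selfadjoint_real[OF B(2), of l v] selfadjoint_real[OF B(2), of i v]
      by (simp add: cinner_simps cinner_self)
    have Cf: "cinner (C v) v = of_real (\<sigma> * (Re (cinner (B i v) v) - m i * (norm v)\<^sup>2))" for v
      unfolding C_def using selfadjoint_real[OF B(2), of i v]
      by (simp add: cinner_simps cinner_self)
    have pl: "p l - m l - d l * (p i - m i) = 0" "p' l - m l - d l * (p' i - m i) = 0" for l
      unfolding m_def d_def using 3 by (auto simp: field_simps)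
    have "cinner (R l x) x = 0" "cinner (R l y) y = 0" for l
      using pl[of l] x y by (simp_all only: Rf p_def p'_def power_one mult_1_right of_real_0)
    then have T0: "cinner (T x) x = 0" "cinner (T y) y = 0"
      by (simp_all add: T_def cinner_simps)
    have "Re (cinner (C x) x) = t * \<bar>p i - p' i\<bar>"
      unfolding Cf using x
      by (simp add: m_def \<sigma>_def abs_sgn flip: p_def) (simp add: algebra_simps)
    then have Cx: "Re (cinner (C x) x) > 0" using 3 by simp
    have "Re (cinner (C y) y) = - ((1 - t) * \<bar>p i - p' i\<bar>)"
      unfolding Cf using y
      by (simp add: m_def \<sigma>_def abs_sgn flip: p'_def) (simp add: algebra_simps)
    then have Cy: "Re (cinner (C y) y) < 0" using 3 by simp
    \<comment> \<open>If the third form is zero, \<open>T\<close> reduces to the self-adjoint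
      \<open>R j\<close>, whose two cross terms are conjugate; this is the alternative without a
      third vector.\<close>
    have "cmod (cinner (T x) y) = cmod (cinner (T y) x) \<or> z \<noteq> 0 \<and> cinner z x = 0 \<and> cinner z y = 0"
    proof (cases "\<forall>v. B 3 v = 0")
      case True
      then have "p 3 = 0" "p' 3 = 0" by (simp_all add: p_def p'_def)
      with 3(3) have "i \<noteq> 3" by auto
      then have "k = 3" by (rule jk(2))
      have "m 3 = 0" "d 3 = 0" unfolding m_def d_def \<open>p 3 = 0\<close> \<open>p' 3 = 0\<close> by simp_all
      have "R k v = 0" for v
        unfolding R_def \<open>k = 3\<close> \<open>m 3 = 0\<close> \<open>d 3 = 0\<close> using True by simp
      moreover have "cinner (R j x) y = cnj (cinner (R j y) x)"
        unfolding R_def using selfadjoint_cnj[OF B(2)] cinner_commute[of x y]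
        by (simp add: cinner_simps)
      ultimately show ?thesis by (simp add: T_def)
    qed (use z in auto)
    from sesquilinear_common_zero[OF T C T0(1) Cx T0(2) Cy this]
    obtain a b c where abc: "scaleC a x + scaleC b y + scaleC c z \<noteq> 0"
      "cinner (T (scaleC a x + scaleC b y + scaleC c z)) (scaleC a x + scaleC b y + scaleC c z) = 0"
      "Re (cinner (C (scaleC a x + scaleC b y + scaleC c z)) (scaleC a x + scaleC b y + scaleC c z)) = 0"
      by blast
    define v where "v = scaleC a x + scaleC b y + scaleC c z"
    define n where "n = complex_of_real (inverse (norm v))"
    have v: "v \<noteq> 0" "cinner (T v) v = 0" "Re (cinner (C v) v) = 0"
      using abc by (simp_all add: v_def)
    have Qi: "Re (cinner (B i v) v) = m i * (norm v)\<^sup>2"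
      using v(3) 3 by (simp add: Cf \<sigma>_def sgn_zero_iff)
    have "cinner (R j v) v = 0 \<and> cinner (R k v) v = 0"
      using v(2) unfolding T_def by (simp add: cinner_simps Rf complex_eq_iff)
    then have "Re (cinner (B l v) v) = m l * (norm v)\<^sup>2" if "l \<in> {i, j, k}" for l
      using that Qi unfolding Rf of_real_eq_0_iff by auto
    then have Q: "Re (cinner (B l v) v) = m l * (norm v)\<^sup>2" for l
      using jk(1) by blast
    have "cinner (B l (scaleC n v)) (scaleC n v) = of_real (m l)" for l
    proof -
      have "n * cnj n * of_real ((norm v)\<^sup>2) = 1"
        using v(1) by (simp add: n_def power2_eq_square field_simps)
      moreover have "cinner (B l v) v = of_real (m l) * of_real ((norm v)\<^sup>2)"
        using selfadjoint_real[OF B(2), of l v] Q[of l] by simp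
      ultimately show ?thesis
        unfolding form_scaleC[OF B(1)] by (metis mult.left_commute mult.right_neutral)
    qed
    moreover have "norm (scaleC n v) = 1"
      using v(1) by (simp add: n_def norm_inverse)
    moreover have "scaleC n v = scaleC (n * a) x + scaleC (n * b) y + scaleC (n * c) z"
      by (simp add: v_def cvs.scale_right_distrib)
    ultimately show ?thesis
      by (intro exI3[of _ "(n * a, n * b, n * c)"])
        (simp add: m_def p_def p'_def)
  qed
qed

subsection \<open>Principal vectors\<close>

lemma cinner_scaleR_left: "cinner (scaleR r x) y = scaleR r (cinner x y)"
  by (simp add: scaleR_scaleC cinner_scaleC_left scaleR_conv_of_real)

lemma cinner_scaleR_right: "cinner x (scaleR r y) = scaleR r (cinner x y)"
  by (simp add: scaleR_scaleC cinner_scaleC_right scaleR_conv_of_real)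

lemma bounded_bilinear_cinner: "bounded_bilinear cinner"
  by (rule bounded_bilinear.intro)
    (auto simp: cinner_add_left cinner_add_right cinner_scaleR_left cinner_scaleR_right
      intro!: exI[of _ 1] norm_cinner_le)

lemmas continuous_on_cinner [continuous_intros] =
  bounded_bilinear.continuous_on[OF bounded_bilinear_cinner]

lemma bounded_bilinear_scaleC:
  "bounded_bilinear (scaleC :: complex \<Rightarrow> 'a \<Rightarrow> 'a::complex_inner)"
  by (rule bounded_bilinear.intro)
    (auto simp: scaleC_add_left scaleC_add_right scaleR_scaleC scaleC_scaleC scaleR_conv_of_real
      mult.commute intro!: exI[of _ 1])

lemmas continuous_on_scaleC [continuous_intros] =
  bounded_bilinear.continuous_on[OF bounded_bilinear_scaleC]

lemma compact_PiE_UNIV: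
  fixes S :: "'i \<Rightarrow> 'b::topological_space set"
  assumes "\<And>i. compact (S i)"
  shows "compact (PiE UNIV S)"
  using compactin_PiE[of "\<lambda>_. euclidean" UNIV S] assms
  by (simp add: euclidean_product_topology)

text \<open>For orthonormal \<open>u\<close>, the orthonormal bases of the span of \<open>u\<close>.
  Entries with index outside \<open>1..k\<close> are pinned to \<open>0\<close>, which makes the set
  compact in the product topology.\<close>

definition frames_in :: "nat \<Rightarrow> (nat \<Rightarrow> 'a::complex_inner) \<Rightarrow> (nat \<Rightarrow> 'a) set" where
  "frames_in k u = {w. orthonormal k w \<and> (\<forall>l\<in>{1..k}. proj k u (w l) = w l) \<and> (\<forall>l. l \<notin> {1..k} \<longrightarrow> w l = 0)}"

text \<open>The entries are combinations of \<open>u\<close> with coefficients in the unit disc, so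
  they range over a compact set and Tychonoff applies; the remaining conditions are closed.\<close>

lemma compact_frames_in:
  fixes u :: "nat \<Rightarrow> 'a::complex_inner"
  assumes u: "orthonormal k u"
  shows "compact (frames_in k u)"
proof -
  define K where "K = PiE UNIV (\<lambda>l. if l \<in> {1..k} then cball (0::complex) 1 else {0})"
  define S where "S = (\<lambda>c. \<Sum>l=1..k. scaleC (c l) (u l)) ` K"
  have "compact K" unfolding K_def by (intro compact_PiE_UNIV) auto
  then have "compact S" unfolding S_def
    by (intro compact_continuous_image continuous_intros continuous_on_subset[OF continuous_on_product_coordinates]) auto
  then have cP: "compact (PiE UNIV (\<lambda>l. if l \<in> {1..k} then S else {0}))"
    by (intro compact_PiE_UNIV) auto
  have coord: "continuous_on UNIV (\<lambda>w. w i :: 'a)" for i :: nat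
    by (rule continuous_on_product_coordinates)
  define F where "F = (\<Inter>i\<in>{1..k}. \<Inter>j\<in>{1..k}. {w. cinner (w i) (w j) = (if i = j then 1 else 0)})
      \<inter> (\<Inter>l\<in>{1..k}. {w. proj k u (w l) = w l})"
  have "closed F" unfolding F_def proj_def
    by (intro closed_Int closed_INT ballI closed_Collect_eq continuous_intros coord)
  have "w l \<in> S" if "orthonormal k w" "proj k u (w l) = w l" "l \<in> {1..k}" for w l
    unfolding S_def
  proof (rule image_eqI)
    show "w l = (\<Sum>m=1..k. scaleC (if m \<in> {1..k} then cinner (w l) (u m) else 0) (u m))"
      using that(2) by (simp add: proj_def)
    have "cmod (cinner (w l) (u m)) \<le> 1" if "m \<in> {1..k}" for m
      using norm_cinner_le[of "w l" "u m"] orthonormal_norm[OF u that]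
        orthonormal_norm[OF \<open>orthonormal k w\<close> \<open>l \<in> {1..k}\<close>] by simp
    then show "(\<lambda>m. if m \<in> {1..k} then cinner (w l) (u m) else 0) \<in> K"
      by (auto simp: K_def)
  qed
  then have "frames_in k u = PiE UNIV (\<lambda>l. if l \<in> {1..k} then S else {0}) \<inter> F"
    unfolding frames_in_def F_def orthonormal_def[of k] PiE_UNIV_domain
    by (auto simp: Pi_iff split: if_splits)
  then show ?thesis using cP \<open>closed F\<close> by (simp add: compact_Int_closed)
qed

section \<open>Plane rotations, and principal vectors by maximisation\<close>

definition rot :: "nat \<Rightarrow> nat \<Rightarrow> complex \<Rightarrow> complex \<Rightarrow> (nat \<Rightarrow> 'a::complex_vector) \<Rightarrow> nat \<Rightarrow> 'a" where
  "rot i j c s w = w(i := scaleC c (w i) + scaleC s (w j), j := scaleC (- cnj s) (w i) + scaleC c (w j))"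

text \<open>The conditions \<open>cs\<close> say that \<open>c\<close> is real and that the 2 by 2
  matrix of the rotation is unitary.\<close>

lemma orthonormal_rot:
  assumes w: "orthonormal k w" and ij: "i \<in> {1..k}" "j \<in> {1..k}" "i \<noteq> j"
    and cs: "cnj c = c" "c * c + s * cnj s = 1"
  shows "orthonormal k (rot i j c s w)"
proof -
  have cs': "s * cnj s + c * c = 1" "cnj s * s + c * c = 1" "c * c + cnj s * s = 1"
    using cs(2) by (simp_all add: add.commute mult.commute)
  show ?thesis
    unfolding orthonormal_def rot_def
    using ij orthonormal_cinner[OF w] cs cs' by (auto simp: cinner_simps mult.commute)
qed

lemma proj_comb:
  "proj k u (scaleC a x + scaleC b y) = scaleC a (proj k u x) + scaleC b (proj k u y)"
  by (simp add: proj_def cinner_simps scaleC_add_left sum.distrib cvs.scale_sum_right scaleC_scaleC)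

lemma frames_in_rot:
  assumes "w \<in> frames_in k u" "i \<in> {1..k}" "j \<in> {1..k}" "i \<noteq> j" "cnj c = c" "c * c + s * cnj s = 1"
  shows "rot i j c s w \<in> frames_in k u"
  using assms orthonormal_rot[of k w i j c s] unfolding frames_in_def
  by (auto simp: rot_def proj_comb simp del: cvs.scale_minus_left)

text \<open>The right-hand side differs from \<open>X\<close> only to second order in
  \<open>t\<close>, so the linear term on the left cannot be positive.\<close>

lemma first_order_nonpos:
  fixes X r :: real
  assumes "\<And>t. t > 0 \<Longrightarrow> X + t * r \<le> X * sqrt (1 + t\<^sup>2)"
  shows "r \<le> 0"
proof (rule ccontr)
  assume "\<not> r \<le> 0"
  then have r: "r > 0" by simp
  \<comment> \<open>Small enough that the error \<open>\<bar>X\<bar> * t^2 / 2\<close> is at most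
    half of \<open>t * r\<close>.\<close>
  define t where "t = r / (1 + \<bar>X\<bar>)"
  have t: "t > 0" using r by (simp add: t_def)
  have s: "1 \<le> sqrt (1 + t\<^sup>2)" "sqrt (1 + t\<^sup>2) \<le> 1 + t\<^sup>2 / 2"
  proof -
    show "1 \<le> sqrt (1 + t\<^sup>2)" by simp
    have "1 + t\<^sup>2 \<le> (1 + t\<^sup>2 / 2)\<^sup>2" by (simp add: power2_sum)
    then show "sqrt (1 + t\<^sup>2) \<le> 1 + t\<^sup>2 / 2" by (simp add: real_le_lsqrt)
  qed
  have "t * r \<le> X * (sqrt (1 + t\<^sup>2) - 1)" using assms[OF t] by (simp add: algebra_simps)
  also have "\<dots> \<le> \<bar>X\<bar> * (t\<^sup>2 / 2)"
    using s by (intro mult_mono) auto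
  finally have "t * r \<le> t * (\<bar>X\<bar> * t / 2)" by (simp add: power2_eq_square mult_ac)
  then have "r \<le> \<bar>X\<bar> * t / 2" using t by simp
  moreover have "\<bar>X\<bar> * t \<le> r" using r by (simp add: t_def field_simps)
  ultimately show False using r by linarith
qed

lemma Re_of_real_times: "Re (of_real r * z) = r * Re z"
  by simp

text \<open>The first-order condition for rotations of the pair \<open>u i\<close>,
  \<open>u j\<close>: the derivative is \<open>Re (e * z)\<close>, and as the phase \<open>e\<close>
  is arbitrary, \<open>z\<close> vanishes.\<close>

lemma weighted_max_first_order:
  assumes u: "u \<in> frames_in k u0" and ij: "i \<in> {1..k}" "j \<in> {1..k}" "i \<noteq> j"
    and mx: "\<And>u'. u' \<in> frames_in k u0 \<Longrightarrow>
      (\<Sum>l=1..k. real l * Re (cinner (u' l) (v l))) \<le> (\<Sum>l=1..k. real l * Re (cinner (u l) (v l)))"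
  shows "of_nat i * cinner (u j) (v i) = of_nat j * cnj (cinner (u i) (v j))"
proof -
  define z where "z = of_nat i * cinner (u j) (v i) - of_nat j * cnj (cinner (u i) (v j))"
  define X where "X = real i * Re (cinner (u i) (v i)) + real j * Re (cinner (u j) (v j))"
  have nonpos: "Re (e * z) \<le> 0" if e: "cmod e = 1" for e
  proof (rule first_order_nonpos[of X])
    fix t :: real assume t: "t > 0"
    \<comment> \<open>The rotation by the angle with tangent \<open>t\<close>, with phase
      \<open>e\<close>.\<close>
    define q where "q = sqrt (1 + t\<^sup>2)"
    have q: "q > 0" "q\<^sup>2 = 1 + t\<^sup>2" by (simp_all add: q_def add_pos_nonneg)
    define c where "c = complex_of_real (1 / q)"
    define s where "s = of_real (t / q) * e"
    have "e * cnj e = 1" using e by (simp flip: complex_norm_square)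
    then have "s * cnj s = of_real (t / q * (t / q))"
      by (simp add: s_def mult_ac)
    then have "c * c + s * cnj s = of_real (1 / q * (1 / q) + t / q * (t / q))"
      by (simp add: c_def)
    also have "1 / q * (1 / q) + t / q * (t / q) = (1 + t\<^sup>2) / q\<^sup>2"
      by (simp add: power2_eq_square add_divide_distrib)
    also have "\<dots> = 1" unfolding q(2)[symmetric] using q(1) by simp
    finally have cs: "c * c + s * cnj s = 1" by simp
    define u' where "u' = rot i j c s u"
    have "u' \<in> frames_in k u0"
      unfolding u'_def using u ij cs by (intro frames_in_rot) (auto simp: c_def)
    note le = mx[OF this]
    define R where "R = {1..k} - {i, j}"
    have split: "(\<Sum>l=1..k. f l) = f i + f j + (\<Sum>l\<in>R. f l)" for f :: "nat \<Rightarrow> real"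
    proof -
      have "{1..k} = insert i (insert j R)" using ij by (auto simp: R_def)
      moreover have "finite R" "i \<notin> insert j R" "j \<notin> R" using ij by (auto simp: R_def)
      ultimately show ?thesis by (simp add: add.assoc)
    qed
    have "(\<Sum>l\<in>R. real l * Re (cinner (u' l) (v l))) = (\<Sum>l\<in>R. real l * Re (cinner (u l) (v l)))"
      by (intro sum.cong) (auto simp: R_def u'_def rot_def)
    with le have "real i * Re (cinner (u' i) (v i)) + real j * Re (cinner (u' j) (v j)) \<le> X"
      unfolding split X_def by simp
    also have "real i * Re (cinner (u' i) (v i)) + real j * Re (cinner (u' j) (v j)) = (X + t * Re (e * z)) / q"
    proof -
      have "cinner (u' i) (v i) = of_real (1 / q) * (cinner (u i) (v i) + of_real t * (e * cinner (u j) (v i)))"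
        using ij(3) by (simp add: u'_def rot_def cinner_simps c_def s_def distrib_left)
      then have 1: "Re (cinner (u' i) (v i)) = 1 / q * (Re (cinner (u i) (v i)) + t * Re (e * cinner (u j) (v i)))"
        by (simp only: Re_of_real_times) simp
      have "cinner (u' j) (v j) = of_real (1 / q) * (cinner (u j) (v j) - of_real t * (cnj e * cinner (u i) (v j)))"
        using ij(3) by (simp add: u'_def rot_def cinner_simps c_def s_def right_diff_distrib)
      then have 2: "Re (cinner (u' j) (v j)) = 1 / q * (Re (cinner (u j) (v j)) - t * Re (e * cnj (cinner (u i) (v j))))"
        by (simp only: Re_of_real_times) simp
      have 3: "Re (e * z) = real i * Re (e * cinner (u j) (v i)) - real j * Re (e * cnj (cinner (u i) (v j)))"
        by (simp add: z_def algebra_simps)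
      show ?thesis unfolding 1 2 3 X_def unfolding divide_inverse by algebra
    qed
    finally show "X + t * Re (e * z) \<le> X * sqrt (1 + t\<^sup>2)"
      using q(1) by (simp add: field_simps q_def)
  qed
  have "z = 0"
  proof (rule ccontr)
    assume "z \<noteq> 0"
    define e where "e = cnj z / of_real (cmod z)"
    have "cmod e = 1" using \<open>z \<noteq> 0\<close> by (simp add: e_def norm_divide)
    moreover have "e * z = of_real (cmod z)"
      using \<open>z \<noteq> 0\<close>
      by (simp add: e_def mult.commute[of _ z] flip: complex_norm_square) (simp add: power2_eq_square)
    ultimately show False using nonpos[of e] \<open>z \<noteq> 0\<close> by simp
  qed
  then show ?thesis by (simp add: z_def)
qed

text \<open>Replaces a singular value decomposition. Both frames are chosen to maximise the sum of
  \<open>Re (cinner (a l) (b l))\<close> with weights \<open>l\<close>. Stationarity in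
  \<open>a\<close> gives \<open>j * cinner (a i) (b j) = i * cnj (cinner (a j) (b i))\<close>,
  stationarity in \<open>b\<close> the same with the factors \<open>i\<close> and \<open>j\<close>
  exchanged; as the weights differ, both sides vanish.\<close>

lemma ex_principal_frames:
  fixes u v :: "nat \<Rightarrow> 'a::complex_inner"
  assumes u: "orthonormal k u" and v: "orthonormal k v"
  obtains u' v' where "u' \<in> frames_in k u" "v' \<in> frames_in k v"
    "\<And>i j. i \<in> {1..k} \<Longrightarrow> j \<in> {1..k} \<Longrightarrow> i \<noteq> j \<Longrightarrow> cinner (u' i) (v' j) = 0"
proof -
  have ne: "(\<lambda>l. if l \<in> {1..k} then w l else 0) \<in> frames_in k w" if "orthonormal k w" for w :: "nat \<Rightarrow> 'a"
  proof -
    have "proj k w (w l) = w l" if "l \<in> {1..k}" for l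
      by (rule proj_frame[OF \<open>orthonormal k w\<close> that])
    moreover have "orthonormal k (\<lambda>l. if l \<in> {1..k} then w l else 0)"
      using that by (simp add: orthonormal_def)
    ultimately show ?thesis by (auto simp: frames_in_def)
  qed
  define \<phi> where "\<phi> = (\<lambda>(a, b). \<Sum>l=1..k. real l * Re (cinner (a l :: 'a) (b l)))"
  have coord: "continuous_on UNIV (\<lambda>w. w i :: 'a)" for i :: nat
    by (rule continuous_on_product_coordinates)
  have "continuous_on (frames_in k u \<times> frames_in k v) \<phi>"
    unfolding \<phi>_def case_prod_beta
    by (intro continuous_intros continuous_on_compose2[OF coord]) auto
  moreover have "compact (frames_in k u \<times> frames_in k v)"
    by (intro compact_Times compact_frames_in u v)
  ultimately obtain m where m: "m \<in> frames_in k u \<times> frames_in k v"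
    "\<And>y. y \<in> frames_in k u \<times> frames_in k v \<Longrightarrow> \<phi> y \<le> \<phi> m"
    using continuous_attains_sup[of "frames_in k u \<times> frames_in k v" \<phi>] ne[OF u] ne[OF v] by blast
  obtain a b where ab: "m = (a, b)" by (cases m)
  show thesis
  proof (rule that[of a b])
    show a: "a \<in> frames_in k u" and b: "b \<in> frames_in k v" using m ab by auto
    fix i j assume ij: "i \<in> {1..k}" "j \<in> {1..k}" "i \<noteq> j"
    have "of_nat j * cinner (a i) (b j) = of_nat i * cnj (cinner (a j) (b i))"
      using m(2)[of "(_, b)"] b ij unfolding ab
      by (intro weighted_max_first_order[OF a]) (auto simp: \<phi>_def)
    moreover have "of_nat j * cinner (b i) (a j) = of_nat i * cnj (cinner (b j) (a i))"
    proof (intro weighted_max_first_order[OF b])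
      fix b' assume "b' \<in> frames_in k v"
      have Rc: "Re (cinner x y) = Re (cinner y x)" for x y :: 'a
        by (metis cinner_commute complex_cnj(1) complex.sel(1) cnj.sel(1))
      show "(\<Sum>l=1..k. real l * Re (cinner (b' l) (a l))) \<le> (\<Sum>l=1..k. real l * Re (cinner (b l) (a l)))"
        using m(2)[of "(a, b')"] a \<open>b' \<in> frames_in k v\<close> unfolding ab \<phi>_def case_prod_conv
        by (subst (1 2) Rc) auto
    qed (use ij in auto)
    then have "of_nat j * cnj (cinner (a j) (b i)) = of_nat i * cinner (a i) (b j)"
      by (metis cinner_commute)
    ultimately have "of_nat j * (of_nat j * cinner (a i) (b j)) = of_nat i * (of_nat i * cinner (a i) (b j))"
      by (metis mult.left_commute)
    then have "(of_nat (j * j) - of_nat (i * i)) * cinner (a i) (b j) = 0"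
      by (simp add: algebra_simps)
    moreover have "(of_nat (j * j) :: complex) \<noteq> of_nat (i * i)"
      unfolding of_nat_eq_iff using ij(3) by (simp flip: power2_eq_square)
    ultimately show "cinner (a i) (b j) = 0" by simp
  qed
qed

subsection \<open>Bloch spheres and a Shapley--Folkman argument\<close>

definition form_vec :: "('i::finite \<Rightarrow> 'a::complex_inner \<Rightarrow> 'a) \<Rightarrow> 'a \<Rightarrow> real ^ 'i" where
  "form_vec B x = (\<chi> i. Re (cinner (B i x) x))"

text \<open>At a unit vector \<open>scaleC a e + scaleC b f\<close>, with \<open>e\<close>,
  \<open>f\<close> orthonormal, the forms are the mean of their values at \<open>e\<close> and
  \<open>f\<close> plus this map at the Bloch vector
  \<open>(|a|^2 - |b|^2, 2 * a * cnj b)\<close>.\<close>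

definition bloch_lin :: "('i::finite \<Rightarrow> 'a::complex_inner \<Rightarrow> 'a) \<Rightarrow> 'a \<Rightarrow> 'a \<Rightarrow> real \<times> complex \<Rightarrow> real ^ 'i" where
  "bloch_lin B e f s = (fst s / 2) *\<^sub>R (form_vec B e - form_vec B f)
    + (\<chi> i. Re (snd s * cinner (B i e) f))"

lemma linear_bloch_lin: "linear (bloch_lin B e f)"
  by (rule linearI)
    (simp_all add: bloch_lin_def vec_eq_iff add_divide_distrib algebra_simps)

lemma norm_bloch:
  assumes "(cmod a)\<^sup>2 + (cmod b)\<^sup>2 = 1"
  shows "norm ((cmod a)\<^sup>2 - (cmod b)\<^sup>2, 2 * a * cnj b) = 1"
proof -
  have "((cmod a)\<^sup>2 - (cmod b)\<^sup>2)\<^sup>2 + (2 * cmod a * cmod b)\<^sup>2 = ((cmod a)\<^sup>2 + (cmod b)\<^sup>2)\<^sup>2"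
    by (simp add: power2_eq_square algebra_simps)
  then show ?thesis using assms by (simp add: norm_Pair norm_mult)
qed

text \<open>The Hopf map is onto. Away from the south pole \<open>a\<close> can be taken real and
  positive, and the height \<open>h\<close> forces \<open>a^2 = (1 + h) / 2\<close>.\<close>

lemma ex_bloch:
  assumes "norm (s :: real \<times> complex) = 1"
  obtains a b where "(cmod a)\<^sup>2 + (cmod b)\<^sup>2 = 1" "s = ((cmod a)\<^sup>2 - (cmod b)\<^sup>2, 2 * a * cnj b)"
proof -
  obtain h w where s: "s = (h, w)" by (cases s)
  have hw: "h\<^sup>2 + (cmod w)\<^sup>2 = 1" using assms by (simp add: s norm_Pair)
  then have "h\<^sup>2 \<le> 1" by (metis le_add_same_cancel1 zero_le_power2)
  then have h: "- 1 \<le> h" "h \<le> 1" by (simp_all add: abs_square_le_1 abs_le_iff)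
  show thesis
  proof (cases "h = - 1")
    case True
    with hw have "w = 0" by simp
    with True s that[of 0 1] show thesis by simp
  next
    case False
    define r where "r = sqrt ((1 + h) / 2)"
    have r: "r > 0" "r\<^sup>2 = (1 + h) / 2" using h False by (simp_all add: r_def)
    define b where "b = cnj w / of_real (2 * r)"
    have "(cmod b)\<^sup>2 = (cmod w)\<^sup>2 / (4 * r\<^sup>2)"
      using r(1) by (simp add: b_def norm_divide norm_mult power_divide power_mult_distrib)
    also have "\<dots> = (1 - h) / 2"
    proof -
      have "(cmod w)\<^sup>2 = (1 - h) * (1 + h)" using hw by (simp add: algebra_simps power2_eq_square)
      moreover have "4 * r\<^sup>2 = 2 * (1 + h)" by (simp add: r(2))
      moreover have "1 + h \<noteq> 0" using False by linarith
      ultimately show ?thesis by (simp only: mult.commute[of 2] times_divide_times_eq[symmetric]) simp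
    qed
    finally have b: "(cmod b)\<^sup>2 = (1 - h) / 2" .
    have "2 * of_real r * cnj b = w" using r(1) by (simp add: b_def)
    with r b s that[of "of_real r" b] show thesis by (simp add: field_simps)
  qed
qed

lemma Re_form_plane:
  assumes T: "clinear T" "selfadjoint T"
  shows "Re (cinner (T (scaleC a e + scaleC b f)) (scaleC a e + scaleC b f))
      = (cmod a)\<^sup>2 * Re (cinner (T e) e) + (cmod b)\<^sup>2 * Re (cinner (T f) f)
        + 2 * Re (a * cnj b * cinner (T e) f)"
proof -
  have "cinner (T (scaleC a e + scaleC b f)) (scaleC a e + scaleC b f)
      = of_real ((cmod a)\<^sup>2) * cinner (T e) e + of_real ((cmod b)\<^sup>2) * cinner (T f) f
        + (a * cnj b * cinner (T e) f + cnj (a * cnj b * cinner (T e) f))"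
    using form_comb[OF T(1), of a e b f 0 0] selfadjoint_cnj[OF T(2), of e f]
    by (simp add: mult_ac flip: complex_norm_square)
  then show ?thesis
    by (simp only: Re_of_real_times plus_complex.sel cnj.sel)
qed

lemma form_vec_bloch:
  assumes B: "\<And>i. clinear (B i)" "\<And>i. selfadjoint (B i)"
    and ab: "(cmod a)\<^sup>2 + (cmod b)\<^sup>2 = 1"
  shows "form_vec B (scaleC a e + scaleC b f) = (1 / 2) *\<^sub>R (form_vec B e + form_vec B f)
    + bloch_lin B e f ((cmod a)\<^sup>2 - (cmod b)\<^sup>2, 2 * a * cnj b)"
proof (subst vec_eq_iff, intro allI)
  fix i
  have "Re (cinner (B i (scaleC a e + scaleC b f)) (scaleC a e + scaleC b f))
      = (cmod a)\<^sup>2 * Re (cinner (B i e) e) + (cmod b)\<^sup>2 * Re (cinner (B i f) f)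
        + 2 * Re (a * cnj b * cinner (B i e) f)"
    by (rule Re_form_plane[OF B])
  moreover have b: "(cmod b)\<^sup>2 = 1 - (cmod a)\<^sup>2" using ab by simp
  moreover have "Re (2 * a * cnj b * cinner (B i e) f) = 2 * Re (a * cnj b * cinner (B i e) f)"
    by (metis Re_of_real_times mult.assoc of_real_numeral)
  ultimately show "form_vec B (scaleC a e + scaleC b f) $ i
     = ((1 / 2) *\<^sub>R (form_vec B e + form_vec B f)
      + bloch_lin B e f ((cmod a)\<^sup>2 - (cmod b)\<^sup>2, 2 * a * cnj b)) $ i"
    unfolding form_vec_def bloch_lin_def
    by (simp only: vector_add_component vector_scaleR_component vector_minus_component vec_lambda_beta
        fst_conv snd_conv b) (simp add: field_simps)
qed

lemma norm_orthogonal_comb: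
  assumes "norm e = 1" "norm f = 1" "cinner e f = 0"
  shows "(norm (scaleC a e + scaleC b f))\<^sup>2 = (cmod a)\<^sup>2 + (cmod b)\<^sup>2"
proof -
  have "cinner e e = 1" "cinner f f = 1" "cinner f e = 0"
    using assms cinner_zero_commute[of e f] by (simp_all add: cinner_eq_one_iff)
  then have "cinner (scaleC a e + scaleC b f) (scaleC a e + scaleC b f) = a * cnj a + b * cnj b"
    using assms(3) by (simp add: cinner_simps mult.commute)
  then show ?thesis
    unfolding cinner_self complex_norm_square[symmetric] of_real_add[symmetric] of_real_eq_iff .
qed

text \<open>The unit vectors in the plane of \<open>u\<close> and \<open>v\<close> are parametrised by the Bloch sphere, on which
  the quadratic forms are affine functions.\<close>

lemma ex_bloch_parametrisation:
  fixes B :: "'i::finite \<Rightarrow> 'a::complex_inner \<Rightarrow> 'a"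
  assumes B: "\<And>i. clinear (B i)" "\<And>i. selfadjoint (B i)"
    and u: "norm u = 1" and v: "norm v = 1"
  shows "\<exists>C L s0 s1. linear L \<and> norm (s0 :: real \<times> complex) = 1 \<and> norm s1 = 1
    \<and> form_vec B u = C + L s0 \<and> form_vec B v = C + L s1
    \<and> (\<forall>s. norm s = 1 \<longrightarrow> (\<exists>a b. norm (scaleC a u + scaleC b v) = 1
        \<and> form_vec B (scaleC a u + scaleC b v) = C + L s))"
proof -
  define p where "p = cinner v u"
  define d where "d = v - scaleC p u"
  have dv: "v = scaleC p u + d" by (simp add: d_def)
  have uu: "cinner u u = 1" using u by (simp add: cinner_eq_one_iff)
  \<comment> \<open>If \<open>v\<close> is a multiple of \<open>u\<close> the plane degenerates to a
    line, and a constant map serves.\<close>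
  show ?thesis
  proof (cases "d = 0")
    case True
    then have v': "v = scaleC p u" using dv by simp
    then have "p * cnj p = 1" using u v by (simp flip: complex_norm_square)
    then have "form_vec B v = form_vec B u"
      unfolding form_vec_def v' form_scaleC[OF B(1)] by simp
    moreover have "linear (\<lambda>_ :: real \<times> complex. 0 :: real ^ 'i)" by (rule linearI) simp_all
    moreover have "norm (1 :: real, 0 :: complex) = 1" by (simp add: norm_Pair)
    moreover have "scaleC 1 u + scaleC 0 v = u" by (simp add: scaleC_one)
    ultimately show ?thesis using u by (metis add.right_neutral)
  next
    case False
    define n where "n = complex_of_real (norm d)"
    define f where "f = scaleC (inverse n) d"
    have n: "n \<noteq> 0" using False by (simp add: n_def)
    have f: "norm f = 1" using False by (simp add: f_def n_def norm_inverse)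
    have "cinner u d = 0"
      unfolding d_def using uu by (simp add: cinner_simps p_def) (metis cinner_commute)
    then have uf: "cinner u f = 0" by (simp add: f_def cinner_simps)
    have v': "v = scaleC p u + scaleC n f"
      using n dv by (simp add: f_def scaleC_scaleC scaleC_one)
    \<comment> \<open>Vectors found in terms of the Gram-Schmidt vector \<open>f\<close> are to be
      expressed through \<open>u\<close> and \<open>v\<close>.\<close>
    have sp: "scaleC a u + scaleC b f = scaleC (a - b * inverse n * p) u + scaleC (b * inverse n) v" for a b
      unfolding f_def d_def
      by (simp add: cvs.scale_right_diff_distrib cvs.scale_left_diff_distrib scaleC_scaleC mult_ac)
    have pn: "(cmod p)\<^sup>2 + (cmod n)\<^sup>2 = 1"
      using norm_orthogonal_comb[OF u f uf, of p n] v unfolding v'[symmetric] by simp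
    define C where "C = (1 / 2) *\<^sub>R (form_vec B u + form_vec B f)"
    have "form_vec B u = C + bloch_lin B u f ((cmod 1)\<^sup>2 - (cmod 0)\<^sup>2, 2 * 1 * cnj 0)"
      using form_vec_bloch[where B = B and a = 1 and b = 0 and e = u and f = f] B by (simp add: C_def scaleC_one)
    moreover have "norm ((cmod 1)\<^sup>2 - (cmod 0)\<^sup>2, 2 * 1 * cnj 0 :: complex) = 1"
      by (rule norm_bloch) simp
    moreover have "form_vec B v = C + bloch_lin B u f ((cmod p)\<^sup>2 - (cmod n)\<^sup>2, 2 * p * cnj n)"
      using form_vec_bloch[where e = u and f = f, OF B pn] unfolding v'[symmetric] C_def .
    moreover have "norm ((cmod p)\<^sup>2 - (cmod n)\<^sup>2, 2 * p * cnj n) = 1"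
      by (rule norm_bloch[OF pn])
    moreover have "\<exists>a b. norm (scaleC a u + scaleC b v) = 1
        \<and> form_vec B (scaleC a u + scaleC b v) = C + bloch_lin B u f s" if s: "norm s = 1" for s
    proof -
      obtain a b where ab: "(cmod a)\<^sup>2 + (cmod b)\<^sup>2 = 1" "s = ((cmod a)\<^sup>2 - (cmod b)\<^sup>2, 2 * a * cnj b)"
        using ex_bloch[OF s] .
      have "(norm (scaleC a u + scaleC b f))\<^sup>2 = 1"
        using norm_orthogonal_comb[OF u f uf, of a b] ab(1) by simp
      then have "norm (scaleC a u + scaleC b f) = 1"
        by (metis norm_ge_zero power2_eq_iff_nonneg one_power2 zero_le_one)
      moreover have "form_vec B (scaleC a u + scaleC b f) = C + bloch_lin B u f s"
        using form_vec_bloch[where e = u and f = f, OF B ab(1)] unfolding ab(2) C_def .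
      ultimately show ?thesis unfolding sp by blast
    qed
    ultimately show ?thesis using linear_bloch_lin[of B u f] by blast
  qed
qed

section \<open>Reducing the number of mixed states\<close>

lemma linear_ex_kernel:
  fixes f :: "'v::euclidean_space \<Rightarrow> 'w::euclidean_space"
  assumes "linear f" "DIM('w) < DIM('v)"
  obtains x where "x \<noteq> 0" "f x = 0"
proof (cases "inj f")
  case True
  then have "dim (f ` UNIV) = DIM('v)"
    using dim_image_eq[OF assms(1), of UNIV] by (simp add: dim_UNIV)
  with assms(2) dim_subset_UNIV[of "f ` UNIV"] show thesis by simp
next
  case False
  with that show thesis using linear_injective_0[OF assms(1)] by blast
qed

text \<open>A Shapley--Folkman argument: as long as two summands lie in the interior of their balls,
  they can be moved along a common kernel direction until one of them reaches the sphere.\<close>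

lemma shapley_folkman_balls:
  fixes L :: "'i \<Rightarrow> 'v::euclidean_space \<Rightarrow> 'w::euclidean_space"
  assumes "finite I" and L: "\<And>i. i \<in> I \<Longrightarrow> linear (L i)" and dim: "DIM('w) < 2 * DIM('v)"
    and "\<And>i. i \<in> I \<Longrightarrow> norm (s i) \<le> 1"
  shows "\<exists>s'. (\<forall>i\<in>I. norm (s' i) \<le> 1) \<and> (\<Sum>i\<in>I. L i (s' i)) = (\<Sum>i\<in>I. L i (s i))
    \<and> card {i\<in>I. norm (s' i) < 1} \<le> 1"
  using assms(4)
proof (induction "card {i\<in>I. norm (s i) < 1}" arbitrary: s rule: less_induct)
  case less
  show ?case
  proof (cases "card {i\<in>I. norm (s i) < 1} \<le> 1")
    case True
    with less.prems show ?thesis by blast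
  next
    case False
    then obtain i j where ij: "i \<in> I" "j \<in> I" "i \<noteq> j" "norm (s i) < 1" "norm (s j) < 1"
      using card_le_Suc0_iff_eq[of "{i\<in>I. norm (s i) < 1}"] assms(1) by auto
    have "linear (\<lambda>x. L i (fst x) + L j (snd x))"
      using L[OF ij(1)] L[OF ij(2)]
      by (intro linearI) (simp_all add: linear_add linear_cmul scaleR_add_right)
    moreover have "DIM('w) < DIM('v \<times> 'v)" using dim by simp
    ultimately obtain d where d: "d \<noteq> 0" "L i (fst d) + L j (snd d) = 0"
      by (rule linear_ex_kernel)
    \<comment> \<open>The larger norm is below \<open>1\<close> at \<open>0\<close> and at least
      \<open>1\<close> far out. Where it equals \<open>1\<close>, both points are in their balls and
      one is on its sphere.\<close>
    define m where "m t = max (norm (s i + t *\<^sub>R fst d)) (norm (s j + t *\<^sub>R snd d))" for t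
    obtain b where b: "0 \<le> b" "1 \<le> m b"
    proof (cases "fst d = 0")
      case True
      then have "snd d \<noteq> 0" using d(1) by (simp add: prod_eq_iff)
      have "norm ((2 / norm (snd d)) *\<^sub>R snd d) - norm (s j) \<le> norm (s j + (2 / norm (snd d)) *\<^sub>R snd d)"
        by (metis add.commute norm_diff_ineq)
      then have "1 \<le> m (2 / norm (snd d))" using ij(5) \<open>snd d \<noteq> 0\<close> by (simp add: m_def)
      then show ?thesis by (intro that[of "2 / norm (snd d)"]) auto
    next
      case False
      have "norm ((2 / norm (fst d)) *\<^sub>R fst d) - norm (s i) \<le> norm (s i + (2 / norm (fst d)) *\<^sub>R fst d)"
        by (metis add.commute norm_diff_ineq)
      then have "1 \<le> m (2 / norm (fst d))" using ij(4) False by (simp add: m_def)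
      then show ?thesis by (intro that[of "2 / norm (fst d)"]) auto
    qed
    have "continuous_on {0..b} m" unfolding m_def by (intro continuous_intros)
    moreover have "m 0 \<le> 1" using ij by (simp add: m_def)
    ultimately obtain t where t: "m t = 1" using IVT'[of m 0 1 b] b by auto
    define s' where "s' = s(i := s i + t *\<^sub>R fst d, j := s j + t *\<^sub>R snd d)"
    have s': "s' i = s i + t *\<^sub>R fst d" "s' j = s j + t *\<^sub>R snd d"
      "\<And>l. l \<noteq> i \<Longrightarrow> l \<noteq> j \<Longrightarrow> s' l = s l"
      using ij(3) by (simp_all add: s'_def)
    have nm: "norm (s' i) \<le> 1" "norm (s' j) \<le> 1" "norm (s' i) = 1 \<or> norm (s' j) = 1"
      using t unfolding s' m_def by (auto simp: max_def split: if_splits)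
    then have le: "norm (s' l) \<le> 1" if "l \<in> I" for l
      using less.prems[OF that] s'(3)[of l] by (cases "l = i \<or> l = j") auto
    have "{l\<in>I. norm (s' l) < 1} \<subset> {l\<in>I. norm (s l) < 1}"
    proof
      show "{l\<in>I. norm (s' l) < 1} \<subseteq> {l\<in>I. norm (s l) < 1}"
        using ij s'(3) by (metis (mono_tags, lifting) Collect_mono)
      show "{l\<in>I. norm (s' l) < 1} \<noteq> {l\<in>I. norm (s l) < 1}"
        using ij nm(3) by (metis (mono_tags, lifting) mem_Collect_eq less_irrefl)
    qed
    then have "card {l\<in>I. norm (s' l) < 1} < card {l\<in>I. norm (s l) < 1}"
      using assms(1) by (intro psubset_card_mono) auto
    from less.hyps[OF this le] obtain s'' where s'': "\<forall>i\<in>I. norm (s'' i) \<le> 1"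
      "(\<Sum>i\<in>I. L i (s'' i)) = (\<Sum>i\<in>I. L i (s' i))" "card {i\<in>I. norm (s'' i) < 1} \<le> 1"
      by blast
    have "(\<Sum>l\<in>I. L l (s' l)) = (\<Sum>l\<in>I. L l (s l))"
    proof -
      have split: "(\<Sum>l\<in>I. g l) = g i + g j + (\<Sum>l\<in>I - {i, j}. g l)" for g :: "'i \<Rightarrow> 'w"
      proof -
        have "I = insert i (insert j (I - {i, j}))" using ij by auto
        then show ?thesis using ij(3) assms(1)
          by (metis (no_types, lifting) Diff_iff add.assoc finite_Diff finite_insert insertCI insertE sum.insert)
      qed
      have "L i (s' i) + L j (s' j) = L i (s i) + L j (s j) + t *\<^sub>R (L i (fst d) + L j (snd d))"
        unfolding s' using L[OF ij(1)] L[OF ij(2)]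
        by (simp add: linear_add linear_cmul scaleR_add_right)
      moreover have "(\<Sum>l\<in>I - {i, j}. L l (s' l)) = (\<Sum>l\<in>I - {i, j}. L l (s l))"
        by (intro sum.cong) (auto simp: s'(3))
      ultimately show ?thesis unfolding split[of "\<lambda>l. L l (s' l)"] split[of "\<lambda>l. L l (s l)"] using d(2) by simp
    qed
    with s'' show ?thesis by auto
  qed
qed

subsection \<open>Joint numerical ranges of triples\<close>

text \<open>The component of \<open>y\<close> orthogonal to the frame, if nonzero, is added to the
  frame. This supplies the third vector for the case of single vectors.\<close>

lemma ex_orthogonal_insert:
  fixes w :: "nat \<Rightarrow> 'a::complex_inner"
  assumes w: "orthonormal k w" and dim: "enat (Suc k) < cdim (UNIV :: 'a set)"
  obtains z where "norm z = 1" "\<And>l. l \<in> {1..k} \<Longrightarrow> cinner z (w l) = 0" "cinner z y = 0"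
proof (cases "proj k w y = y")
  case True
  have "enat k < cdim (UNIV :: 'a set)" using dim by (meson enat_ord_simps(2) lessI less_trans)
  then obtain z where z: "norm z = 1" "\<And>l. l \<in> {1..k} \<Longrightarrow> cinner z (w l) = 0"
    using ex_orthogonal[OF w] by blast
  then have "cinner z (proj k w y) = 0" by (simp add: cinner_proj_right)
  with z that True show thesis by simp
next
  case False
  define n where "n = complex_of_real (norm (y - proj k w y))"
  define e where "e = scaleC (inverse n) (y - proj k w y)"
  have n: "n \<noteq> 0" using False by (simp add: n_def)
  have "norm e = 1" using False by (simp add: e_def n_def norm_inverse)
  moreover have "cinner e (w l) = 0" if "l \<in> {1..k}" for l
    using cinner_diff_proj[OF w that] by (simp add: e_def cinner_scaleC_left)
  ultimately have e: "orthonormal (Suc k) (w(Suc k := e))"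
    by (intro orthonormal_extend w)
  obtain z where z: "norm z = 1" "\<And>l. l \<in> {1..Suc k} \<Longrightarrow> cinner z ((w(Suc k := e)) l) = 0"
    using ex_orthogonal[OF e dim] by blast
  have zw: "cinner z (w l) = 0" if "l \<in> {1..k}" for l
    using z(2)[of l] that by (auto simp: fun_upd_def split: if_splits)
  have "cinner z e = 0" using z(2)[of "Suc k"] by simp
  moreover have "y = scaleC n e + proj k w y" using n by (simp add: e_def scaleC_scaleC scaleC_one)
  ultimately have "cinner z y = 0"
    using zw by (metis (no_types, lifting) add.right_neutral cinner_add_right cinner_proj_right
        cinner_scaleC_right mult_zero_left mult_zero_right sum.neutral)
  with z(1) zw that show thesis by blast
qed

text \<open>The diameter through \<open>s\<close> serves: a mixed state is a convex combination of
  two opposite pure ones.\<close>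

lemma chord_of_ball:
  fixes s :: "real \<times> complex"
  assumes "norm s \<le> 1"
  obtains a b t where "norm a = 1" "norm b = 1" "0 \<le> t" "t \<le> 1" "s = (1 - t) *\<^sub>R a + t *\<^sub>R b"
proof -
  obtain e where e: "norm e = 1" "s = norm s *\<^sub>R e"
  proof (cases "s = 0")
    case True
    then show ?thesis using that[of "(1, 0)"] by (simp add: norm_Pair zero_prod_def)
  next
    case False
    then show ?thesis using that[of "s /\<^sub>R norm s"] by simp
  qed
  define r where "r = norm s"
  have r: "0 \<le> r" "r \<le> 1" using assms by (simp_all add: r_def)
  show thesis
  proof (rule that[of e "- e" "(1 - r) / 2"])
    have "(1 - h) *\<^sub>R e + h *\<^sub>R (- e) = (1 - h - h) *\<^sub>R e" for h
      unfolding scaleR_diff_left by simp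
    then have "(1 - (1 - r) / 2) *\<^sub>R e + ((1 - r) / 2) *\<^sub>R (- e)
        = ((1 - (1 - r) / 2) - (1 - r) / 2) *\<^sub>R e" .
    also have "(1 - (1 - r) / 2) - (1 - r) / 2 = r" by (simp add: field_simps)
    finally show "s = (1 - (1 - r) / 2) *\<^sub>R e + ((1 - r) / 2) *\<^sub>R (- e)"
      using e(2) by (simp only: r_def[symmetric])
  qed (use e(1) r in auto)
qed

lemma form_vec_segment:
  fixes B :: "3 \<Rightarrow> 'a::complex_inner \<Rightarrow> 'a"
  assumes B: "\<And>i. clinear (B i)" "\<And>i. selfadjoint (B i)"
    and x: "norm x = 1" and y: "norm y = 1" and t: "0 \<le> t" "t \<le> 1"
    and z: "(\<forall>v. B 3 v = 0) \<or> norm z = 1 \<and> cinner z x = 0 \<and> cinner z y = 0"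
  obtains a b c where "norm (scaleC a x + scaleC b y + scaleC c z) = 1"
    "form_vec B (scaleC a x + scaleC b y + scaleC c z)
        = (1 - t) *\<^sub>R form_vec B x + t *\<^sub>R form_vec B y"
proof -
  have "(\<forall>v. B 3 v = 0) \<or> z \<noteq> 0 \<and> cinner z x = 0 \<and> cinner z y = 0" using z by auto
  from numerical_range_segment[where B = B, OF B x y t this] that show thesis
    by (auto simp: form_vec_def vec_eq_iff)
qed

lemma form_vec_trace_eq:
  assumes B: "\<And>i. clinear (B i)" and "orthonormal k u" "orthonormal k w"
    and "\<And>l. l \<in> {1..k} \<Longrightarrow> proj k u (w l) = w l"
  shows "(\<Sum>l=1..k. form_vec B (u l)) = (\<Sum>l=1..k. form_vec B (w l))"
  using trace_eq[OF B assms(2-4)]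
  by (simp add: vec_eq_iff form_vec_def) (metis Re_sum)

text \<open>Principal vectors make the planes of \<open>u' l\<close> and \<open>v' l\<close>
  mutually orthogonal, so unit vectors can be chosen in them independently. The spare dimensions
  provide the extra direction in which the last mixed state is purified.\<close>

lemma frames_segment_codim_ge_2:
  fixes B :: "3 \<Rightarrow> 'a::complex_inner \<Rightarrow> 'a"
  assumes B: "\<And>i. clinear (B i)" "\<And>i. selfadjoint (B i)"
    and u: "orthonormal k u" and v: "orthonormal k v" and k: "0 < k"
    and dim: "enat (Suc k) < cdim (UNIV :: 'a set)" and t: "0 \<le> t" "t \<le> 1"
  shows "\<exists>w. orthonormal k w \<and> (\<Sum>l=1..k. form_vec B (w l))
      = (1 - t) *\<^sub>R (\<Sum>l=1..k. form_vec B (u l)) + t *\<^sub>R (\<Sum>l=1..k. form_vec B (v l))"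
proof -
  obtain u' v' where u': "u' \<in> frames_in k u" and v': "v' \<in> frames_in k v"
    and orth: "\<And>i j. i \<in> {1..k} \<Longrightarrow> j \<in> {1..k} \<Longrightarrow> i \<noteq> j \<Longrightarrow> cinner (u' i) (v' j) = 0"
    using ex_principal_frames[OF u v] by blast
  have ou: "orthonormal k u'" and ov: "orthonormal k v'" using u' v' by (auto simp: frames_in_def)
  have tru: "(\<Sum>l=1..k. form_vec B (u l)) = (\<Sum>l=1..k. form_vec B (u' l))"
    using u' by (intro form_vec_trace_eq B u ou) (auto simp: frames_in_def)
  have trv: "(\<Sum>l=1..k. form_vec B (v l)) = (\<Sum>l=1..k. form_vec B (v' l))"
    using v' by (intro form_vec_trace_eq B v ov) (auto simp: frames_in_def)
  define P where "P l C L s0 s1 \<longleftrightarrow> linear L \<and> norm (s0 :: real \<times> complex) = 1 \<and> norm s1 = 1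
    \<and> form_vec B (u' l) = C + L s0 \<and> form_vec B (v' l) = C + L s1
    \<and> (\<forall>s. norm s = 1 \<longrightarrow> (\<exists>a b. norm (scaleC a (u' l) + scaleC b (v' l)) = 1
        \<and> form_vec B (scaleC a (u' l) + scaleC b (v' l)) = C + L s))" for l C L s0 s1
  have "\<forall>l\<in>{1..k}. \<exists>C L s0 s1. P l C L s0 s1"
    unfolding P_def
    by (intro ballI ex_bloch_parametrisation B orthonormal_norm[OF ou] orthonormal_norm[OF ov])
  then obtain C L s0 s1 where P: "\<And>l. l \<in> {1..k} \<Longrightarrow> P l (C l) (L l) (s0 l) (s1 l)"
    by metis
  note PD = P[unfolded P_def]
  have lin: "linear (L l)" if "l \<in> {1..k}" for l using PD[OF that] by simp
  \<comment> \<open>The point of the segment is first represented by a mixed state in every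
    plane.\<close>
  define s where "s l = (1 - t) *\<^sub>R s0 l + t *\<^sub>R s1 l" for l
  have ns: "norm (s l) \<le> 1" if "l \<in> {1..k}" for l
  proof -
    have "norm (s l) \<le> (1 - t) * norm (s0 l) + t * norm (s1 l)"
      unfolding s_def using t by (intro order.trans[OF norm_triangle_ineq]) simp
    then show ?thesis using PD[OF that] by simp
  qed
  have "DIM(real ^ 3) < 2 * DIM(real \<times> complex)" by simp
  from shapley_folkman_balls[of "{1..k}" L s, OF finite_atLeastAtMost lin this ns]
  obtain s' where "\<forall>l\<in>{1..k}. norm (s' l) \<le> 1"
    and s'23: "(\<Sum>l=1..k. L l (s' l)) = (\<Sum>l=1..k. L l (s l))" "card {l\<in>{1..k}. norm (s' l) < 1} \<le> 1"
    by blast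
  then have s': "\<And>l. l \<in> {1..k} \<Longrightarrow> norm (s' l) \<le> 1"
    "(\<Sum>l=1..k. L l (s' l)) = (\<Sum>l=1..k. L l (s l))" "card {l\<in>{1..k}. norm (s' l) < 1} \<le> 1"
    by blast+
  have target: "(\<Sum>l=1..k. C l + L l (s' l))
      = (1 - t) *\<^sub>R (\<Sum>l=1..k. form_vec B (u l)) + t *\<^sub>R (\<Sum>l=1..k. form_vec B (v l))"
  proof -
    have "(\<Sum>l=1..k. C l + L l (s' l)) = (\<Sum>l=1..k. C l + L l (s l))"
      using s'(2) by (simp add: sum.distrib)
    also have "\<dots> = (\<Sum>l=1..k. (1 - t) *\<^sub>R form_vec B (u' l) + t *\<^sub>R form_vec B (v' l))"
    proof (intro sum.cong refl)
      fix l assume l: "l \<in> {1..k}"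
      have "form_vec B (u' l) = C l + L l (s0 l)" "form_vec B (v' l) = C l + L l (s1 l)"
        using PD[OF l] by auto
      moreover have "L l (s l) = (1 - t) *\<^sub>R L l (s0 l) + t *\<^sub>R L l (s1 l)"
        unfolding s_def by (simp only: linear_add[OF lin[OF l]] linear_cmul[OF lin[OF l]])
      ultimately show "C l + L l (s l) = (1 - t) *\<^sub>R form_vec B (u' l) + t *\<^sub>R form_vec B (v' l)"
        by (simp add: algebra_simps)
    qed
    finally show ?thesis unfolding tru trv by (simp add: sum.distrib scaleR_sum_right)
  qed
  \<comment> \<open>Plane \<open>m\<close> is the one whose state may still be mixed. If all states
    are pure, plane \<open>1\<close> is taken, which exists as \<open>k > 0\<close>.\<close>
  obtain m where m: "m \<in> {1..k}" "\<And>l. l \<in> {1..k} \<Longrightarrow> l \<noteq> m \<Longrightarrow> norm (s' l) = 1"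
  proof (cases "\<exists>m\<in>{1..k}. norm (s' m) < 1")
    case True
    then obtain m where m: "m \<in> {1..k}" "norm (s' m) < 1" by blast
    have "norm (s' l) = 1" if "l \<in> {1..k}" "l \<noteq> m" for l
    proof (rule ccontr)
      assume "norm (s' l) \<noteq> 1"
      then have "norm (s' l) < 1" using s'(1)[OF that(1)] by simp
      then show False
        using s'(3) m that card_le_Suc0_iff_eq[of "{l\<in>{1..k}. norm (s' l) < 1}"] by auto
    qed
    with m that show ?thesis by blast
  next
    case False
    then show ?thesis using s'(1) k that[of 1] by (metis One_nat_def Suc_leI antisym_conv2 atLeastAtMost_iff order_refl)
  qed
  \<comment> \<open>Only the form values belonging to \<open>s\<close> are recorded, together with
    membership in plane \<open>l\<close>, which is what orthogonality between planes rests
    on.\<close>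
  define Q where "Q l s z \<longleftrightarrow> norm z = 1 \<and> (\<exists>a b. z = scaleC a (u' l) + scaleC b (v' l)) \<and> form_vec B z = C l + L l s" for l s z
  have exQ: "\<exists>z. Q l s z" if "l \<in> {1..k}" "norm s = 1" for l s
    using PD[OF that(1)] that(2) unfolding Q_def by blast
  then have "\<forall>l\<in>{1..k} - {m}. \<exists>z. Q l (s' l) z" using m(2) by blast
  then obtain \<zeta> where \<zeta>: "\<And>l. l \<in> {1..k} \<Longrightarrow> l \<noteq> m \<Longrightarrow> Q l (s' l) (\<zeta> l)"
    by (metis Diff_iff singletonD)
  obtain \<sigma>0 \<sigma>1 \<tau> where \<sigma>: "norm \<sigma>0 = 1" "norm \<sigma>1 = 1" "0 \<le> \<tau>" "\<tau> \<le> 1"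
    "s' m = (1 - \<tau>) *\<^sub>R \<sigma>0 + \<tau> *\<^sub>R \<sigma>1"
    using chord_of_ball[OF s'(1)[OF m(1)]] by blast
  obtain x y where x: "Q m \<sigma>0 x" and y: "Q m \<sigma>1 y"
    using exQ[OF m(1)] \<sigma> by blast
  have cross: "cinner z z' = 0"
    if "Q l r z" "Q l' r' z'" "l \<in> {1..k}" "l' \<in> {1..k}" "l \<noteq> l'" for l l' r r' z z'
    using that orthonormal_cinner[OF ou that(3,4)] orthonormal_cinner[OF ov that(3,4)]
      orth[OF that(3,4)] orth[OF that(4,3)] cinner_zero_commute[of "v' l" "u' l'"]
    unfolding Q_def by (auto simp: cinner_simps)
  have frame: "orthonormal k (\<zeta>(m := w))" if "norm w = 1" "\<And>l. l \<in> {1..k} \<Longrightarrow> l \<noteq> m \<Longrightarrow> cinner w (\<zeta> l) = 0" for w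
    unfolding orthonormal_def
  proof (intro ballI)
    fix i j assume ij: "i \<in> {1..k}" "j \<in> {1..k}"
    show "cinner ((\<zeta>(m := w)) i) ((\<zeta>(m := w)) j) = (if i = j then 1 else 0)"
    proof (cases "i = j")
      case True
      then show ?thesis using \<zeta>[OF ij(1)] that(1) by (auto simp: Q_def cinner_eq_one_iff)
    next
      case False
      then show ?thesis
        using cross[OF \<zeta> \<zeta> ij] that(2) ij cinner_zero_commute[of w] by auto
    qed
  qed
  have xo: "cinner x (\<zeta> l) = 0" and yo: "cinner y (\<zeta> l) = 0" if "l \<in> {1..k}" "l \<noteq> m" for l
    using cross[OF x \<zeta>[OF that]] cross[OF y \<zeta>[OF that]] that m(1) by auto
  have "norm x = 1" "norm y = 1" using x y by (auto simp: Q_def)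
  \<comment> \<open>Orthogonal to \<open>x\<close>, to \<open>y\<close> and to the pure states of
    the other planes, that is, to a \<open>k\<close>-frame and one more vector; this is where
    codimension at least two enters.\<close>
  obtain z where z: "norm z = 1" "\<And>l. l \<in> {1..k} \<Longrightarrow> cinner z ((\<zeta>(m := x)) l) = 0" "cinner z y = 0"
    using ex_orthogonal_insert[OF frame[OF \<open>norm x = 1\<close> xo] dim] by blast
  have "cinner z x = 0" using z(2)[OF m(1)] by simp
  have zo: "cinner z (\<zeta> l) = 0" if "l \<in> {1..k}" "l \<noteq> m" for l
    using z(2)[OF that(1)] that(2) by simp
  obtain a b c where w: "norm (scaleC a x + scaleC b y + scaleC c z) = 1"
    "form_vec B (scaleC a x + scaleC b y + scaleC c z)
        = (1 - \<tau>) *\<^sub>R form_vec B x + \<tau> *\<^sub>R form_vec B y"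
    using form_vec_segment[where B = B, OF B \<open>norm x = 1\<close> \<open>norm y = 1\<close> \<sigma>(3,4)] z(1,3) \<open>cinner z x = 0\<close> by metis
  define w' where "w' = \<zeta>(m := scaleC a x + scaleC b y + scaleC c z)"
  have "orthonormal k w'"
    unfolding w'_def using xo yo zo by (intro frame w(1)) (simp add: cinner_simps)
  moreover have "form_vec B (w' l) = C l + L l (s' l)" if "l \<in> {1..k}" for l
  proof (cases "l = m")
    case True
    have "form_vec B x = C m + L m \<sigma>0" "form_vec B y = C m + L m \<sigma>1"
      using x y by (auto simp: Q_def)
    then have "form_vec B (w' m) = C m + ((1 - \<tau>) *\<^sub>R L m \<sigma>0 + \<tau> *\<^sub>R L m \<sigma>1)"
      using w(2) by (simp add: w'_def algebra_simps)
    moreover have "L m (s' m) = (1 - \<tau>) *\<^sub>R L m \<sigma>0 + \<tau> *\<^sub>R L m \<sigma>1"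
      unfolding \<sigma>(5) by (simp only: linear_add[OF lin[OF m(1)]] linear_cmul[OF lin[OF m(1)]])
    ultimately have "form_vec B (w' m) = C m + L m (s' m)" by simp
    with True show ?thesis by simp
  next
    case False
    with \<zeta>[OF that False] show ?thesis by (simp add: w'_def Q_def)
  qed
  ultimately show ?thesis using target by (intro exI[of _ w']) (metis (no_types, lifting) sum.cong)
qed

text \<open>The form values of a \<open>k\<close>-frame and of its unit normal add up to the trace
  over the whole space. So the segment is sought among the normals, where the case of single vectors
  applies.\<close>

lemma frames_segment_codim_1:
  fixes B :: "3 \<Rightarrow> 'a::complex_inner \<Rightarrow> 'a"
  assumes B: "\<And>i. clinear (B i)" "\<And>i. selfadjoint (B i)"
    and u: "orthonormal k u" and v: "orthonormal k v"
    and dim: "cdim (UNIV :: 'a set) = enat (Suc k)" and t: "0 \<le> t" "t \<le> 1"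
    and z: "(\<forall>v. B 3 v = 0) \<or> 2 \<le> k"
  shows "\<exists>w. orthonormal k w \<and> (\<Sum>l=1..k. form_vec B (w l))
      = (1 - t) *\<^sub>R (\<Sum>l=1..k. form_vec B (u l)) + t *\<^sub>R (\<Sum>l=1..k. form_vec B (v l))"
proof -
  have lt: "enat k < cdim (UNIV :: 'a set)" using dim by simp
  obtain x where x: "norm x = 1" "\<And>l. l \<in> {1..k} \<Longrightarrow> cinner x (u l) = 0"
    using ex_orthogonal[OF u lt] by blast
  obtain y where y: "norm y = 1" "\<And>l. l \<in> {1..k} \<Longrightarrow> cinner y (v l) = 0"
    using ex_orthogonal[OF v lt] by blast
  have ou: "orthonormal (Suc k) (u(Suc k := x))" and ov: "orthonormal (Suc k) (v(Suc k := y))"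
    using orthonormal_extend[OF u x] orthonormal_extend[OF v y] by auto
  \<comment> \<open>The two normals leave room for a third orthogonal vector as soon as the
    dimension \<open>k + 1\<close> is at least \<open>3\<close>.\<close>
  obtain z where z: "(\<forall>v. B 3 v = 0) \<or> norm z = 1 \<and> cinner z x = 0 \<and> cinner z y = 0"
  proof (cases "\<forall>v. B 3 v = 0")
    case False
    have "orthonormal 1 (\<lambda>_. x)" using x(1) by (simp add: orthonormal_def cinner_eq_one_iff)
    moreover have "enat (Suc 1) < cdim (UNIV :: 'a set)" using z False dim by simp
    ultimately obtain z where "norm z = 1" "\<And>l::nat. l \<in> {1..1} \<Longrightarrow> cinner z x = 0" "cinner z y = 0"
      using ex_orthogonal_insert[of 1 "\<lambda>_. x" y] by blast
    with that show ?thesis by force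
  qed (use that in blast)
  obtain a b c where w: "norm (scaleC a x + scaleC b y + scaleC c z) = 1"
    "form_vec B (scaleC a x + scaleC b y + scaleC c z)
        = (1 - t) *\<^sub>R form_vec B x + t *\<^sub>R form_vec B y"
    using form_vec_segment[where B = B, OF B x(1) y(1) t z] by blast
  define w0 where "w0 = scaleC a x + scaleC b y + scaleC c z"
  have "orthonormal 1 (\<lambda>_. w0)" using w(1) by (simp add: orthonormal_def cinner_eq_one_iff w0_def)
  then obtain r where r: "orthonormal (Suc k) r" "r 1 = w0"
    using ex_orthonormal_extension[of 1 "\<lambda>_. w0" "Suc k"] dim by auto
  \<comment> \<open>Shifting the index drops \<open>r 1\<close>, which is the new normal
    \<open>w0\<close>.\<close>
  define w' where "w' l = r (Suc l)" for l
  have ow: "orthonormal k w'"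
    using r(1) unfolding orthonormal_def w'_def by auto
  define \<Theta> where "\<Theta> = (\<Sum>l=1..Suc k. form_vec B (r l))"
  have tr: "(\<Sum>l=1..Suc k. form_vec B (q l)) = \<Theta>" if "orthonormal (Suc k) q" for q
    unfolding \<Theta>_def by (intro form_vec_trace_eq B that r(1) proj_full) (simp add: dim)
  have "(\<Sum>l=1..k. form_vec B (u l)) + form_vec B x = (\<Sum>l=1..Suc k. form_vec B ((u(Suc k := x)) l))"
    by (simp add: sum.cl_ivl_Suc)
  then have su: "(\<Sum>l=1..k. form_vec B (u l)) = \<Theta> - form_vec B x"
    unfolding tr[OF ou] by (simp add: eq_diff_eq)
  have "(\<Sum>l=1..k. form_vec B (v l)) + form_vec B y = (\<Sum>l=1..Suc k. form_vec B ((v(Suc k := y)) l))"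
    by simp
  then have sv: "(\<Sum>l=1..k. form_vec B (v l)) = \<Theta> - form_vec B y"
    unfolding tr[OF ov] by (simp add: eq_diff_eq)
  have "\<Theta> = form_vec B w0 + (\<Sum>l=1..k. form_vec B (w' l))"
    unfolding \<Theta>_def w'_def r(2)[symmetric]
    by (subst sum.atLeast_Suc_atMost, simp, subst sum.atLeast_Suc_atMost_Suc_shift, simp only: o_def)
  then have "(\<Sum>l=1..k. form_vec B (w' l)) = \<Theta> - ((1 - t) *\<^sub>R form_vec B x + t *\<^sub>R form_vec B y)"
    using w(2) by (simp add: w0_def)
  also have "\<dots> = (1 - t) *\<^sub>R (\<Theta> - form_vec B x) + t *\<^sub>R (\<Theta> - form_vec B y)"
    by (simp add: algebra_simps)
  finally show ?thesis using ow unfolding su sv by blast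
qed

lemma frames_segment:
  fixes B :: "3 \<Rightarrow> 'a::complex_inner \<Rightarrow> 'a"
  assumes B: "\<And>i. clinear (B i)" "\<And>i. selfadjoint (B i)"
    and u: "orthonormal k u" and v: "orthonormal k v" and k: "0 < k"
    and dim: "enat k < cdim (UNIV :: 'a set)" and t: "0 \<le> t" "t \<le> 1"
    and z: "(\<forall>v. B 3 v = 0) \<or> 3 \<le> cdim (UNIV :: 'a set)"
  shows "\<exists>w. orthonormal k w \<and> (\<Sum>l=1..k. form_vec B (w l))
      = (1 - t) *\<^sub>R (\<Sum>l=1..k. form_vec B (u l)) + t *\<^sub>R (\<Sum>l=1..k. form_vec B (v l))"
proof (cases "cdim (UNIV :: 'a set) = enat (Suc k)")
  case True
  have "(\<forall>v. B 3 v = 0) \<or> 2 \<le> k"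
    using z unfolding True by (auto simp: numeral_eq_enat)
  then show ?thesis by (rule frames_segment_codim_1[OF B u v True t])
next
  case False
  then have "enat (Suc k) < cdim (UNIV :: 'a set)"
    using Suc_ile_eq[of k "cdim (UNIV :: 'a set)"] dim by (metis order_le_less)
  then show ?thesis by (intro frames_segment_codim_ge_2 B u v k t)
qed

subsection \<open>Separating forms by their restriction to a plane\<close>

text \<open>Lower semicontinuity of the rank: composed with a right inverse \<open>G\<close> of
  \<open>N0\<close>, the map \<open>N e\<close> is close to the identity on \<open>range N0\<close>
  and hence injective there.\<close>

lemma eventually_dim_range_ge:
  fixes N :: "real \<Rightarrow> 'v::euclidean_space \<Rightarrow> 'w::euclidean_space"
  assumes N: "\<And>e. linear (N e)" and N0: "linear N0"
    and lim: "\<And>b. ((\<lambda>e. N e b) \<longlongrightarrow> N0 b) F"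
  shows "eventually (\<lambda>e. dim (range N0) \<le> dim (range (N e))) F"
proof -
  obtain G where G: "linear G" "\<And>w. w \<in> range N0 \<Longrightarrow> N0 (G w) = w"
    using linear_exists_right_inverse_on[OF N0 subspace_UNIV] by auto
  \<comment> \<open>The sum over the basis bounds the operator norm of the difference; once it is
    below \<open>1\<close>, no nonzero vector of \<open>range N0\<close> is annihilated.\<close>
  have "((\<lambda>e. \<Sum>b\<in>Basis. norm (N e (G b) - N0 (G b))) \<longlongrightarrow> (\<Sum>b\<in>(Basis :: 'w set). norm (N0 (G b) - N0 (G b)))) F"
    by (intro tendsto_intros lim)
  then have "eventually (\<lambda>e. (\<Sum>b\<in>(Basis :: 'w set). norm (N e (G b) - N0 (G b))) < 1) F"
    by (rule order_tendstoD) simp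
  then show ?thesis
  proof eventually_elim
    case (elim e)
    have lin: "linear (\<lambda>w. N e (G w))" using linear_compose[OF G(1) N[of e]] by (simp add: o_def)
    have lin': "linear (\<lambda>w. N e (G w) - N0 (G w))"
      using linear_compose_sub[OF lin linear_compose[OF G(1) N0, unfolded o_def]] .
    have "w = 0" if w: "w \<in> range N0" "N e (G w) = 0" for w
    proof (rule ccontr)
      assume "w \<noteq> 0"
      have "w = (\<Sum>b\<in>Basis. (w \<bullet> b) *\<^sub>R b)" by (simp add: euclidean_representation)
      then have "N e (G w) - N0 (G w) = (\<Sum>b\<in>Basis. (w \<bullet> b) *\<^sub>R (N e (G b) - N0 (G b)))"
        using linear_sum[OF lin'] linear_cmul[OF lin'] by (metis (no_types, lifting) sum.cong)
      then have "norm w \<le> (\<Sum>b\<in>Basis. norm ((w \<bullet> b) *\<^sub>R (N e (G b) - N0 (G b))))"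
        using w G(2)[OF w(1)] norm_sum by (metis diff_0 norm_minus_cancel)
      also have "\<dots> \<le> (\<Sum>b\<in>Basis. norm w * norm (N e (G b) - N0 (G b)))"
        by (intro sum_mono) (simp add: mult_right_mono Basis_le_norm)
      also have "\<dots> = norm w * (\<Sum>b\<in>(Basis :: 'w set). norm (N e (G b) - N0 (G b)))"
        by (simp add: sum_distrib_left)
      also have "\<dots> < norm w * 1" using elim \<open>w \<noteq> 0\<close> by (intro mult_strict_left_mono) auto
      finally show False by simp
    qed
    moreover have sub: "subspace (range N0)" by (intro linear_subspace_image N0 subspace_UNIV)
    ultimately have "inj_on (\<lambda>w. N e (G w)) (span (range N0))"
      using linear_inj_on_iff_eq_0[OF lin sub] by (simp add: span_eq_iff[THEN iffD2, OF sub])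
    then have "dim (range N0) = dim ((\<lambda>w. N e (G w)) ` range N0)"
      using dim_image_eq[OF lin] by simp
    also have "\<dots> \<le> dim (range (N e))" by (intro dim_subset) auto
    finally show ?case .
  qed
qed

text \<open>Rescaling \<open>L e\<close> by \<open>f e\<close> along \<open>a\<close> does not
  enlarge its range. The rescaled maps \<open>N e\<close> converge to \<open>N0\<close>, whose range
  contains \<open>c\<close> in addition to the range of \<open>L0\<close>, and the rank is lower
  semicontinuous.\<close>

lemma eventually_dim_range_increase:
  fixes L :: "real \<Rightarrow> 'v::euclidean_space \<Rightarrow> 'w::euclidean_space"
  assumes L: "\<And>e. linear (L e)" and L0: "linear L0"
    and lim: "\<And>b. ((\<lambda>e. L e b) \<longlongrightarrow> L0 b) F"
    and a: "a \<noteq> 0" "L0 a = 0" and c: "c \<notin> range L0"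
    and flim: "((\<lambda>e. f e *\<^sub>R L e a) \<longlongrightarrow> c) F"
  shows "eventually (\<lambda>e. dim (range L0) < dim (range (L e))) F"
proof -
  \<comment> \<open>The coefficient of the orthogonal projection of \<open>b\<close> onto the line
    of \<open>a\<close>.\<close>
  define k where "k b = (a \<bullet> b) / (a \<bullet> a)" for b
  have k: "k (b + b') = k b + k b'" "k (r *\<^sub>R b) = r * k b" "k a = 1" for b b' r
    using a(1) by (simp_all add: k_def inner_add_right add_divide_distrib)
  define N where "N e b = L e b + k b *\<^sub>R (f e *\<^sub>R L e a - L e a)" for e b
  define N0 where "N0 b = L0 b + k b *\<^sub>R c" for b
  have "linear (N e)" for e
    by (intro linearI)
      (simp_all add: N_def k linear_add[OF L] linear_cmul[OF L] algebra_simps)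
  moreover have linN0: "linear N0"
    by (intro linearI)
      (simp_all add: N0_def k linear_add[OF L0] linear_cmul[OF L0] algebra_simps)
  moreover have "((\<lambda>e. N e b) \<longlongrightarrow> N0 b) F" for b
  proof -
    have "((\<lambda>e. L e b + k b *\<^sub>R (f e *\<^sub>R L e a - L e a)) \<longlongrightarrow> L0 b + k b *\<^sub>R (c - L0 a)) F"
      by (intro tendsto_intros lim flim)
    then show ?thesis by (simp add: N_def N0_def a(2))
  qed
  ultimately have ev: "eventually (\<lambda>e. dim (range N0) \<le> dim (range (N e))) F"
    by (rule eventually_dim_range_ge)
  have "insert c (range L0) \<subseteq> range N0"
  proof -
    have "c = N0 a" by (simp add: N0_def a(2) k)
    moreover have "L0 b = N0 (b - k b *\<^sub>R a)" for b
    proof -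
      have "k (b - k b *\<^sub>R a) = 0" using k(1)[of "b - k b *\<^sub>R a" "k b *\<^sub>R a"] k(2,3) by simp
      then show ?thesis using a(2) by (simp add: N0_def linear_diff[OF L0] linear_cmul[OF L0])
    qed
    ultimately show ?thesis by (metis insert_subset image_subsetI rangeI)
  qed
  then have "dim (insert c (range L0)) \<le> dim (range N0)" by (rule dim_subset)
  moreover have "subspace (range L0)" by (intro linear_subspace_image L0 subspace_UNIV)
  then have "c \<notin> span (range L0)" using c by (simp add: span_eq_iff[THEN iffD2])
  then have "dim (insert c (range L0)) = Suc (dim (range L0))" by (simp add: dim_insert)
  moreover have "dim (range (N e)) \<le> dim (range (L e))" for e
  proof (rule dim_subset, rule image_subsetI)
    fix b
    have "L e (b + (k b * (f e - 1)) *\<^sub>R a) = L e b + (k b * (f e - 1)) *\<^sub>R L e a"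
      by (simp only: linear_add[OF L] linear_cmul[OF L])
    then have "N e b = L e (b + (k b * (f e - 1)) *\<^sub>R a)"
      by (simp add: N_def algebra_simps)
    then show "N e b \<in> range (L e)" by simp
  qed
  ultimately show ?thesis
    using ev by (auto elim!: eventually_mono) (meson Suc_le_lessD order.trans)
qed

text \<open>The matrix of the Hermitian form of \<open>h a\<close> on the span of \<open>x\<close>
  and \<open>y\<close>; for self-adjoint \<open>h a\<close> the missing entry is the conjugate of
  the last one. This makes four real parameters.\<close>

definition restr :: "('v \<Rightarrow> 'a::complex_inner \<Rightarrow> 'a) \<Rightarrow> 'a \<Rightarrow> 'a \<Rightarrow> 'v \<Rightarrow> real \<times> real \<times> complex" where
  "restr h x y a = (Re (cinner (h a x) x), Re (cinner (h a y) y), cinner (h a x) y)"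

text \<open>Both vectors move along the same \<open>z\<close>, so the second-order term is a
  multiple of a single form of rank one.\<close>

lemma restr_perturb:
  assumes "clinear (h a)" "selfadjoint (h a)"
  shows "restr h (x + scaleC (of_real e * p) z) (y + scaleC (of_real e * q) z) a = restr h x y a
    + e *\<^sub>R (2 * Re (p * cinner (h a z) x), 2 * Re (q * cinner (h a z) y),
        p * cinner (h a z) y + cnj q * cnj (cinner (h a z) x))
    + (e\<^sup>2 * Re (cinner (h a z) z)) *\<^sub>R ((cmod p)\<^sup>2, (cmod q)\<^sup>2, p * cnj q)"
proof -
  have exp: "cinner (h a (x + scaleC b z)) (y + scaleC c z) = cinner (h a x) y
      + (b * cinner (h a z) y + cnj c * cnj (cinner (h a z) x)) + b * cnj c * cinner (h a z) z" for x y b c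
    using selfadjoint_cnj[OF assms(2), of z x]
    by (simp add: clinear_add[OF assms(1)] clinear_scaleC[OF assms(1)] cinner_simps algebra_simps)
  define \<nu> where "\<nu> = Re (cinner (h a z) z)"
  have \<nu>: "cinner (h a z) z = of_real \<nu>"
    unfolding \<nu>_def by (rule selfadjoint_real[OF assms(2)])
  have diag: "Re (cinner (h a (x + scaleC (of_real e * p) z)) (x + scaleC (of_real e * p) z))
      = Re (cinner (h a x) x) + e * (2 * Re (p * cinner (h a z) x)) + e\<^sup>2 * \<nu> * (cmod p)\<^sup>2" for x p
  proof -
    have "of_real e * p * cnj (of_real e * p) * cinner (h a z) z = of_real (e\<^sup>2 * \<nu> * (cmod p)\<^sup>2)"
      unfolding \<nu> of_real_mult complex_norm_square by (simp add: power2_eq_square)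
    moreover have "of_real e * p * cinner (h a z) x + cnj (of_real e * p) * cnj (cinner (h a z) x)
        = of_real (e * (2 * Re (p * cinner (h a z) x)))"
      by (simp add: complex_eq_iff algebra_simps)
    ultimately show ?thesis unfolding exp by simp
  qed
  show ?thesis
    unfolding restr_def diag unfolding exp \<nu>_def[symmetric] \<nu>
    by (simp add: scaleR_conv_of_real algebra_simps power2_eq_square)
qed

text \<open>The functional \<open>E\<close> evaluates a form at the vector with coefficients
  \<open>cnj s\<close> and \<open>- cnj p\<close>. The first-order variations fill its kernel, and
  the positive definite form \<open>(m, n, g)\<close> lies outside it.\<close>

lemma first_order_forms_span:
  fixes R :: "(real \<times> real \<times> complex) set"
  assumes R: "subspace R" and ps: "p \<noteq> 0 \<or> s \<noteq> 0"
    and \<iota>: "(m, n, g) \<in> R" "m \<ge> 0" "(cmod g)\<^sup>2 < m * n"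
    and D: "\<And>a b. (2 * Re (a * p), 2 * Re (b * s), a * s + cnj b * cnj p) \<in> R"
  shows "R = UNIV"
proof -
  define E where "E = (\<lambda>(c1, c2, c3). (cmod s)\<^sup>2 * c1 + (cmod p)\<^sup>2 * c2 - 2 * Re (cnj s * p * c3))"
  have "m > 0" using \<iota>(2,3) by (metis le_less_trans less_eq_real_def mult_zero_left order_less_irrefl zero_le_power2)
  \<comment> \<open>Completing the square.\<close>
  have "m * E (m, n, g) = (cmod (of_real m * s - p * g))\<^sup>2 + (cmod p)\<^sup>2 * (m * n - (cmod g)\<^sup>2)"
    unfolding E_def case_prod_conv cmod_power2 by (simp add: power2_eq_square algebra_simps)
  also have "\<dots> > 0"
  proof (cases "p = 0")
    case True
    then show ?thesis using ps \<open>m > 0\<close> by simp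
  next
    case False
    then show ?thesis using \<iota>(3) by (intro add_nonneg_pos) auto
  qed
  finally have E\<iota>: "E (m, n, g) > 0" using \<open>m > 0\<close> by (simp add: zero_less_mult_iff)
  have E0: "(c1, c2, c3) \<in> R" if "E (c1, c2, c3) = 0" for c1 c2 c3
  proof (cases "p = 0")
    case True
    then have "s \<noteq> 0" using ps by simp
    with that True have "c1 = 0" by (simp add: E_def)
    then show ?thesis using D[of "c3 / s" "of_real c2 / (2 * s)"] True \<open>s \<noteq> 0\<close> by simp
  next
    case False
    \<comment> \<open>The first and third coordinates determine \<open>a\<close> and
      \<open>b\<close>; \<open>E = 0\<close> then yields the second.\<close>
    define a where "a = of_real c1 / (2 * p)"
    define b where "b = cnj ((c3 - a * s) / cnj p)"
    have 1: "2 * Re (a * p) = c1" using False by (simp add: a_def)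
    have 3: "a * s + cnj b * cnj p = c3" using False by (simp add: b_def)
    have "b * s * of_real ((cmod p)\<^sup>2) = cnj ((c3 - a * s) * cnj s * p)"
      using False unfolding complex_norm_square b_def by (simp add: field_simps)
    then have "Re (b * s * of_real ((cmod p)\<^sup>2)) = Re ((c3 - a * s) * cnj s * p)"
      by (simp only: cnj.sel)
    moreover have "(c3 - a * s) * cnj s * p = cnj s * p * c3 - of_real ((cmod s)\<^sup>2) * (a * p)"
      unfolding complex_norm_square by (simp add: algebra_simps)
    moreover have "Re (b * s * of_real ((cmod p)\<^sup>2)) = Re (b * s) * (cmod p)\<^sup>2"
      by (metis Re_of_real_times mult.commute)
    moreover have "Re (of_real ((cmod s)\<^sup>2) * (a * p)) = (cmod s)\<^sup>2 * Re (a * p)"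
      by (rule Re_of_real_times)
    ultimately have "Re (b * s) * (cmod p)\<^sup>2 = Re (cnj s * p * c3) - (cmod s)\<^sup>2 * (c1 / 2)"
      using 1 by simp
    with that have "(cmod p)\<^sup>2 * (2 * Re (b * s)) = (cmod p)\<^sup>2 * c2"
      by (simp add: E_def algebra_simps)
    then have 2: "2 * Re (b * s) = c2" using False by simp
    show ?thesis using D[of a b] unfolding 1 2 3 .
  qed
  have "c \<in> R" for c
  proof -
    define \<kappa> where "\<kappa> = E c / E (m, n, g)"
    obtain c1 c2 c3 where c: "c = (c1, c2, c3)" by (cases c)
    have "E (c1 - \<kappa> * m, c2 - \<kappa> * n, c3 - of_real \<kappa> * g) = E c - \<kappa> * E (m, n, g)"
      by (simp add: E_def c algebra_simps)
    also have "\<dots> = 0" using E\<iota> by (simp add: \<kappa>_def)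
    finally have "(c1 - \<kappa> * m, c2 - \<kappa> * n, c3 - of_real \<kappa> * g) \<in> R" by (rule E0)
    from subspace_add[OF R this subspace_scale[OF R \<iota>(1), of \<kappa>]]
    show ?thesis by (simp add: c scaleR_conv_of_real)
  qed
  then show ?thesis by auto
qed

text \<open>Forms of rank one span all Hermitian ones: the off-diagonal units arise from the vectors
  \<open>(1, 1)\<close> and \<open>(\<i>, 1)\<close> after subtracting diagonal ones.\<close>

lemma second_order_forms_span:
  fixes R :: "(real \<times> real \<times> complex) set"
  assumes R: "subspace R" and D: "\<And>a b. ((cmod a)\<^sup>2, (cmod b)\<^sup>2, a * cnj b) \<in> R"
  shows "R = UNIV"
proof -
  have 1: "(1, 0, 0) \<in> R" using D[of 1 0] by simp
  have 2: "(0, 1, 0) \<in> R" using D[of 0 1] by simp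
  have "(0, 0, 1) \<in> R"
    using subspace_diff[OF R subspace_diff[OF R D[of 1 1] 1] 2] by simp
  moreover have "(0, 0, \<i>) \<in> R"
    using subspace_diff[OF R subspace_diff[OF R D[of \<i> 1] 1] 2] by simp
  moreover have "(c1, c2, c3) = c1 *\<^sub>R (1, 0, 0) + c2 *\<^sub>R (0, 1, 0) + Re c3 *\<^sub>R (0, 0, 1) + Im c3 *\<^sub>R (0, 0, \<i>)" for c1 c2 c3
    by (simp add: complex_eq_iff)
  ultimately have "(c1, c2, c3) \<in> R" for c1 c2 c3
    using 1 2 by (metis subspace_add[OF R] subspace_scale[OF R])
  then show ?thesis by auto
qed

text \<open>At \<open>z + T z\<close> the form reduces to twice the squared norm of
  \<open>T z\<close>.\<close>

lemma selfadjoint_form_zero: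
  assumes T: "clinear T" "selfadjoint T" and 0: "\<And>z. cinner (T z) z = 0"
  shows "T z = 0"
proof -
  have "cinner (T (z + T z)) (z + T z) = cinner (T z) (T z) + cinner (T (T z)) z"
    using 0[of z] 0[of "T z"] by (simp add: clinear_add[OF T(1)] cinner_simps)
  also have "cinner (T (T z)) z = cinner (T z) (T z)" using T(2) by (simp add: selfadjoint_def)
  finally show ?thesis using 0[of "z + T z"] by simp
qed

text \<open>Take a pair of maximal rank among the independent ones. A kernel element
  \<open>a \<noteq> 0\<close> leaves part of the target uncovered, and a variation of the pair moves
  the image of \<open>a\<close> there: to first order if some \<open>h a z\<close> is not orthogonal
  to the pair, to second order otherwise.\<close>

lemma ex_injective_restr:
  fixes h :: "real \<times> real \<times> complex \<Rightarrow> 'a::complex_inner \<Rightarrow> 'a" and x0 y0 :: 'a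
  assumes lin: "\<And>v. linear (\<lambda>a. h a v)" and cl: "\<And>a. clinear (h a)" and sa: "\<And>a. selfadjoint (h a)"
    and id: "\<And>v. h \<iota> v = v" and inj: "\<And>a. (\<And>v. h a v = 0) \<Longrightarrow> a = 0"
    and xy: "norm x0 = 1" "norm y0 = 1" "cinner x0 y0 = 0"
  shows "\<exists>x y. inj (restr h x y) \<and> (cmod (cinner x y))\<^sup>2 < (norm x)\<^sup>2 * (norm y)\<^sup>2"
proof -
  have linr: "linear (restr h x y)" for x y
    by (rule linearI)
      (simp_all add: restr_def linear_add[OF lin] linear_cmul[OF lin] cinner_simps cinner_scaleR_left)
  \<comment> \<open>The strict Cauchy-Schwarz inequality: linear independence of the pair, as a
    visibly open condition.\<close>
  define P where "P m \<longleftrightarrow> (cmod (cinner (fst m) (snd m)))\<^sup>2 < (norm (fst m))\<^sup>2 * (norm (snd m :: 'a))\<^sup>2" for m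
  define rk where "rk m = dim (range (restr h (fst m) (snd m)))" for m
  have "P (x0, y0)" using xy by (simp add: P_def)
  moreover have "\<forall>m. P m \<longrightarrow> rk m < Suc (DIM(real \<times> real \<times> complex))"
    unfolding rk_def less_Suc_eq_le by (intro allI impI dim_subset_UNIV)
  ultimately have "\<exists>m. P m \<and> (\<forall>m'. P m' \<longrightarrow> rk m' \<le> rk m)"
    by (rule ex_has_greatest_nat)
  then obtain m where m: "P m" "\<And>m'. P m' \<Longrightarrow> rk m' \<le> rk m" by blast
  obtain x y where mxy: "m = (x, y)" by (cases m)
  have "inj (restr h x y)"
  proof (rule ccontr)
    assume "\<not> inj (restr h x y)"
    then obtain a where a: "a \<noteq> 0" "restr h x y a = 0"
      using linear_injective_0[OF linr] by blast
    define R where "R = range (restr h x y)"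
    have sub: "subspace R" unfolding R_def by (intro linear_subspace_image linr subspace_UNIV)
    \<comment> \<open>Source and target both have real dimension 4, so surjectivity would imply
      injectivity.\<close>
    have "R \<noteq> UNIV"
      using linear_surjective_imp_injective[OF linr, of x y] \<open>\<not> inj (restr h x y)\<close> by (auto simp: R_def)
    have restr_id: "restr h x y \<iota> = ((norm x)\<^sup>2, (norm y)\<^sup>2, cinner x y)" for x y
      by (simp add: restr_def id cinner_self)
    define D where "D b z p q = (2 * Re (p * cinner (h b z) x), 2 * Re (q * cinner (h b z) y),
        p * cinner (h b z) y + cnj q * cnj (cinner (h b z) x))" for b z p q
    define E where "E p q = ((cmod p)\<^sup>2, (cmod q)\<^sup>2, p * cnj q)" for p q
    define L where "L z p q e = restr h (x + scaleC (of_real e * p) z) (y + scaleC (of_real e * q) z)" for z p q e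
    have L: "L z p q e b = restr h x y b + e *\<^sub>R D b z p q + (e\<^sup>2 * Re (cinner (h b z) z)) *\<^sub>R E p q" for z p q e b
      unfolding L_def D_def E_def by (rule restr_perturb[OF cl sa])
    \<comment> \<open>A rescaled image of \<open>a\<close> with limit outside \<open>R\<close>
      raises the rank at nearby independent pairs, against maximality.\<close>
    have contra: False
      if c: "c \<notin> R" and flim: "((\<lambda>e. f e *\<^sub>R L z p q e a) \<longlongrightarrow> c) (at_right 0)" for z p q c and f :: "real \<Rightarrow> real"
    proof -
      have lim: "((\<lambda>e. L z p q e b) \<longlongrightarrow> restr h x y b) (at_right 0)" for b
      proof -
        have "((\<lambda>e. restr h x y b + e *\<^sub>R D b z p q + (e\<^sup>2 * Re (cinner (h b z) z)) *\<^sub>R E p q)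
          \<longlongrightarrow> restr h x y b + 0 *\<^sub>R D b z p q + (0\<^sup>2 * Re (cinner (h b z) z)) *\<^sub>R E p q) (at_right 0)"
          by (intro tendsto_intros)
        then show ?thesis unfolding L by simp
      qed
      have "eventually (\<lambda>e. dim (range (restr h x y)) < dim (range (L z p q e))) (at_right 0)"
        using c unfolding R_def
        by (intro eventually_dim_range_increase[OF _ linr lim a _ flim]) (simp_all add: L_def linr)
      moreover have "eventually (\<lambda>e. P (x + scaleC (of_real e * p) z, y + scaleC (of_real e * q) z)) (at_right 0)"
      proof -
        \<comment> \<open>At the image of \<open>\<iota>\<close>, this is the Gram determinant of
          the pair.\<close>
        define \<Delta> where "\<Delta> v = fst v * fst (snd v) - (cmod (snd (snd v)))\<^sup>2" for v :: "real \<times> real \<times> complex"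
        have "((\<lambda>e. \<Delta> (L z p q e \<iota>)) \<longlongrightarrow> \<Delta> (restr h x y \<iota>)) (at_right 0)"
          unfolding \<Delta>_def by (intro tendsto_intros lim)
        moreover have "0 < \<Delta> (restr h x y \<iota>)"
          using m(1) unfolding restr_id \<Delta>_def P_def mxy by simp
        ultimately have "eventually (\<lambda>e. 0 < \<Delta> (L z p q e \<iota>)) (at_right 0)"
          by (rule order_tendstoD(1))
        then show ?thesis unfolding L_def restr_id \<Delta>_def P_def by simp
      qed
      ultimately have "eventually (\<lambda>e. False) (at_right (0 :: real))"
      proof eventually_elim
        case (elim e)
        from m(2)[OF elim(2)] elim(1) show False by (simp add: rk_def mxy L_def)
      qed
      then show False by simp
    qed
    have La: "L z p q e a = e *\<^sub>R D a z p q + (e\<^sup>2 * Re (cinner (h a z) z)) *\<^sub>R E p q" for z p q e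
      unfolding L a(2) by simp
    have ev0: "eventually (\<lambda>e. e \<noteq> 0) (at_right (0 :: real))"
      by (simp add: eventually_at_filter)
    show False
    proof (cases "\<exists>z. cinner (h a z) x \<noteq> 0 \<or> cinner (h a z) y \<noteq> 0")
      case True
      then obtain z where z: "cinner (h a z) x \<noteq> 0 \<or> cinner (h a z) y \<noteq> 0" by blast
      \<comment> \<open>Otherwise \<open>R\<close> contains all first-order variations and the
        positive definite Gram matrix of the pair.\<close>
      have "\<exists>p q. D a z p q \<notin> R"
      proof (rule ccontr)
        assume "\<nexists>p q. D a z p q \<notin> R"
        then have "R = UNIV"
          using m(1) rangeI[of "restr h x y" \<iota>, unfolded restr_id] unfolding D_def P_def mxy
          by (intro first_order_forms_span[OF sub z, of "(norm x)\<^sup>2" "(norm y)\<^sup>2" "cinner x y"])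
            (simp_all add: R_def)
        with \<open>R \<noteq> UNIV\<close> show False by simp
      qed
      then obtain p q where pq: "D a z p q \<notin> R" by blast
      have "((\<lambda>e. D a z p q + (e * Re (cinner (h a z) z)) *\<^sub>R E p q) \<longlongrightarrow>
          D a z p q + (0 * Re (cinner (h a z) z)) *\<^sub>R E p q) (at_right 0)"
        by (intro tendsto_intros)
      then have "((\<lambda>e. D a z p q + (e * Re (cinner (h a z) z)) *\<^sub>R E p q) \<longlongrightarrow> D a z p q) (at_right 0)"
        by simp
      moreover have "eventually (\<lambda>e. D a z p q + (e * Re (cinner (h a z) z)) *\<^sub>R E p q
          = (1 / e) *\<^sub>R L z p q e a) (at_right 0)"
        using ev0 unfolding La by eventually_elim (simp add: scaleR_add_right power2_eq_square)
      ultimately have "((\<lambda>e. (1 / e) *\<^sub>R L z p q e a) \<longlongrightarrow> D a z p q) (at_right 0)"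
        by (rule Lim_transform_eventually)
      from contra[OF pq this] show False .
    next
      case False
      \<comment> \<open>Now \<open>h a\<close> maps into the orthogonal complement of the pair and
        the first-order term is absent, but \<open>h a \<noteq> 0\<close> still has a nonzero form
        value at some \<open>z\<close>.\<close>
      then have D0: "D a z p q = 0" for z p q by (simp add: D_def zero_prod_def)
      obtain z where z: "cinner (h a z) z \<noteq> 0"
        using selfadjoint_form_zero[OF cl sa] inj[of a] a(1) by metis
      define \<nu> where "\<nu> = Re (cinner (h a z) z)"
      have \<nu>: "\<nu> \<noteq> 0" using z selfadjoint_real[OF sa, of a z] by (auto simp: \<nu>_def)
      obtain p q where pq: "E p q \<notin> R"
        using second_order_forms_span[OF sub] \<open>R \<noteq> UNIV\<close> unfolding E_def by blast
      have "eventually (\<lambda>e. E p q = (1 / (e\<^sup>2 * \<nu>)) *\<^sub>R L z p q e a) (at_right 0)"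
        using ev0 unfolding La D0 \<nu>_def[symmetric] by eventually_elim (simp add: \<nu>)
      then have "((\<lambda>e. (1 / (e\<^sup>2 * \<nu>)) *\<^sub>R L z p q e a) \<longlongrightarrow> E p q) (at_right 0)"
        by (rule Lim_transform_eventually[OF tendsto_const])
      from contra[OF pq this] show False .
    qed
  qed
  with m(1) show ?thesis unfolding P_def mxy by auto
qed

subsection \<open>Failure of convexity\<close>

lemma clinear_proj: "clinear (proj k w)"
  using proj_comb[of k w 1 _ 1] proj_comb[of k w _ _ 0]
  by (simp add: clinear_def scaleC_one)

lemma clinear_diff: "clinear T \<Longrightarrow> T (x - y) = T x - T y"
  using clinear_add[of T "x - y" y] by simp

lemma cinner_proj_self: "cinner (proj k w v) v = of_real (\<Sum>l=1..k. (cmod (cinner v (w l)))\<^sup>2)"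
proof -
  have "cinner v (proj k w v) = of_real (\<Sum>l=1..k. (cmod (cinner v (w l)))\<^sup>2)"
    unfolding cinner_proj_right of_real_sum complex_norm_square ..
  then show ?thesis using cinner_commute[of "proj k w v" v] by simp
qed

lemma bounded_clinear_proj: "bounded_clinear (proj k w)"
proof -
  have "bounded_linear (\<lambda>v. scaleC (cinner v (w l)) (w l))" for l
    using bounded_linear_compose[OF bounded_bilinear.bounded_linear_left[OF bounded_bilinear_scaleC]
        bounded_bilinear.bounded_linear_left[OF bounded_bilinear_cinner]] .
  then have "bounded_linear (proj k w)"
    unfolding proj_def by (intro bounded_linear_sum)
  then show ?thesis
    using clinear_scaleC[OF clinear_proj] by (auto simp: bounded_clinear_def)
qed

lemma bounded_clinear_add:
  "bounded_clinear S \<Longrightarrow> bounded_clinear T \<Longrightarrow> bounded_clinear (\<lambda>v. S v + T v)"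
  by (auto simp: bounded_clinear_def bounded_linear_add cvs.scale_right_distrib)

text \<open>A frame at which the operator \<open>proj (q + 2) x + proj q x\<close> attains its maximal trace consists,
  up to a unitary change, of \<open>x 1, \<dots>, x q\<close> and a unit vector in the plane of the last two \<open>x l\<close>.\<close>

lemma maximal_frame:
  fixes x y :: "nat \<Rightarrow> 'a::complex_inner"
  assumes x: "orthonormal (Suc (Suc q)) x" and y: "orthonormal (Suc q) y"
    and wt: "2 * real q + 1 \<le> (\<Sum>j=1..Suc q. (\<Sum>l=1..Suc (Suc q). (cmod (cinner (y j) (x l)))\<^sup>2)
      + (\<Sum>l=1..q. (cmod (cinner (y j) (x l)))\<^sup>2))"
  obtains a b where "(cmod a)\<^sup>2 + (cmod b)\<^sup>2 = 1"
    "\<And>T. clinear T \<Longrightarrow> (\<Sum>j=1..Suc q. cinner (T (y j)) (y j)) = (\<Sum>l=1..q. cinner (T (x l)) (x l))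
      + cinner (T (scaleC a (x (Suc q)) + scaleC b (x (Suc (Suc q)))))
          (scaleC a (x (Suc q)) + scaleC b (x (Suc (Suc q))))"
proof -
  have xq: "orthonormal q x" using x by (rule orthonormal_mono) simp
  define s where "s j = (\<Sum>l=1..Suc (Suc q). (cmod (cinner (y j) (x l)))\<^sup>2)" for j
  define n where "n l = (\<Sum>j=1..Suc q. (cmod (cinner (y j) (x l)))\<^sup>2)" for l
  have s1: "s j \<le> 1" if "j \<in> {1..Suc q}" for j
    using bessel[OF x, of "y j"] orthonormal_norm[OF y that] by (simp only: s_def) simp
  have n_eq: "n l = (\<Sum>j=1..Suc q. (cmod (cinner (x l) (y j)))\<^sup>2)" for l
    unfolding n_def by (intro sum.cong refl) (metis cinner_commute complex_mod_cnj)
  have lq: "l \<in> {1..Suc (Suc q)}" if "l \<in> {1..q}" for l using that by auto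
  have n1: "n l \<le> 1" if "l \<in> {1..q}" for l
    using bessel[OF y, of "x l"] orthonormal_norm[OF x lq[OF that]] by (simp only: n_eq) simp
  have "(\<Sum>j=1..Suc q. \<Sum>l=1..q. (cmod (cinner (y j) (x l)))\<^sup>2) = (\<Sum>l=1..q. n l)"
    unfolding n_def by (rule sum.swap)
  then have wt': "2 * real q + 1 \<le> (\<Sum>j=1..Suc q. s j) + (\<Sum>l=1..q. n l)"
    using wt unfolding s_def sum.distrib by simp
  have ss: "(\<Sum>j=1..Suc q. s j) \<le> (\<Sum>j=1..Suc q. 1)" using s1 by (intro sum_mono) auto
  have sn: "(\<Sum>l=1..q. n l) \<le> (\<Sum>l=1..q. 1)" using n1 by (intro sum_mono) auto
  \<comment> \<open>The \<open>q + 1\<close> numbers \<open>s j\<close> and the \<open>q\<close>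
    numbers \<open>n l\<close> are at most \<open>1\<close>, so the bound \<open>2 * q + 1\<close>
    forces all of them to be \<open>1\<close>.\<close>
  have sum0: "(\<Sum>j=1..Suc q. 1 - s j) = 0" "(\<Sum>l=1..q. 1 - n l) = 0"
    using wt' ss sn by (simp_all add: sum_subtractf)
  have seq: "s j = 1" if "j \<in> {1..Suc q}" for j
  proof -
    have "1 - s j = 0"
      by (rule sum_nonneg_0[OF finite_atLeastAtMost _ sum0(1) that]) (use s1 in simp)
    then show ?thesis by simp
  qed
  have neq: "n l = 1" if "l \<in> {1..q}" for l
  proof -
    have "1 - n l = 0"
      by (rule sum_nonneg_0[OF finite_atLeastAtMost _ sum0(2) that]) (use n1 in simp)
    then show ?thesis by simp
  qed
  have py: "proj (Suc (Suc q)) x (y j) = y j" if "j \<in> {1..Suc q}" for j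
    using proj_eq_iff[OF x, of "y j"] orthonormal_norm[OF y that] seq[OF that]
    unfolding s_def by simp
  have px: "proj (Suc q) y (x l) = x l" if "l \<in> {1..q}" for l
    using proj_eq_iff[OF y, of "x l"] orthonormal_norm[OF x lq[OF that]] neq[OF that]
    unfolding n_eq by simp
  \<comment> \<open>The span of \<open>x 1, ..., x q\<close> cannot contain \<open>q + 1\<close>
    orthonormal vectors: the squared inner products would add up to \<open>q + 1\<close>, but
    \<open>sn\<close> allows only \<open>q\<close>.\<close>
  obtain j where j: "j \<in> {1..Suc q}" "proj q x (y j) \<noteq> y j"
  proof (rule ccontr)
    assume "\<not> thesis"
    with that have "\<And>j. j \<in> {1..Suc q} \<Longrightarrow> proj q x (y j) = y j" by blast
    then have "(\<Sum>j=1..Suc q. \<Sum>l=1..q. (cmod (cinner (y j) (x l)))\<^sup>2) = (\<Sum>j=1..Suc q. 1)"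
      using proj_eq_iff[OF xq] orthonormal_norm[OF y] by (intro sum.cong) auto
    also have "(\<Sum>j=1..Suc q. \<Sum>l=1..q. (cmod (cinner (y j) (x l)))\<^sup>2) = (\<Sum>l=1..q. n l)"
      unfolding n_def by (rule sum.swap)
    finally show False using sn by simp
  qed
  \<comment> \<open>Removing the components along \<open>x 1, ..., x q\<close> leaves neither the
    span of \<open>y\<close> nor that of \<open>x\<close>, so the normalised \<open>z\<close> lies
    in the plane of the last two \<open>x l\<close>.\<close>
  define d where "d = y j - proj q x (y j)"
  define z where "z = scaleC (of_real (inverse (norm d))) d"
  have "d \<noteq> 0" using j(2) by (simp add: d_def)
  then have z: "norm z = 1" by (simp add: z_def norm_inverse)
  have zx: "cinner z (x l) = 0" if "l \<in> {1..q}" for l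
    using cinner_diff_proj[OF xq that] by (simp add: z_def d_def cinner_scaleC_left)
  have pd: "proj k w d = d"
    if "proj k w (y j) = y j" "\<And>l. l \<in> {1..q} \<Longrightarrow> proj k w (x l) = x l" for k w
  proof -
    have "proj k w (proj q x (y j)) = proj q x (y j)"
      unfolding proj_def[of q x]
      by (simp add: clinear_sum[OF clinear_proj] clinear_scaleC[OF clinear_proj] that(2))
    then show ?thesis by (simp add: d_def clinear_diff[OF clinear_proj] that(1))
  qed
  have pyz: "proj (Suc q) y z = z"
    unfolding z_def clinear_scaleC[OF clinear_proj]
    by (simp only: pd[OF proj_frame[OF y j(1)] px])
  have pxz: "proj (Suc (Suc q)) x z = z"
    unfolding z_def clinear_scaleC[OF clinear_proj]
    by (simp only: pd[OF py[OF j(1)] proj_frame[OF x lq]])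
  define a where "a = cinner z (x (Suc q))"
  define b where "b = cinner z (x (Suc (Suc q)))"
  have "z = (\<Sum>l=1..q. scaleC (cinner z (x l)) (x l)) + scaleC a (x (Suc q)) + scaleC b (x (Suc (Suc q)))"
    using pxz unfolding a_def b_def by (simp add: proj_def)
  also have "(\<Sum>l=1..q. scaleC (cinner z (x l)) (x l)) = 0"
    by (intro sum.neutral) (simp add: zx)
  finally have zab: "z = scaleC a (x (Suc q)) + scaleC b (x (Suc (Suc q)))" by simp
  have "(norm z)\<^sup>2 = (cmod a)\<^sup>2 + (cmod b)\<^sup>2"
    unfolding zab
    by (intro norm_orthogonal_comb orthonormal_norm[OF x]) (simp_all add: orthonormal_cinner[OF x])
  then have ab: "(cmod a)\<^sup>2 + (cmod b)\<^sup>2 = 1" using z by simp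
  have w: "orthonormal (Suc q) (x(Suc q := z))"
    by (intro orthonormal_extend xq z zx)
  have "(\<Sum>j=1..Suc q. cinner (T (y j)) (y j)) = (\<Sum>l=1..q. cinner (T (x l)) (x l)) + cinner (T z) z"
    if "clinear T" for T
  proof -
    have "(\<Sum>j=1..Suc q. cinner (T (y j)) (y j))
        = (\<Sum>l=1..Suc q. cinner (T ((x(Suc q := z)) l)) ((x(Suc q := z)) l))"
      using px pyz by (intro trace_eq that y w) (auto simp: le_Suc_eq)
    then show ?thesis by simp
  qed
  with ab that show thesis unfolding zab by blast
qed

text \<open>Half the trace is the centre of the Bloch ball, while \<open>a\<close> and
  \<open>b\<close> describe a pure state. By surjectivity all matrix entries can be tested: the
  off-diagonal ones give \<open>a * cnj b = 0\<close>, the diagonal ones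
  \<open>|a|^2 = |b|^2 = 1 / 2\<close>.\<close>

lemma half_trace_not_pure:
  fixes a b :: complex
  assumes "surj f" and f: "\<And>v. (cmod a)\<^sup>2 * fst (f v) + (cmod b)\<^sup>2 * fst (snd (f v))
    + 2 * Re (a * cnj b * snd (snd (f v))) = (fst (f v) + fst (snd (f v))) / 2"
  shows False
proof -
  have f': "(cmod a)\<^sup>2 * c1 + (cmod b)\<^sup>2 * c2 + 2 * Re (a * cnj b * c3) = (c1 + c2) / 2" for c1 c2 c3
    using f assms(1) by (metis fst_conv snd_conv surjD)
  have "Re (a * cnj b) = 0" "Im (a * cnj b) = 0" "(cmod a)\<^sup>2 = 1 / 2" "(cmod b)\<^sup>2 = 1 / 2"
    using f'[of 0 0 1] f'[of 0 0 \<i>] f'[of 1 0 0] f'[of 0 1 0] by simp_all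
  then have "a * cnj b = 0" by (simp only: complex_eq_iff) simp
  then have "a = 0 \<or> b = 0" by simp
  with \<open>(cmod a)\<^sup>2 = 1 / 2\<close> \<open>(cmod b)\<^sup>2 = 1 / 2\<close> show False by auto
qed

text \<open>Gram-Schmidt: injectivity depends only on the plane, not on its basis. Between spaces of
  dimension 4 it amounts to surjectivity.\<close>

lemma ex_orthonormal_injective_restr:
  fixes h :: "real \<times> real \<times> complex \<Rightarrow> 'a::complex_inner \<Rightarrow> 'a" and x0 y0 :: 'a
  assumes lin: "\<And>v. linear (\<lambda>a. h a v)" and cl: "\<And>a. clinear (h a)" and sa: "\<And>a. selfadjoint (h a)"
    and id: "\<And>v. h \<iota> v = v" and inj: "\<And>a. (\<And>v. h a v = 0) \<Longrightarrow> a = 0"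
    and xy: "norm x0 = 1" "norm y0 = 1" "cinner x0 y0 = 0"
  obtains e f where "norm e = 1" "norm f = 1" "cinner e f = 0" "surj (restr h e f)"
proof -
  obtain x y where xy: "inj (restr h x y)" "(cmod (cinner x y))\<^sup>2 < (norm x)\<^sup>2 * (norm y)\<^sup>2"
    using ex_injective_restr[OF lin cl sa id inj xy] by blast
  have linr: "linear (restr h e f)" for e f
    by (rule linearI)
      (simp_all add: restr_def linear_add[OF lin] linear_cmul[OF lin] cinner_simps cinner_scaleR_left)
  have "x \<noteq> 0" using xy(2) by auto
  define n where "n = complex_of_real (norm x)"
  have n: "n \<noteq> 0" using \<open>x \<noteq> 0\<close> by (simp add: n_def)
  define e where "e = scaleC (inverse n) x"
  have e: "norm e = 1" using \<open>x \<noteq> 0\<close> by (simp add: e_def n_def norm_inverse)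
  then have ee: "cinner e e = 1" by (simp add: cinner_eq_one_iff)
  have x: "x = scaleC n e" using n by (simp add: e_def scaleC_scaleC scaleC_one)
  define p where "p = cinner y e"
  define d where "d = y - scaleC p e"
  have "d \<noteq> 0"
  proof
    assume "d = 0"
    then have y: "y = scaleC p e" by (simp add: d_def)
    show False using xy(2) ee e unfolding x y
      by (simp add: cinner_simps norm_mult power_mult_distrib)
  qed
  define m where "m = complex_of_real (norm d)"
  have m: "m \<noteq> 0" using \<open>d \<noteq> 0\<close> by (simp add: m_def)
  define f where "f = scaleC (inverse m) d"
  have f: "norm f = 1" using \<open>d \<noteq> 0\<close> by (simp add: f_def m_def norm_inverse)
  have "cinner d e = 0" using ee by (simp add: d_def p_def cinner_simps)
  then have ef: "cinner e f = 0"
    using cinner_zero_commute[of d e] by (simp add: f_def cinner_simps)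
  have y: "y = scaleC p e + scaleC m f"
    using m by (simp add: f_def scaleC_scaleC scaleC_one d_def)
  have "inj (restr h e f)"
  proof (rule linear_injective_0[OF linr, THEN iffD2], intro allI impI)
    fix a assume "restr h e f a = 0"
    then have 0: "cinner (h a e) e = 0" "cinner (h a f) f = 0" "cinner (h a e) f = 0"
      using selfadjoint_real[OF sa, of a e] selfadjoint_real[OF sa, of a f]
      by (simp_all add: restr_def zero_prod_def)
    then have "cinner (h a f) e = 0" using selfadjoint_cnj[OF sa, of a e f] by simp
    with 0 have "restr h x y a = 0"
      unfolding restr_def x y
      by (simp add: clinear_add[OF cl] clinear_scaleC[OF cl] cinner_simps zero_prod_def)
    with xy(1) show "a = 0" using linear_injective_0[OF linr] by blast
  qed
  then have "surj (restr h e f)" by (rule linear_inj_imp_surj[OF linr])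
  with e f ef that show thesis by blast
qed

text \<open>The frame \<open>x 1, ..., x (q + 1)\<close> and the one with \<open>x (q + 2)\<close>
  in the last place have values whose midpoint is not attained: a frame attaining it has maximal
  trace by \<open>wt\<close>, hence yields a unit vector in the last plane that acts as half the
  trace on every \<open>h a\<close>. The premise \<open>wt\<close> accommodates both an ambient
  plane and an additional operator.\<close>

lemma not_convex_joint_num_range:
  fixes A :: "'m::finite \<Rightarrow> 'a::complex_inner \<Rightarrow> 'a" and F :: "real \<times> real \<times> complex \<Rightarrow> 'm \<Rightarrow> real"
  assumes x: "orthonormal (Suc (Suc q)) x"
    and cl: "\<And>a. clinear (h a)" and sa: "\<And>a. selfadjoint (h a)"
    and clA: "\<And>i. clinear (A i)"
    and h: "\<And>a v. h a v = scaleC (of_real (fst a)) v + (\<Sum>i\<in>UNIV. scaleC (of_real (F a i)) (A i v))"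
    and surj: "surj (restr h (x (Suc q)) (x (Suc (Suc q))))"
    and wt: "\<And>y. orthonormal (Suc q) y \<Longrightarrow>
        (\<And>i. (\<Sum>j=1..Suc q. cinner (A i (y j)) (y j)) = (\<Sum>l=1..q. cinner (A i (x l)) (x l))
          + (cinner (A i (x (Suc q))) (x (Suc q)) + cinner (A i (x (Suc (Suc q)))) (x (Suc (Suc q)))) / 2) \<Longrightarrow>
        2 * real q + 1 \<le> (\<Sum>j=1..Suc q. (\<Sum>l=1..Suc (Suc q). (cmod (cinner (y j) (x l)))\<^sup>2)
          + (\<Sum>l=1..q. (cmod (cinner (y j) (x l)))\<^sup>2))"
  shows "\<not> convex (joint_num_range (Suc q) A)"
proof
  assume conv: "convex (joint_num_range (Suc q) A)"
  define e f where "e = x (Suc q)" and "f = x (Suc (Suc q))"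
  have e: "cinner e e = 1" "cinner f f = 1" "cinner e f = 0"
    unfolding e_def f_def using orthonormal_cinner[OF x] by auto
  define x' where "x' = x(Suc q := f)"
  have o1: "orthonormal (Suc q) x" using x by (rule orthonormal_mono) simp
  have "norm f = 1" using e(2) by (simp add: cinner_eq_one_iff)
  then have o2: "orthonormal (Suc q) x'"
    unfolding x'_def using orthonormal_cinner[OF x]
    by (intro orthonormal_extend orthonormal_mono[OF x]) (auto simp: f_def)
  define P where "P w = (\<chi> i. \<Sum>l=1..Suc q. cinner (A i (w l)) (w l))" for w
  have "P x \<in> joint_num_range (Suc q) A" "P x' \<in> joint_num_range (Suc q) A"
    unfolding P_def joint_num_range_def using o1 o2 by blast+
  then have "(1 / 2) *\<^sub>R P x + (1 / 2) *\<^sub>R P x' \<in> joint_num_range (Suc q) A"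
    by (intro convexD[OF conv]) auto
  then obtain y where y: "orthonormal (Suc q) y" "(1 / 2) *\<^sub>R P x + (1 / 2) *\<^sub>R P x' = P y"
    unfolding joint_num_range_def P_def by blast
  have mid: "(\<Sum>j=1..Suc q. cinner (A i (y j)) (y j)) = (\<Sum>l=1..q. cinner (A i (x l)) (x l))
      + (cinner (A i e) e + cinner (A i f) f) / 2" for i
  proof -
    have "P y $ i = (P x $ i + P x' $ i) / 2"
      unfolding y(2)[symmetric]
      by (simp only: vector_add_component vector_scaleR_component)
        (simp add: scaleR_conv_of_real add_divide_distrib)
    moreover have "(\<Sum>l=1..q. cinner (A i (x' l)) (x' l)) = (\<Sum>l=1..q. cinner (A i (x l)) (x l))"
      by (intro sum.cong) (auto simp: x'_def)
    ultimately show ?thesis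
      unfolding P_def by (simp add: x'_def e_def[symmetric] add_divide_distrib)
  qed
  obtain a b where ab: "(cmod a)\<^sup>2 + (cmod b)\<^sup>2 = 1"
    "\<And>T. clinear T \<Longrightarrow> (\<Sum>j=1..Suc q. cinner (T (y j)) (y j)) = (\<Sum>l=1..q. cinner (T (x l)) (x l))
      + cinner (T (scaleC a e + scaleC b f)) (scaleC a e + scaleC b f)"
    using maximal_frame[OF x y(1) wt[OF y(1) mid[unfolded e_def f_def]]] unfolding e_def f_def by blast
  define z where "z = scaleC a e + scaleC b f"
  have Az: "cinner (A i z) z = (cinner (A i e) e + cinner (A i f) f) / 2" for i
    using ab(2)[OF clA, of i] mid[of i] unfolding z_def by simp
  have "norm e = 1" using e(1) by (simp add: cinner_eq_one_iff)
  have "(norm z)\<^sup>2 = 1"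
    unfolding z_def norm_orthogonal_comb[OF \<open>norm e = 1\<close> \<open>norm f = 1\<close> e(3)] by (rule ab(1))
  then have Iz: "cinner z z = (cinner e e + cinner f f) / 2" using e by (simp add: cinner_self)
  \<comment> \<open>The half-trace property is linear in the operator, so it passes from the
    identity and the \<open>A i\<close> to \<open>h c\<close>.\<close>
  have hz: "cinner (h c z) z = (cinner (h c e) e + cinner (h c f) f) / 2" for c
    unfolding h by (simp add: cinner_simps Az Iz sum_divide_distrib add_divide_distrib
        sum.distrib distrib_left)
  show False
  proof (rule half_trace_not_pure[OF surj])
    fix c
    have "Re (cinner (h c z) z) = (Re (cinner (h c e) e) + Re (cinner (h c f) f)) / 2"
      unfolding hz by simp
    then show "(cmod a)\<^sup>2 * fst (restr h (x (Suc q)) (x (Suc (Suc q))) c)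
        + (cmod b)\<^sup>2 * fst (snd (restr h (x (Suc q)) (x (Suc (Suc q))) c))
        + 2 * Re (a * cnj b * snd (snd (restr h (x (Suc q)) (x (Suc (Suc q))) c)))
        = (fst (restr h (x (Suc q)) (x (Suc (Suc q))) c) + fst (snd (restr h (x (Suc q)) (x (Suc (Suc q))) c))) / 2"
      unfolding z_def Re_form_plane[OF cl sa] by (simp add: restr_def e_def f_def)
  qed
qed

subsection \<open>The span of the operators\<close>

lemma cspan_insert_id_range:
  fixes g :: "'n::finite \<Rightarrow> 'a::complex_vector \<Rightarrow> 'a"
  assumes "f \<in> cvs.span (insert id (range g))"
  shows "\<exists>c0 c. \<forall>v. f v = scaleC c0 v + (\<Sum>j\<in>UNIV. scaleC (c j) (g j v))"
proof -
  define V where "V = {f. \<exists>c0 c. \<forall>v. f v = scaleC c0 v + (\<Sum>j\<in>UNIV. scaleC (c j) (g j v))}"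
  have "cvs.subspace V"
  proof (rule cvs.subspaceI)
    show "0 \<in> V" unfolding V_def
      by (rule CollectI, rule exI[of _ 0], rule exI[of _ "\<lambda>_. 0"]) simp
    show "x + y \<in> V" if xy: "x \<in> V" "y \<in> V" for x y
    proof -
      obtain c0 c where c: "\<And>v. x v = scaleC c0 v + (\<Sum>j\<in>UNIV. scaleC (c j) (g j v))"
        using xy(1) unfolding V_def by blast
      obtain d0 d where d: "\<And>v. y v = scaleC d0 v + (\<Sum>j\<in>UNIV. scaleC (d j) (g j v))"
        using xy(2) unfolding V_def by blast
      show ?thesis unfolding V_def
        by (rule CollectI, rule exI[of _ "c0 + d0"], rule exI[of _ "\<lambda>j. c j + d j"])
          (simp add: c d scaleC_add_left sum.distrib algebra_simps)
    qed
    show "scaleC r x \<in> V" if x: "x \<in> V" for r x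
    proof -
      obtain c0 c where c: "\<And>v. x v = scaleC c0 v + (\<Sum>j\<in>UNIV. scaleC (c j) (g j v))"
        using x unfolding V_def by blast
      show ?thesis unfolding V_def
        by (rule CollectI, rule exI[of _ "r * c0"], rule exI[of _ "\<lambda>j. r * c j"])
          (simp add: scaleC_fun_def c scaleC_add_right cvs.scale_sum_right scaleC_scaleC)
    qed
  qed
  moreover have "insert id (range g) \<subseteq> V"
  proof -
    have "id \<in> V" unfolding V_def
      by (rule CollectI, rule exI[of _ 1], rule exI[of _ "\<lambda>_. 0"]) (simp add: scaleC_one)
    moreover have "g i \<in> V" for i
    proof -
      have "(\<Sum>j\<in>UNIV. scaleC (if j = i then 1 else 0) (g j v)) = g i v" for v
      proof -
        have "(\<Sum>j\<in>UNIV. scaleC (if j = i then 1 else 0) (g j v)) = (\<Sum>j\<in>UNIV. if j = i then g j v else 0)"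
          by (intro sum.cong) (auto simp: scaleC_one)
        then show ?thesis by simp
      qed
      then show ?thesis unfolding V_def
        by (intro CollectI exI[of _ 0] exI[of _ "\<lambda>j. if j = i then 1 else 0"]) simp
    qed
    ultimately show ?thesis by auto
  qed
  ultimately have "f \<in> V" using assms cvs.span_minimal by blast
  then show ?thesis by (simp add: V_def)
qed

text \<open>The value at a frame is a real-affine function of the three real sums
  \<open>G w\<close>, the identity contributing the constant \<open>k * c0 i\<close>. Such functions
  carry segments to segments.\<close>

lemma convex_joint_num_range:
  fixes A :: "'m::finite \<Rightarrow> 'a::complex_inner \<Rightarrow> 'a" and g :: "3 \<Rightarrow> 'a \<Rightarrow> 'a"
  assumes g: "\<And>j. clinear (g j)" "\<And>j. selfadjoint (g j)"
    and A: "\<And>i. A i \<in> cvs.span (insert id (range g))"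
    and k: "0 < k" and dim: "enat k < cdim (UNIV :: 'a set)"
    and z: "(\<forall>v. g 3 v = 0) \<or> 3 \<le> cdim (UNIV :: 'a set)"
  shows "convex (joint_num_range k A)"
proof -
  have "\<forall>i. \<exists>c0 c. \<forall>v. A i v = scaleC c0 v + (\<Sum>j\<in>UNIV. scaleC (c j) (g j v))"
    using cspan_insert_id_range[OF A] by blast
  then obtain c0 c where c: "\<And>i v. A i v = scaleC (c0 i) v + (\<Sum>j\<in>UNIV. scaleC (c i j) (g j v))"
    by metis
  define G where "G w = (\<Sum>l=1..k. form_vec g (w l))" for w
  define P where "P w = (\<chi> i. \<Sum>l=1..k. cinner (A i (w l)) (w l))" for w
  have P: "P w $ i = of_nat k * c0 i + (\<Sum>j\<in>UNIV. c i j * of_real (G w $ j))" if w: "orthonormal k w" for w i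
  proof -
    have "cinner (A i (w l)) (w l) = c0 i + (\<Sum>j\<in>UNIV. c i j * of_real (form_vec g (w l) $ j))"
      if "l \<in> {1..k}" for l
    proof -
      have "cinner (w l) (w l) = 1" using orthonormal_cinner[OF w that that] by simp
      moreover have "cinner (g j (w l)) (w l) = of_real (form_vec g (w l) $ j)" for j
        using selfadjoint_real[OF g(2), of j "w l"] by (simp add: form_vec_def)
      ultimately show ?thesis unfolding c by (simp add: cinner_simps)
    qed
    then have "P w $ i = (\<Sum>l=1..k. c0 i + (\<Sum>j\<in>UNIV. c i j * of_real (form_vec g (w l) $ j)))"
      unfolding P_def by (simp only: vec_lambda_beta) (intro sum.cong, auto)
    also have "\<dots> = of_nat k * c0 i + (\<Sum>j\<in>UNIV. \<Sum>l=1..k. c i j * of_real (form_vec g (w l) $ j))"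
      by (simp add: sum.distrib) (rule sum.swap)
    also have "\<dots> = of_nat k * c0 i + (\<Sum>j\<in>UNIV. c i j * of_real (G w $ j))"
      by (simp add: G_def sum_distrib_left)
    finally show ?thesis .
  qed
  show ?thesis
    unfolding convex_alt
  proof (intro ballI allI impI)
    fix p p' t assume pp: "p \<in> joint_num_range k A" "p' \<in> joint_num_range k A" and t: "0 \<le> t \<and> t \<le> (1::real)"
    obtain u where u: "orthonormal k u" "p = P u" using pp(1) unfolding joint_num_range_def P_def by blast
    obtain v where v: "orthonormal k v" "p' = P v" using pp(2) unfolding joint_num_range_def P_def by blast
    have t': "0 \<le> t" "t \<le> 1" using t by auto
    have "\<exists>w. orthonormal k w \<and> G w = (1 - t) *\<^sub>R G u + t *\<^sub>R G v"
      unfolding G_def by (rule frames_segment[where B = g, OF g u(1) v(1) k dim t' z])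
    then obtain w where w: "orthonormal k w" "G w = (1 - t) *\<^sub>R G u + t *\<^sub>R G v" by blast
    have "P w = (1 - t) *\<^sub>R P u + t *\<^sub>R P v"
    proof (subst vec_eq_iff, intro allI)
      fix i
      have "P w $ i = of_nat k * c0 i + (\<Sum>j\<in>UNIV. of_real (1 - t) * (c i j * of_real (G u $ j)) + of_real t * (c i j * of_real (G v $ j)))"
        unfolding P[OF w(1)] w(2) by (simp add: algebra_simps)
      also have "\<dots> = of_real (1 - t) * P u $ i + of_real t * P v $ i"
        unfolding P[OF u(1)] P[OF v(1)] sum.distrib sum_distrib_left[symmetric] by (simp add: algebra_simps)
      finally show "P w $ i = ((1 - t) *\<^sub>R P u + t *\<^sub>R P v) $ i"
        unfolding vector_add_component vector_scaleR_component
        unfolding scaleR_conv_of_real .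
    qed
    moreover have "P w \<in> joint_num_range k A"
      unfolding joint_num_range_def P_def using w(1) by blast
    ultimately show "(1 - t) *\<^sub>R p + t *\<^sub>R p' \<in> joint_num_range k A" using u v by simp
  qed
qed

text \<open>Lists a set of operators as an indexed family, padded with \<open>0\<close> so that
  nonzero entries occur only at indices in \<open>J\<close>.\<close>

lemma finite_set_subset_range:
  fixes X :: "'b::zero set" and J :: "'j::finite set"
  assumes "finite X" "card X \<le> card J"
  shows "\<exists>g :: 'j \<Rightarrow> 'b. X \<subseteq> range g \<and> range g \<subseteq> insert 0 X \<and> (\<forall>j. j \<notin> J \<longrightarrow> g j = 0)"
proof -
  obtain f where f: "f ` X \<subseteq> J" "inj_on f X"
    using card_le_inj[OF assms(1) finite assms(2)] by blast
  define g where "g j = (if j \<in> f ` X then inv_into X f j else 0)" for j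
  have "x \<in> range g" if "x \<in> X" for x
  proof -
    have "g (f x) = x" using that f(2) by (simp add: g_def)
    then show ?thesis by (metis rangeI)
  qed
  moreover have "g j \<in> insert 0 X" for j by (auto simp: g_def inv_into_into)
  moreover have "g j = 0" if "j \<notin> J" for j using that f(1) by (auto simp: g_def)
  ultimately show ?thesis by blast
qed

text \<open>The basis is drawn from the operators themselves, so it inherits self-adjointness
  although the span is complex. The vector \<open>x\<close> ensures \<open>id \<noteq> 0\<close>, so
  \<open>id\<close> can be kept.\<close>

lemma ex_basis_with_id:
  fixes A :: "'m::finite \<Rightarrow> 'a::complex_vector \<Rightarrow> 'a" and x :: 'a
  assumes "x \<noteq> 0"
  obtains B where "id \<in> B" "B \<subseteq> insert id (range A)" "cvs.independent B"
    "insert id (range A) \<subseteq> cvs.span B" "finite B"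
    "cdim (cvs.span (insert id (range A))) = enat (card B)"
proof -
  define S where "S = insert id (range A)"
  have "id \<noteq> (0 :: 'a \<Rightarrow> 'a)" using assms by (metis id_apply zero_fun_apply)
  then have ind: "cvs.independent {id :: 'a \<Rightarrow> 'a}" by (simp add: cvs.dependent_single)
  obtain B where B: "{id} \<subseteq> B" "B \<subseteq> S" "cvs.independent B" "S \<subseteq> cvs.span B"
    by (rule cvs.maximal_independent_subset_extend[OF _ ind, of S]) (auto simp: S_def)
  have fin: "finite B" using B(2) by (rule finite_subset) (simp add: S_def)
  have "cvs.span B = cvs.span S"
    using B(2,4) by (metis cvs.span_mono cvs.span_span subset_antisym)
  then have "cvs.dim S = card B" using cvs.dim_eq_card B(3) by blast
  then have "cdim (cvs.span S) = enat (card B)"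
    using cdim_eq_dim[OF fin, of "cvs.span S"] \<open>cvs.span B = cvs.span S\<close> by (simp add: cvs.dim_span)
  with B fin that show thesis unfolding S_def by blast
qed

lemma clinear_selfadjoint_zero:
  "clinear (0 :: 'a::complex_inner \<Rightarrow> 'a)" "selfadjoint (0 :: 'a \<Rightarrow> 'a)"
  by (simp_all add: clinear_def selfadjoint_def)

lemma convex_if_small_span:
  fixes A :: "'m::finite \<Rightarrow> 'a::complex_inner \<Rightarrow> 'a"
  assumes A: "\<And>i. clinear (A i)" "\<And>i. selfadjoint (A i)"
    and k: "0 < k" and dim: "enat k < cdim (UNIV :: 'a set)"
    and span: "cdim (cvs.span (insert id (range A))) \<le> 3
      \<or> 3 \<le> cdim (UNIV :: 'a set) \<and> cdim (cvs.span (insert id (range A))) \<le> 4"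
  shows "convex (joint_num_range k A)"
proof -
  have "orthonormal 0 (\<lambda>_. 0 :: 'a)" by (simp add: orthonormal_def)
  moreover have "enat 0 < cdim (UNIV :: 'a set)" using dim by (meson enat_ord_simps(1) le0 le_less_trans)
  ultimately obtain x :: 'a where "norm x = 1" by (rule ex_orthogonal)
  then have "x \<noteq> 0" by auto
  obtain B where B: "id \<in> B" "B \<subseteq> insert id (range A)" "cvs.independent B"
    "insert id (range A) \<subseteq> cvs.span B" "finite B"
    "cdim (cvs.span (insert id (range A))) = enat (card B)"
    using ex_basis_with_id[OF \<open>x \<noteq> 0\<close>] by blast
  define X where "X = B - {id}"
  have X: "finite X" "X \<subseteq> range A" "B \<subseteq> insert id X" "card B = Suc (card X)"
    using B(1,2,5) card.remove[OF B(5,1)] by (auto simp: X_def)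
  \<comment> \<open>With at most two operators besides the identity, index \<open>3\<close> receives
    the zero operator, which is what dimension two calls for.\<close>
  define J :: "3 set" where "J = (if card X \<le> 2 then UNIV - {3} else UNIV)"
  have cX: "card X \<le> 2 \<or> 3 \<le> cdim (UNIV :: 'a set) \<and> card X \<le> 3"
    using span unfolding B(6) X(4) by (simp add: numeral_eq_enat)
  have "card (UNIV - {3 :: 3}) = 2" by (subst card_Diff_singleton) simp_all
  with cX have "card X \<le> card J" unfolding J_def by (cases "card X \<le> 2") simp_all
  moreover have J: "3 \<notin> J \<or> 3 \<le> cdim (UNIV :: 'a set)"
    unfolding J_def using cX by (cases "card X \<le> 2") simp_all
  ultimately obtain g :: "3 \<Rightarrow> 'a \<Rightarrow> 'a" where g: "X \<subseteq> range g" "range g \<subseteq> insert 0 X" "\<forall>j. j \<notin> J \<longrightarrow> g j = 0"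
    using finite_set_subset_range[OF X(1)] by metis
  have gA: "clinear (g j) \<and> selfadjoint (g j)" for j
  proof -
    have "g j = 0 \<or> g j \<in> range A"
      using subsetD[OF g(2) rangeI[of g j]] subsetD[OF X(2), of "g j"] by (metis insertE)
    then show ?thesis
    proof
      assume "g j = 0"
      then show ?thesis by (simp only: clinear_selfadjoint_zero simp_thms)
    next
      assume "g j \<in> range A"
      then show ?thesis using A by (elim rangeE) simp
    qed
  qed
  have "A i \<in> cvs.span (insert id (range g))" for i
  proof -
    have "B \<subseteq> insert id (range g)"
      using X(3) insert_mono[OF g(1)] by (rule subset_trans)
    from subset_trans[OF B(4) cvs.span_mono[OF this]] show ?thesis by (rule subsetD) simp
  qed
  moreover have "(\<forall>v. g 3 v = 0) \<or> 3 \<le> cdim (UNIV :: 'a set)"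
  proof (cases "3 \<in> J")
    case True
    with J show ?thesis by simp
  next
    case False
    with g(3) have "g 3 = 0" by simp
    then show ?thesis by simp
  qed
  ultimately show ?thesis
    using gA by (intro convex_joint_num_range[of g] k dim) simp_all
qed

text \<open>Real combinations of \<open>id\<close> and three further basis operators form a
  four-dimensional real space of self-adjoint operators, to which the search for a separating plane
  applies.\<close>

lemma ex_separating_forms:
  fixes A :: "'m::finite \<Rightarrow> 'a::complex_inner \<Rightarrow> 'a"
  assumes A: "\<And>i. clinear (A i)" "\<And>i. selfadjoint (A i)"
    and dim: "2 \<le> cdim (UNIV :: 'a set)"
    and span: "4 \<le> cdim (cvs.span (insert id (range A)))"
  obtains h :: "real \<times> real \<times> complex \<Rightarrow> 'a \<Rightarrow> 'a" and F e f where "\<And>a. clinear (h a)" "\<And>a. selfadjoint (h a)"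
    "\<And>a v. h a v = scaleC (of_real (fst a)) v + (\<Sum>i\<in>UNIV. scaleC (of_real (F a i)) (A i v))"
    "norm e = 1" "norm f = 1" "cinner e f = 0" "surj (restr h e f)"
proof -
  have "enat 2 \<le> cdim (UNIV :: 'a set)" using dim by (simp add: numeral_eq_enat)
  moreover have "orthonormal 0 (\<lambda>_. 0 :: 'a)" by (simp add: orthonormal_def)
  ultimately obtain w :: "nat \<Rightarrow> 'a" where w: "orthonormal 2 w"
    using ex_orthonormal_extension[of 0 "\<lambda>_. 0" 2] by blast
  have xy: "norm (w 1) = 1" "norm (w 2) = 1" "cinner (w 1) (w 2) = 0"
    using orthonormal_norm[OF w] orthonormal_cinner[OF w, of 1 2] by auto
  have "w 1 \<noteq> 0" using xy(1) by auto
  obtain B where B: "id \<in> B" "B \<subseteq> insert id (range A)" "cvs.independent B"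
    "insert id (range A) \<subseteq> cvs.span B" "finite B"
    "cdim (cvs.span (insert id (range A))) = enat (card B)"
    using ex_basis_with_id[OF \<open>w 1 \<noteq> 0\<close>] by blast
  have "3 \<le> card (B - {id})"
    using span B(1,5) unfolding B(6) by (simp add: numeral_eq_enat)
  then obtain X where X: "X \<subseteq> B - {id}" "card X = 3" "finite X"
    by (rule obtain_subset_with_card_n)
  then obtain f1 f2 f3 where f: "X = {f1, f2, f3}" "f1 \<noteq> f2" "f2 \<noteq> f3" "f1 \<noteq> f3"
    using card_3_iff[of X] by auto
  have "X \<subseteq> range A" using X(1) B(2) by blast
  then have "f1 \<in> range A" "f2 \<in> range A" "f3 \<in> range A" unfolding f(1) by simp_all
  then obtain i1 i2 i3 where i: "f1 = A i1" "f2 = A i2" "f3 = A i3"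
    by (elim rangeE)
  have di: "i1 \<noteq> i2" "i2 \<noteq> i3" "i1 \<noteq> i3" using f i by auto
  define F where "F a i = (if i = i1 then fst (snd a) else if i = i2 then Re (snd (snd a))
      else if i = i3 then Im (snd (snd a)) else 0)" for a :: "real \<times> real \<times> complex" and i
  define h where "h a v = scaleC (of_real (fst a)) v + (\<Sum>i\<in>UNIV. scaleC (of_real (F a i)) (A i v))" for a v
  have cl: "clinear (h a)" for a
    unfolding clinear_def h_def
    by (auto simp: clinear_add[OF A(1)] clinear_scaleC[OF A(1)] cvs.scale_right_distrib sum.distrib
        scaleC_scaleC cvs.scale_sum_right mult_ac)
  have sa: "selfadjoint (h a)" for a
    using A(2) by (simp add: selfadjoint_def h_def cinner_simps)
  have lin: "linear (\<lambda>a. h a v)" for v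
  proof (rule linearI)
    have "F (a + b) i = F a i + F b i" "F (r *\<^sub>R a) i = r * F a i" for a b r i
      by (simp_all add: F_def)
    then show "h (a + b) v = h a v + h b v" "h (r *\<^sub>R a) v = r *\<^sub>R h a v" for a b r
      by (simp_all add: h_def scaleC_add_left sum.distrib scaleR_scaleC scaleC_add_right
          cvs.scale_sum_right scaleC_scaleC)
  qed
  have id: "h (1, 0, 0) v = v" for v
  proof -
    have "F (1, 0, 0) i = 0" for i by (auto simp: F_def)
    then show ?thesis by (simp add: h_def scaleC_one)
  qed
  have inj: "a = 0" if a: "\<And>v. h a v = 0" for a
  proof -
    \<comment> \<open>The same coefficients as a function of the operator, so that independence of
      \<open>B\<close> can be applied.\<close>
    define u where "u p = (if p = id then of_real (fst a) else if p = f1 then of_real (fst (snd a))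
      else if p = f2 then of_real (Re (snd (snd a))) else if p = f3 then of_real (Im (snd (snd a))) else (0::complex))" for p
    have nid: "f1 \<noteq> id" "f2 \<noteq> id" "f3 \<noteq> id" using X(1) f(1) by auto
    have "(\<Sum>i\<in>UNIV. scaleC (of_real (F a i)) (A i v)) = scaleC (u f1) (f1 v) + scaleC (u f2) (f2 v) + scaleC (u f3) (f3 v)" for v
    proof -
      have "(\<Sum>i\<in>UNIV. scaleC (of_real (F a i)) (A i v)) = (\<Sum>i\<in>{i1, i2, i3}. scaleC (of_real (F a i)) (A i v))"
        by (intro sum.mono_neutral_right) (auto simp: F_def)
      then show ?thesis using di f nid by (simp add: F_def u_def i add.assoc)
    qed
    then have 0: "scaleC (u id) v + (scaleC (u f1) (f1 v) + scaleC (u f2) (f2 v) + scaleC (u f3) (f3 v)) = 0" for v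
      using a[of v] by (simp add: h_def u_def)
    have "(\<Sum>p\<in>insert id X. scaleC (u p) p) = 0"
    proof (rule ext)
      fix v
      show "(\<Sum>p\<in>insert id X. scaleC (u p) p) v = 0 v"
        using 0[of v] nid f by (simp add: scaleC_fun_def add.assoc)
    qed
    then have "u p = 0" if "p \<in> insert id X" for p
      using cvs.independentD[OF B(3), of "insert id X" u p] X(1,3) B(1) that by blast
    then have "u id = 0" "u f1 = 0" "u f2 = 0" "u f3 = 0" using f(1) by auto
    then show "a = 0" using nid f by (simp add: u_def prod_eq_iff complex_eq_iff)
  qed
  obtain e f where ef: "norm e = 1" "norm f = 1" "cinner e f = 0" "surj (restr h e f)"
    using ex_orthonormal_injective_restr[where h = h, OF lin cl sa id inj xy] by blast
  show thesis by (rule that[of h F e f, OF cl sa h_def ef])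
qed

lemma ex_frame_ending_with:
  fixes e f :: "'a::complex_inner"
  assumes ef: "norm e = 1" "norm f = 1" "cinner e f = 0"
    and dim: "enat (Suc (Suc q)) \<le> cdim (UNIV :: 'a set)"
  obtains x where "orthonormal (Suc (Suc q)) x" "x (Suc q) = e" "x (Suc (Suc q)) = f"
proof -
  have "cinner e e = 1" "cinner f f = 1" "cinner f e = 0"
    using ef cinner_zero_commute[of e f] by (simp_all add: cinner_eq_one_iff)
  then have "orthonormal 2 (\<lambda>l. if l = 1 then e else f)"
    using ef(3) by (auto simp: orthonormal_def)
  then obtain r where r: "orthonormal (Suc (Suc q)) r" "\<And>l. l \<in> {1..2} \<Longrightarrow> r l = (if l = 1 then e else f)"
    using ex_orthonormal_extension[of 2 _ "Suc (Suc q)"] dim by fastforce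
  have re: "r 1 = e" "r 2 = f" using r(2)[of 1] r(2)[of 2] by auto
  \<comment> \<open>A cyclic shift: positions \<open>q + 1\<close> and \<open>q + 2\<close> receive
    the first two vectors \<open>e\<close> and \<open>f\<close> of \<open>r\<close>.\<close>
  define \<pi> where "\<pi> l = (if l \<le> q then l + 2 else l - q)" for l :: nat
  have \<pi>: "\<pi> l \<in> {1..Suc (Suc q)}" "\<pi> l = \<pi> m \<longleftrightarrow> l = m"
    if "l \<in> {1..Suc (Suc q)}" "m \<in> {1..Suc (Suc q)}" for l m
    using that by (auto simp: \<pi>_def)
  show thesis
  proof (rule that[of "\<lambda>l. r (\<pi> l)"])
    show "orthonormal (Suc (Suc q)) (\<lambda>l. r (\<pi> l))"
      unfolding orthonormal_def using orthonormal_cinner[OF r(1) \<pi>(1) \<pi>(1)] \<pi>(2) by auto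
  qed (use re in \<open>simp_all add: \<pi>_def numeral_2_eq_2\<close>)
qed

section \<open>The equivalence in dimension two, sufficiency and sharpness\<close>

theorem proposition3p1:
  fixes A :: "'m::finite \<Rightarrow> 'a::complex_hilbert \<Rightarrow> 'a"
    and k :: nat
  assumes "0 < k"
    and "enat k < cdim (UNIV :: 'a set)"
    and "\<And>i. bounded_clinear (A i)"
    and "\<And>i. selfadjoint (A i)"
  shows
    "(cdim (UNIV :: 'a set) = 2 \<longrightarrow>
        (convex (joint_num_range k A) \<longleftrightarrow> cdim (cvs.span (insert id (range A))) \<le> 3))
     \<and> (cdim (UNIV :: 'a set) \<ge> 3 \<longrightarrow>
        (cdim (cvs.span (insert id (range A))) \<le> 4 \<longrightarrow> convex (joint_num_range k A))
        \<and> (\<forall>B :: 3 \<Rightarrow> 'a \<Rightarrow> 'a. (\<forall>i. bounded_clinear (B i) \<and> selfadjoint (B i)) \<longrightarrow>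
              convex (joint_num_range k B)))
     \<and> (cdim (UNIV :: 'a set) \<ge> 3 \<longrightarrow>
        cdim (cvs.span (insert id (range A))) \<ge> 4 \<longrightarrow>
        (\<exists>A0. bounded_clinear A0 \<and> \<not> convex (joint_num_range k (case_option A0 A))))"
proof (intro conjI impI allI)
  have cl: "clinear (A i)" for i by (rule bounded_clinear_imp_clinear[OF assms(3)])
  obtain q where q: "k = Suc q" using assms(1) by (cases k) auto
  have dimq: "enat (Suc (Suc q)) \<le> cdim (UNIV :: 'a set)"
    using assms(2) unfolding q by (simp add: Suc_ile_eq)
  have not4: "n \<le> 3 \<or> 4 \<le> n" for n :: enat
    by (cases n) (auto simp: numeral_eq_enat)
  show "convex (joint_num_range k A) \<longleftrightarrow> cdim (cvs.span (insert id (range A))) \<le> 3"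
    if dim: "cdim (UNIV :: 'a set) = 2"
  proof
    assume "cdim (cvs.span (insert id (range A))) \<le> 3"
    then show "convex (joint_num_range k A)"
      by (intro convex_if_small_span cl assms(1,2,4) disjI1)
  next
    assume conv: "convex (joint_num_range k A)"
    \<comment> \<open>In dimension two only \<open>k = 1\<close> occurs.\<close>
    have q0: "q = 0" using dimq unfolding dim by (simp add: numeral_eq_enat)
    show "cdim (cvs.span (insert id (range A))) \<le> 3"
    proof (rule ccontr)
      assume "\<not> cdim (cvs.span (insert id (range A))) \<le> 3"
      then have 4: "4 \<le> cdim (cvs.span (insert id (range A)))" using not4 by blast
      have "2 \<le> cdim (UNIV :: 'a set)" by (simp add: dim)
      then obtain h :: "real \<times> real \<times> complex \<Rightarrow> 'a \<Rightarrow> 'a" and F e f where h: "\<And>a. clinear (h a)" "\<And>a. selfadjoint (h a)"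
        "\<And>a v. h a v = scaleC (of_real (fst a)) v + (\<Sum>i\<in>UNIV. scaleC (of_real (F a i)) (A i v))"
        "norm e = 1" "norm f = 1" "cinner e f = 0" "surj (restr h e f)"
        using ex_separating_forms[where A = A, OF cl assms(4) _ 4] by blast
      obtain x where x: "orthonormal (Suc (Suc q)) x" "x (Suc q) = e" "x (Suc (Suc q)) = f"
        using ex_frame_ending_with[OF h(4-6) dimq] by blast
      have "\<not> convex (joint_num_range (Suc q) A)"
      proof (rule not_convex_joint_num_range[where h = h and A = A and F = F, OF x(1) h(1,2) cl h(3)])
        fix y :: "nat \<Rightarrow> 'a" assume y: "orthonormal (Suc q) y"
        \<comment> \<open>Here \<open>x 1\<close> and \<open>x 2\<close> span the whole space, so
          every unit vector satisfies the trace condition.\<close>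
        have "cdim (UNIV :: 'a set) \<le> enat (Suc (Suc q))" by (simp add: dim q0 numeral_eq_enat)
        from proj_full[OF x(1) this, of "y 1"]
        have "(\<Sum>l=1..Suc (Suc q). (cmod (cinner (y 1) (x l)))\<^sup>2) = (norm (y 1))\<^sup>2"
          using proj_eq_iff[OF x(1)] by blast
        also have "norm (y 1) = 1" using orthonormal_norm[OF y, of 1] by simp
        finally show "2 * real q + 1 \<le> (\<Sum>j=1..Suc q. (\<Sum>l=1..Suc (Suc q). (cmod (cinner (y j) (x l)))\<^sup>2)
            + (\<Sum>l=1..q. (cmod (cinner (y j) (x l)))\<^sup>2))"
          by (simp add: q0)
      qed (use h(7) x in simp)
      with conv show False by (simp add: q)
    qed
  qed
  show "convex (joint_num_range k A)"
    if "cdim (UNIV :: 'a set) \<ge> 3" "cdim (cvs.span (insert id (range A))) \<le> 4"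
    using that by (intro convex_if_small_span cl assms(1,2,4) disjI2 conjI)
  show "convex (joint_num_range k B)"
    if "cdim (UNIV :: 'a set) \<ge> 3" "\<forall>i. bounded_clinear (B i) \<and> selfadjoint (B i)" for B :: "3 \<Rightarrow> 'a \<Rightarrow> 'a"
  \<comment> \<open>A triple is its own generating family, whatever the dimension of its
    span.\<close>
  proof (rule convex_joint_num_range[of B])
    show "B i \<in> cvs.span (insert id (range B))" for i by (intro cvs.span_base) auto
  qed (use that bounded_clinear_imp_clinear assms(1,2) in auto)
  show "\<exists>A0. bounded_clinear A0 \<and> \<not> convex (joint_num_range k (case_option A0 A))"
    if dim: "cdim (UNIV :: 'a set) \<ge> 3" and 4: "cdim (cvs.span (insert id (range A))) \<ge> 4"
  proof -
    have "2 \<le> cdim (UNIV :: 'a set)" using dim by (rule order.trans[rotated]) (simp add: numeral_eq_enat)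
    then obtain h :: "real \<times> real \<times> complex \<Rightarrow> 'a \<Rightarrow> 'a" and F e f where h: "\<And>a. clinear (h a)" "\<And>a. selfadjoint (h a)"
      "\<And>a v. h a v = scaleC (of_real (fst a)) v + (\<Sum>i\<in>UNIV. scaleC (of_real (F a i)) (A i v))"
      "norm e = 1" "norm f = 1" "cinner e f = 0" "surj (restr h e f)"
      using ex_separating_forms[where A = A, OF cl assms(4) _ 4] by blast
    obtain x where x: "orthonormal (Suc (Suc q)) x" "x (Suc q) = e" "x (Suc (Suc q)) = f"
      using ex_frame_ending_with[OF h(4-6) dimq] by blast
    \<comment> \<open>Eigenvalue \<open>2\<close> on \<open>x 1, ..., x q\<close>, \<open>1\<close>
      on the plane of \<open>e\<close> and \<open>f\<close>, and \<open>0\<close> on the orthogonal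
      complement, so the trace over a \<open>k\<close>-frame is at most
      \<open>2 * q + 1\<close>.\<close>
    define A0 where "A0 v = proj (Suc (Suc q)) x v + proj q x v" for v
    have bA0: "bounded_clinear A0"
      unfolding A0_def by (intro bounded_clinear_add bounded_clinear_proj)
    define A' where "A' = case_option A0 A"
    have clA': "clinear (A' i)" for i
      using cl bounded_clinear_imp_clinear[OF bA0] by (cases i) (simp_all add: A'_def)
    \<comment> \<open>Coefficient \<open>0\<close> at \<open>A0\<close>: the separating forms remain
      combinations of the given operators.\<close>
    define F' where "F' a = case_option 0 (F a)" for a
    have hA': "h a v = scaleC (of_real (fst a)) v + (\<Sum>i\<in>UNIV. scaleC (of_real (F' a i)) (A' i v))" for a v
      unfolding h(3) UNIV_option_conv F'_def A'_def by (simp add: sum.reindex)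
    have A0y: "cinner (A0 v) v = of_real ((\<Sum>l=1..Suc (Suc q). (cmod (cinner v (x l)))\<^sup>2)
        + (\<Sum>l=1..q. (cmod (cinner v (x l)))\<^sup>2))" for v
      unfolding A0_def cinner_add_left cinner_proj_self by simp
    have A0x: "cinner (A0 (x m)) (x m) = (if m \<le> q then 2 else 1)" if "m \<in> {1..Suc (Suc q)}" for m
    proof -
      have "(\<Sum>l=1..j. (cmod (cinner (x m) (x l)))\<^sup>2) = (if m \<le> j then 1 else 0)" if "j \<le> Suc (Suc q)" for j
      proof -
        have "(\<Sum>l=1..j. (cmod (cinner (x m) (x l)))\<^sup>2) = (\<Sum>l=1..j. if m = l then 1 else 0)"
          using orthonormal_cinner[OF x(1) \<open>m \<in> {1..Suc (Suc q)}\<close>] that by (intro sum.cong) auto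
        also have "\<dots> = (if m \<le> j then 1 else 0)" using \<open>m \<in> {1..Suc (Suc q)}\<close> by simp
        finally show ?thesis .
      qed
      from this[of q] this[of "Suc (Suc q)"] show ?thesis
        unfolding A0y using that by (simp only:) auto
    qed
    have "\<not> convex (joint_num_range (Suc q) A')"
    proof (rule not_convex_joint_num_range[where h = h and A = A' and F = F', OF x(1) h(1,2) clA' hA'])
      fix y :: "nat \<Rightarrow> 'a" assume y: "orthonormal (Suc q) y"
        and mid: "\<And>i. (\<Sum>j=1..Suc q. cinner (A' i (y j)) (y j)) = (\<Sum>l=1..q. cinner (A' i (x l)) (x l))
          + (cinner (A' i (x (Suc q))) (x (Suc q)) + cinner (A' i (x (Suc (Suc q)))) (x (Suc (Suc q)))) / 2"
      have "(\<Sum>l=1..q. cinner (A0 (x l)) (x l)) = (\<Sum>l=1..q. 2)"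
        using A0x by (intro sum.cong) auto
      \<comment> \<open>At the midpoint, the coordinate of \<open>A0\<close> is
        \<open>2 * q + (1 + 1) / 2\<close>, the maximal trace.\<close>
      then have "(\<Sum>j=1..Suc q. cinner (A0 (y j)) (y j)) = of_real (2 * real q + 1)"
        using mid[of None] A0x[of "Suc q"] A0x[of "Suc (Suc q)"] by (simp add: A'_def)
      then have "(\<Sum>j=1..Suc q. (\<Sum>l=1..Suc (Suc q). (cmod (cinner (y j) (x l)))\<^sup>2)
          + (\<Sum>l=1..q. (cmod (cinner (y j) (x l)))\<^sup>2)) = 2 * real q + 1"
        unfolding A0y of_real_sum[symmetric] of_real_eq_iff .
      then show "2 * real q + 1 \<le> (\<Sum>j=1..Suc q. (\<Sum>l=1..Suc (Suc q). (cmod (cinner (y j) (x l)))\<^sup>2)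
          + (\<Sum>l=1..q. (cmod (cinner (y j) (x l)))\<^sup>2))" by linarith
    qed (use h(7) x in simp)
    with bA0 show ?thesis unfolding A'_def q by blast
  qed
qed

end
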